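(* Let $F:M^3\to\mathbb{R}^4$ be a locally strictly convex affine hypersurface. Then $F$ admits a pointwise $Z_2\times Z_2$-symmetry if and only if it is (locally) affine equivalent to $$\left(x_1-\tfrac12 x_3^2\right)\left(x_2-\tfrac12 x_4^2\right)=1,$$ i.e. if and only if every point of $M^3$ has a neighbourhood $U$ for which there is an affine transformation $A$ of $\mathbb{R}^4$ such that $A(F(U))$ is contained in the hypersurface $\{x\in\mathbb{R}^4 : (x_1-\tfrac12 x_3^2)(x_2-\tfrac12 x_4^2)=1\}$.
   Context: A nondegenerate affine hypersurface $F:M^3\to\mathbb{R}^4$ is an immersion which carries the (equi)affine (Blaschke) normal field $\xi$, inducing $\nabla$, $h$, $S$ by $D_XY=\nabla_XY+h(X,Y)\xi$, $D_X\xi=-SX$ ($D$ the flat connection of $\mathbb{R}^4$), where $h$ (affine metric) is nondegenerate and $|\det(X_1,X_2,X_3,\xi)|=1$ for $h$-orthonormal $X_1,X_2,X_3$; $S$ is the affine shape operator. The difference tensor is $K(X,Y)=\nabla_XY-\widehat\nabla_XY$, with $\widehat\nabla$ the Levi-Civita connection of $h$; $h(K(X,Y),Z)$ is totally symmetric and $\operatorname{trace}K_X=0$. Locally strictly convex means that $h$ is definite, with $\xi$ chosen so that $h$ is positive definite. For $p\in M$, $G_p$ is the group of orientation-preserving linear isometries $g$ of $(T_pM,h)$ satisfying $K(gX,gY)=gK(X,Y)$ and $S(gX)=gS(X)$ for all $X,Y\in T_pM$. $M$ admits a pointwise $Z_2\times Z_2$-symmetry if for every $p\in M$ there is an $h$-orthonormal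 basis $\{e_1,e_2,e_3\}$ of $T_pM$ such that $G_p$ is the group of order 4 consisting of the identity and the rotations by $\pi$ about $e_1$, $e_2$, $e_3$. *)

theory Defs
  imports "HOL-Analysis.Analysis"
begin

section \<open>Smooth maps and smooth 3-manifolds\<close>

text \<open>Directional derivative at \<open>u\<close> in direction \<open>X\<close>.\<close>

abbreviation DD :: "('a::real_normed_vector \<Rightarrow> 'b::real_normed_vector) \<Rightarrow> 'a \<Rightarrow> 'a \<Rightarrow> 'b"
  where "DD f u X \<equiv> frechet_derivative f (at u) X"

text \<open>The following notions are meant for open subsets of a Euclidean space, where they are the
  usual \<open>C\<^sup>k\<close> and \<open>C\<^sup>\<infinity>\<close>.\<close>

primrec Ck_on :: "nat \<Rightarrow> 'a::real_normed_vector set \<Rightarrow> ('a \<Rightarrow> 'b::real_normed_vector) \<Rightarrow> bool" where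
  "Ck_on 0 \<Omega> f \<longleftrightarrow> continuous_on \<Omega> f"
| "Ck_on (Suc k) \<Omega> f \<longleftrightarrow>
     (\<forall>u\<in>\<Omega>. f differentiable (at u)) \<and> (\<forall>X. Ck_on k \<Omega> (\<lambda>u. DD f u X))"

definition smooth_on :: "'a::real_normed_vector set \<Rightarrow> ('a \<Rightarrow> 'b::real_normed_vector) \<Rightarrow> bool" where
  "smooth_on \<Omega> f \<longleftrightarrow> (\<forall>k. Ck_on k \<Omega> f)"

text \<open>A chart is a pair of a domain and a coordinate map; values of the coordinate map outside the
  domain are irrelevant.\<close>

type_synonym 'm chart = "'m set \<times> ('m \<Rightarrow> real^3)"

definition chart_image :: "'m chart \<Rightarrow> (real^3) set" where
  "chart_image c = snd c ` fst c"

text \<open>The coordinate expression \<open>G \<circ> \<phi>\<inverse>\<close> of a map \<open>G\<close> in the chart \<open>(U, \<phi>)\<close>.\<close>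

definition in_chart :: "'m chart \<Rightarrow> ('m \<Rightarrow> 'b) \<Rightarrow> real^3 \<Rightarrow> 'b" where
  "in_chart c G = G \<circ> inv_into (fst c) (snd c)"

text \<open>A 3-manifold is given by a smooth atlas \<open>A\<close> on a Hausdorff, second countable space; its set of
  points is the (open) union of the chart domains.\<close>

definition manifold_points :: "'m chart set \<Rightarrow> 'm set" where
  "manifold_points A = \<Union> (fst ` A)"

definition smooth_atlas :: "'m::{t2_space, second_countable_topology} chart set \<Rightarrow> bool" where
  "smooth_atlas A \<longleftrightarrow>
     (\<forall>c\<in>A. open (fst c) \<and> open (chart_image c) \<and>
        (\<exists>\<psi>. homeomorphism (fst c) (chart_image c) (snd c) \<psi>)) \<and>
     (\<forall>c\<in>A. \<forall>d\<in>A. smooth_on (snd c ` (fst c \<inter> fst d)) (in_chart c (snd d)))"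

definition smooth_map :: "'m chart set \<Rightarrow> ('m \<Rightarrow> 'b::real_normed_vector) \<Rightarrow> bool" where
  "smooth_map A G \<longleftrightarrow> (\<forall>c\<in>A. smooth_on (chart_image c) (in_chart c G))"

definition immersion :: "'m chart set \<Rightarrow> ('m \<Rightarrow> real^4) \<Rightarrow> bool" where
  "immersion A F \<longleftrightarrow>
     smooth_map A F \<and> (\<forall>c\<in>A. \<forall>u\<in>chart_image c. inj (DD (in_chart c F) u))"


section \<open>Induced structure in a chart\<close>

text \<open>
  Here \<open>f\<close> and \<open>\<eta>\<close> are the coordinate expressions of the immersion \<open>F\<close> and of a transversal field
  \<open>\<xi>\<close>. A tangent vector at the point with coordinates \<open>u\<close> is represented by its coordinate vector in
  \<open>real^3\<close>; it is mapped to \<open>DD f u X\<close> by the differential of \<open>F\<close>. Vectors \<open>Y\<close> are extended to vector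
  fields with constant coordinates, so the formula of Gauss \<open>D\<^sub>X Y = \<nabla>\<^sub>X Y + h(X,Y) \<xi>\<close> reads
  \<open>D\<^sub>X (DD f Y) = DD f (\<Gamma>(X,Y)) + h(X,Y) \<eta>\<close>, where \<open>\<Gamma>(X,Y)\<close> collects the Christoffel symbols of
  \<open>\<nabla>\<close>; likewise \<open>D\<^sub>X \<xi> = - S X\<close>. The descriptions are unique when \<open>f\<close> is an immersion and \<open>\<eta>\<close> is
  transversal (for \<open>S\<close>: and the derivative of \<open>\<eta>\<close> is tangential).
\<close>

definition second_derivative :: "(real^3 \<Rightarrow> real^4) \<Rightarrow> real^3 \<Rightarrow> real^3 \<Rightarrow> real^3 \<Rightarrow> real^4" where
  "second_derivative f u X Y = DD (\<lambda>w. DD f w Y) u X"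

definition affine_metric ::
    "(real^3 \<Rightarrow> real^4) \<Rightarrow> (real^3 \<Rightarrow> real^4) \<Rightarrow> real^3 \<Rightarrow> real^3 \<Rightarrow> real^3 \<Rightarrow> real" where
  "affine_metric f \<eta> u X Y =
     (THE a. \<exists>Z. second_derivative f u X Y = DD f u Z + a *\<^sub>R \<eta> u)"

definition induced_christoffel ::
    "(real^3 \<Rightarrow> real^4) \<Rightarrow> (real^3 \<Rightarrow> real^4) \<Rightarrow> real^3 \<Rightarrow> real^3 \<Rightarrow> real^3 \<Rightarrow> real^3" where
  "induced_christoffel f \<eta> u X Y =
     (THE Z. \<exists>a. second_derivative f u X Y = DD f u Z + a *\<^sub>R \<eta> u)"

definition shape_operator ::
    "(real^3 \<Rightarrow> real^4) \<Rightarrow> (real^3 \<Rightarrow> real^4) \<Rightarrow> real^3 \<Rightarrow> real^3 \<Rightarrow> real^3" where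
  "shape_operator f \<eta> u X = (THE Z. DD \<eta> u X = - DD f u Z)"

text \<open>
  Christoffel symbols of the Levi-Civita connection \<open>\<nabla>\<^sub>X Y = D\<^sub>X Y + \<Gamma>(X,Y)\<close> of a metric \<open>h\<close> on an open
  set of \<open>real^3\<close>: symmetry of \<open>\<Gamma>\<close> means that the torsion vanishes, the second condition means that
  \<open>h\<close> is parallel.
\<close>

definition levi_civita_christoffel ::
    "(real^3 \<Rightarrow> real^3 \<Rightarrow> real^3 \<Rightarrow> real) \<Rightarrow> real^3 \<Rightarrow> real^3 \<Rightarrow> real^3 \<Rightarrow> real^3" where
  "levi_civita_christoffel h u = (THE \<Gamma>.
     (\<forall>X Y. \<Gamma> X Y = \<Gamma> Y X) \<and>
     (\<forall>X Y Z. DD (\<lambda>w. h w Y Z) u X = h u (\<Gamma> X Y) Z + h u Y (\<Gamma> X Z)))"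

definition difference_tensor ::
    "(real^3 \<Rightarrow> real^4) \<Rightarrow> (real^3 \<Rightarrow> real^4) \<Rightarrow> real^3 \<Rightarrow> real^3 \<Rightarrow> real^3 \<Rightarrow> real^3" where
  "difference_tensor f \<eta> u X Y =
     induced_christoffel f \<eta> u X Y - levi_civita_christoffel (affine_metric f \<eta>) u X Y"

text \<open>For indefinite \<open>h\<close>, orthonormal means \<open>h(e\<^sub>i, e\<^sub>i) = 1\<close> or \<open>-1\<close>.\<close>

definition orthonormal3 ::
    "(real^3 \<Rightarrow> real^3 \<Rightarrow> real) \<Rightarrow> real^3 \<Rightarrow> real^3 \<Rightarrow> real^3 \<Rightarrow> bool" where
  "orthonormal3 h e1 e2 e3 \<longleftrightarrow>
     \<bar>h e1 e1\<bar> = 1 \<and> \<bar>h e2 e2\<bar> = 1 \<and> \<bar>h e3 e3\<bar> = 1 \<and>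
     h e1 e2 = 0 \<and> h e1 e3 = 0 \<and> h e2 e3 = 0"


section \<open>Affine hypersurfaces\<close>

text \<open>\<open>\<xi>\<close> is the (equiaffine) Blaschke normal field of the nondegenerate immersion \<open>F\<close>.\<close>

definition affine_normal :: "'m chart set \<Rightarrow> ('m \<Rightarrow> real^4) \<Rightarrow> ('m \<Rightarrow> real^4) \<Rightarrow> bool" where
  "affine_normal A F \<xi> \<longleftrightarrow> smooth_map A \<xi> \<and>
     (\<forall>c\<in>A. \<forall>u\<in>chart_image c.
        let f = in_chart c F; \<eta> = in_chart c \<xi>; h = affine_metric f \<eta> u in
          \<eta> u \<notin> range (DD f u) \<and>
          (\<forall>X. DD \<eta> u X \<in> range (DD f u)) \<and>
          (\<forall>X. (\<forall>Y. h X Y = 0) \<longrightarrow> X = 0) \<and>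
          (\<forall>X1 X2 X3. orthonormal3 h X1 X2 X3 \<longrightarrow>
             \<bar>det (vector [DD f u X1, DD f u X2, DD f u X3, \<eta> u] :: real^4^4)\<bar> = 1))"

definition affine_hypersurface :: "'m chart set \<Rightarrow> ('m \<Rightarrow> real^4) \<Rightarrow> ('m \<Rightarrow> real^4) \<Rightarrow> bool" where
  "affine_hypersurface A F \<xi> \<longleftrightarrow> immersion A F \<and> affine_normal A F \<xi>"

text \<open>The definiteness of \<open>h\<close>, with the sign of \<open>\<xi>\<close> chosen such that \<open>h\<close> is positive definite.\<close>

definition locally_strictly_convex :: "'m chart set \<Rightarrow> ('m \<Rightarrow> real^4) \<Rightarrow> ('m \<Rightarrow> real^4) \<Rightarrow> bool" where
  "locally_strictly_convex A F \<xi> \<longleftrightarrow>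
     (\<forall>c\<in>A. \<forall>u\<in>chart_image c. \<forall>X. X \<noteq> 0 \<longrightarrow>
        affine_metric (in_chart c F) (in_chart c \<xi>) u X X > 0)"


section \<open>Pointwise symmetry\<close>

text \<open>The group \<open>G\<^sub>p\<close>, in terms of the coordinates of tangent vectors at \<open>p\<close> in a chart.\<close>

definition symmetry_group ::
    "(real^3 \<Rightarrow> real^3 \<Rightarrow> real) \<Rightarrow> (real^3 \<Rightarrow> real^3 \<Rightarrow> real^3) \<Rightarrow> (real^3 \<Rightarrow> real^3)
      \<Rightarrow> (real^3 \<Rightarrow> real^3) set" where
  "symmetry_group h K S = {g. linear g \<and> det (matrix g) > 0 \<and>
     (\<forall>X Y. h (g X) (g Y) = h X Y) \<and>
     (\<forall>X Y. K (g X) (g Y) = g (K X Y)) \<and>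
     (\<forall>X. S (g X) = g (S X))}"

text \<open>Rotation by \<open>\<pi>\<close> about the \<open>h\<close>-unit vector \<open>e\<close>: it fixes \<open>e\<close> and is minus the identity on the
  \<open>h\<close>-orthogonal complement of \<open>e\<close>.\<close>

definition half_turn :: "(real^3 \<Rightarrow> real^3 \<Rightarrow> real) \<Rightarrow> real^3 \<Rightarrow> real^3 \<Rightarrow> real^3" where
  "half_turn h e X = (2 * h X e) *\<^sub>R e - X"

definition pointwise_Z2xZ2_symmetry ::
    "'m chart set \<Rightarrow> ('m \<Rightarrow> real^4) \<Rightarrow> ('m \<Rightarrow> real^4) \<Rightarrow> bool" where
  "pointwise_Z2xZ2_symmetry A F \<xi> \<longleftrightarrow>
     (\<forall>p\<in>manifold_points A. \<forall>c\<in>A. p \<in> fst c \<longrightarrow>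
        (let f = in_chart c F; \<eta> = in_chart c \<xi>; u = snd c p;
             h = affine_metric f \<eta> u; K = difference_tensor f \<eta> u; S = shape_operator f \<eta> u in
           \<exists>e1 e2 e3. orthonormal3 h e1 e2 e3 \<and>
             symmetry_group h K S = {id, half_turn h e1, half_turn h e2, half_turn h e3}))"


section \<open>The model hypersurface\<close>

definition model_hypersurface :: "(real^4) set" where
  "model_hypersurface = {x. (x$1 - 1/2 * (x$3)^2) * (x$2 - 1/2 * (x$4)^2) = 1}"

definition affine_transformation :: "(real^4 \<Rightarrow> real^4) \<Rightarrow> bool" where
  "affine_transformation T \<longleftrightarrow> (\<exists>L b. linear L \<and> bij L \<and> T = (\<lambda>x. L x + b))"

definition locally_affine_equivalent_to ::
    "'m::topological_space chart set \<Rightarrow> ('m \<Rightarrow> real^4) \<Rightarrow> (real^4) set \<Rightarrow> bool" where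
  "locally_affine_equivalent_to A F H \<longleftrightarrow>
     (\<forall>p\<in>manifold_points A. \<exists>U T. open U \<and> p \<in> U \<and> U \<subseteq> manifold_points A \<and>
        affine_transformation T \<and> T ` F ` U \<subseteq> H)"

end

theory Submission
  imports Defs
begin

text \<open>
  Invariance under the half turns means that, in the frame of their axes, the cubic form of \<open>K\<close> is
  \<open>6 b x\<^sub>1 x\<^sub>2 x\<^sub>3\<close> and \<open>S\<close> is diagonal. This implies frame-free identities for the traces of
  \<open>K\<^sub>X\<close>, \<open>K\<^sub>X K\<^sub>Y\<close> and \<open>K\<^sub>X S\<close>, so no differentiable choice of the frame is needed: covariant
  differentiation and the equations of Codazzi give that \<open>b\<close> is constant and nonzero and that \<open>S\<close> has
  eigenvalues \<open>\<lambda>\<close>, \<open>\<lambda>\<close>, \<open>\<lambda> - 4 b\<^sup>2\<close>. If \<open>n\<close> is a unit eigenvector field for the last one, then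
  \<open>D\<^sub>X (F\<^sub>* n) = h(X, n) \<xi>\<close>; symmetry of second derivatives gives \<open>\<lambda> = 0\<close>, and the two fields
  \<open>\<xi> + 2 b F\<^sub>* n\<close> and \<open>\<xi> - 2 b F\<^sub>* n\<close> have constant directions. They span two of the axes of an affine
  coordinate system in which the position vector satisfies two equations \<open>y - x\<^sup>2 / 2 = m / (8 b\<^sup>2) + c\<close>,
  where the product of the two functions \<open>m\<close> is \<open>1\<close>.

  Conversely, on the model hypersurface \<open>p q = 1\<close> with \<open>p = x\<^sub>1 - x\<^sub>3\<^sup>2 / 2\<close> and \<open>q = x\<^sub>2 - x\<^sub>4\<^sup>2 / 2\<close> the
  volume condition forces \<open>\<xi> = \<alpha> (p, q, 0, 0)\<close> with a constant \<open>\<alpha>\<close>, and \<open>K\<close> and \<open>S\<close> have constant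
  coefficients in a coframe proportional to \<open>dx\<^sub>3\<close>, \<open>dx\<^sub>4\<close>, \<open>dp / p\<close>.
\<close>

section \<open>Calculus of smooth maps\<close>

text \<open>The two axes of the double eigenvalue never become vector fields. They enter only
  through the rank one forms attached to e1 + e2 and e1 - e2, on which K_n acts as b and -b and
  which can be written with h, K and n alone. This rotation by 45 degrees turns the product of two
  coordinates into a difference of squares, and it is what splits the surface into two paraboloid
  equations. With \<lambda> = 0 and \<theta> = h(n, .) one has D \<xi> = 4 b^2 \<theta> F_* n and D
  F_* n = \<theta> \<xi>, a system with eigenvalues 2 b and -2 b; hence the two combinations of
  \<xi> and F_* n. No differential equation is solved: affine coordinates of the immersion supply
  the candidate functions, and an identity is proved by showing that its defect vanishes at a base
  point and satisfies a homogeneous linear system, so that uniqueness along segments is enough. In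
  the converse, the volume condition expresses \<alpha>^5 by the determinant of the affine map,
  which is why \<alpha> is constant.\<close>

lemmas lins = linear_add linear_diff linear_cmul linear_0 linear_neg

lemma DD_eqI: "(f has_derivative f') (at u) \<Longrightarrow> DD f u X = f' X"
  using frechet_derivative_at[of f f' u] by simp

lemma DD_has_derivative: "f differentiable (at u) \<Longrightarrow> (f has_derivative DD f u) (at u)"
  using frechet_derivative_works by blast

lemma DD_cong:
  assumes "open \<Omega>" "u \<in> \<Omega>" "\<And>w. w \<in> \<Omega> \<Longrightarrow> f w = g w" "f differentiable (at u)"
  shows "DD f u = DD g u"
  using frechet_derivative_transform_within_open[OF assms(4,1,2)] assms(3) by blast

text \<open>\<open>Ck_on\<close> is built on \<open>frechet_derivative\<close>, a choice operator. A
  formula for a derivative that is valid on the open set can be used only after such a replacement;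
  \<open>Ck_on_SucI\<close> rests on it.\<close>

lemma Ck_on_cong:
  assumes "open \<Omega>" "\<And>w. w \<in> \<Omega> \<Longrightarrow> f w = g w" "Ck_on k \<Omega> f"
  shows "Ck_on k \<Omega> g"
  using assms
proof (induction k arbitrary: f g)
  case 0
  then show ?case by (simp cong: continuous_on_cong)
next
  case (Suc k)
  have d: "f differentiable (at u)" if "u \<in> \<Omega>" for u
    using Suc.prems(3) that by simp
  have "g differentiable (at u)" if "u \<in> \<Omega>" for u
    using has_derivative_transform_within_open[OF DD_has_derivative[OF d[OF that]] Suc.prems(1) that Suc.prems(2)]
    unfolding differentiable_def by blast
  moreover have "Ck_on k \<Omega> (\<lambda>u. DD g u X)" for X
  proof (rule Suc.IH[OF Suc.prems(1)])
    show "DD f w X = DD g w X" if "w \<in> \<Omega>" for w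
      using DD_cong[OF Suc.prems(1) that Suc.prems(2) d[OF that]] by simp
    show "Ck_on k \<Omega> (\<lambda>u. DD f u X)" using Suc.prems(3) by simp
  qed
  ultimately show ?case by simp
qed

lemma Ck_on_SucI:
  assumes "open \<Omega>" "\<And>u. u \<in> \<Omega> \<Longrightarrow> (f has_derivative f' u) (at u)" "\<And>X. Ck_on k \<Omega> (\<lambda>u. f' u X)"
  shows "Ck_on (Suc k) \<Omega> f"
proof -
  have "f' u X = DD f u X" if "u \<in> \<Omega>" for u X
    by (rule DD_eqI[OF assms(2)[OF that], symmetric])
  from Ck_on_cong[OF assms(1) this assms(3)] show ?thesis
    using assms(2) by (auto simp: differentiable_def)
qed

lemma Ck_on_Suc_imp: "Ck_on (Suc k) \<Omega> f \<Longrightarrow> Ck_on k \<Omega> f"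
proof (induction k arbitrary: f)
  case 0
  then show ?case
    by (auto intro!: continuous_at_imp_continuous_on differentiable_imp_continuous_within)
next
  case (Suc k)
  have "Ck_on k \<Omega> (\<lambda>u. DD f u X)" for X
    using Suc.prems unfolding Ck_on.simps(2)[of "Suc k"] by (intro Suc.IH) blast
  then show ?case using Suc.prems by simp
qed

lemma Ck_on_subset: "Ck_on k \<Omega> f \<Longrightarrow> \<Omega>' \<subseteq> \<Omega> \<Longrightarrow> Ck_on k \<Omega>' f"
proof (induction k arbitrary: f)
  case 0
  then show ?case using continuous_on_subset by auto
next
  case (Suc k)
  then show ?case by auto
qed

lemma Ck_on_const: "Ck_on k \<Omega> (\<lambda>u. c)"
  by (induction k arbitrary: c) auto

lemma Ck_on_add:
  assumes "open \<Omega>" "Ck_on k \<Omega> f" "Ck_on k \<Omega> g"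
  shows "Ck_on k \<Omega> (\<lambda>u. f u + g u)"
  using assms(2,3)
proof (induction k arbitrary: f g)
  case 0
  then show ?case by (simp add: continuous_on_add)
next
  case (Suc k)
  show ?case
  proof (rule Ck_on_SucI[OF assms(1)])
    show "((\<lambda>u. f u + g u) has_derivative (\<lambda>X. DD f u X + DD g u X)) (at u)" if "u \<in> \<Omega>" for u
      using that Suc.prems by (intro has_derivative_add DD_has_derivative) auto
    show "Ck_on k \<Omega> (\<lambda>u. DD f u X + DD g u X)" for X
      using Suc.prems by (intro Suc.IH) simp_all
  qed
qed

lemma (in bounded_bilinear) Ck_on_bilinear:
  assumes "open \<Omega>" "Ck_on k \<Omega> f" "Ck_on k \<Omega> g"
  shows "Ck_on k \<Omega> (\<lambda>u. prod (f u) (g u))"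
  using assms(2,3)
proof (induction k arbitrary: f g)
  case 0
  then show ?case by (simp add: continuous_on)
next
  case (Suc k)
  show ?case
  proof (rule Ck_on_SucI[OF assms(1)])
    show "((\<lambda>u. prod (f u) (g u)) has_derivative (\<lambda>X. prod (f u) (DD g u X) + prod (DD f u X) (g u))) (at u)"
      if "u \<in> \<Omega>" for u
      using that Suc.prems by (intro FDERIV DD_has_derivative) auto
    show "Ck_on k \<Omega> (\<lambda>u. prod (f u) (DD g u X) + prod (DD f u X) (g u))" for X
      using Suc.prems Ck_on_Suc_imp[OF Suc.prems(1)] Ck_on_Suc_imp[OF Suc.prems(2)]
      by (intro Ck_on_add assms(1) Suc.IH) simp_all
  qed
qed

lemma (in bounded_linear) Ck_on_linear:
  assumes "open \<Omega>" "Ck_on k \<Omega> g"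
  shows "Ck_on k \<Omega> (\<lambda>u. f (g u))"
  using assms(2)
proof (induction k arbitrary: g)
  case 0
  then show ?case by (simp add: continuous_on)
next
  case (Suc k)
  show ?case
  proof (rule Ck_on_SucI[OF assms(1)])
    show "((\<lambda>u. f (g u)) has_derivative (\<lambda>X. f (DD g u X))) (at u)" if "u \<in> \<Omega>" for u
      using that Suc.prems by (intro has_derivative DD_has_derivative) auto
    show "Ck_on k \<Omega> (\<lambda>u. f (DD g u X))" for X
      using Suc.prems by (intro Suc.IH) simp
  qed
qed

text \<open>The derivative of 1/f is a polynomial in 1/f and Df, so the induction hypothesis for 1/f
  itself closes the step. The square root below is treated in the same way, through 1 / sqrt
  f.\<close>

lemma Ck_on_inverse:
  fixes f :: "_ \<Rightarrow> real"
  assumes "open \<Omega>" "Ck_on k \<Omega> f" "\<And>u. u \<in> \<Omega> \<Longrightarrow> f u \<noteq> 0"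
  shows "Ck_on k \<Omega> (\<lambda>u. inverse (f u))"
  using assms(2)
proof (induction k)
  case 0
  then show ?case using assms by (simp add: continuous_on_inverse)
next
  case (Suc k)
  show ?case
  proof (rule Ck_on_SucI[OF assms(1)])
    show "Ck_on k \<Omega> (\<lambda>u. (-1) * (inverse (f u) * DD f u X * inverse (f u)))" for X
      using Suc Ck_on_Suc_imp[OF Suc.prems] assms
      by (intro bounded_bilinear.Ck_on_bilinear[OF bounded_bilinear_mult] Ck_on_const) auto
    fix u assume "u \<in> \<Omega>"
    then have "((\<lambda>u. inverse (f u)) has_derivative (\<lambda>X. - (inverse (f u) * DD f u X * inverse (f u)))) (at u)"
      using Suc.prems assms by (intro Deriv.has_derivative_inverse DD_has_derivative) auto
    then show "((\<lambda>u. inverse (f u)) has_derivative (\<lambda>X. (-1) * (inverse (f u) * DD f u X * inverse (f u)))) (at u)"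
      by simp
  qed
qed

lemma Ck_on_sqrt:
  fixes f :: "_ \<Rightarrow> real"
  assumes "open \<Omega>" "Ck_on k \<Omega> f" "\<And>u. u \<in> \<Omega> \<Longrightarrow> f u > 0"
  shows "Ck_on k \<Omega> (\<lambda>u. sqrt (f u))"
  using assms(2)
proof (induction k)
  case 0
  then show ?case by (simp add: continuous_on_real_sqrt)
next
  case (Suc k)
  show ?case
  proof (rule Ck_on_SucI[OF assms(1)])
    show "Ck_on k \<Omega> (\<lambda>u. 1 / 2 * (inverse (sqrt (f u)) * DD f u X))" for X
      using Suc.IH[OF Ck_on_Suc_imp[OF Suc.prems]] Suc.prems assms(1,3)
      by (intro bounded_bilinear.Ck_on_bilinear[OF bounded_bilinear_mult] Ck_on_const Ck_on_inverse)
         (auto simp: less_imp_neq[symmetric])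
    fix u assume u: "u \<in> \<Omega>"
    have "(sqrt has_derivative (*) (inverse (sqrt (f u)) / 2)) (at (f u))"
      using DERIV_real_sqrt[OF assms(3)[OF u]] by (simp add: has_field_derivative_def)
    moreover have "(f has_derivative DD f u) (at u)" using u Suc.prems by (intro DD_has_derivative) auto
    ultimately have "((\<lambda>u. sqrt (f u)) has_derivative (\<lambda>X. inverse (sqrt (f u)) / 2 * DD f u X)) (at u)"
      using has_derivative_compose by blast
    then show "((\<lambda>u. sqrt (f u)) has_derivative (\<lambda>X. 1 / 2 * (inverse (sqrt (f u)) * DD f u X))) (at u)"
      by simp
  qed
qed

lemma smooth_on_cong: "open \<Omega> \<Longrightarrow> (\<And>w. w \<in> \<Omega> \<Longrightarrow> f w = g w) \<Longrightarrow> smooth_on \<Omega> f \<Longrightarrow> smooth_on \<Omega> g"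
  unfolding smooth_on_def using Ck_on_cong by blast

lemma smooth_on_subset: "smooth_on \<Omega> f \<Longrightarrow> \<Omega>' \<subseteq> \<Omega> \<Longrightarrow> smooth_on \<Omega>' f"
  unfolding smooth_on_def using Ck_on_subset by blast

lemma smooth_on_DD: "smooth_on \<Omega> f \<Longrightarrow> smooth_on \<Omega> (\<lambda>u. DD f u X)"
  unfolding smooth_on_def using Ck_on.simps(2)[of _ \<Omega> f] by blast

lemma smooth_on_differentiable: "smooth_on \<Omega> f \<Longrightarrow> u \<in> \<Omega> \<Longrightarrow> f differentiable (at u)"
  unfolding smooth_on_def using Ck_on.simps(2)[of _ \<Omega> f] by blast

lemma smooth_on_continuous_on: "smooth_on \<Omega> f \<Longrightarrow> continuous_on \<Omega> f"
  unfolding smooth_on_def using Ck_on.simps(1)[of \<Omega> f] by blast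

lemma smooth_on_linear_DD: "smooth_on \<Omega> f \<Longrightarrow> u \<in> \<Omega> \<Longrightarrow> linear (DD f u)"
  using linear_frechet_derivative smooth_on_differentiable by blast

lemma smooth_on_has_derivative: "smooth_on \<Omega> f \<Longrightarrow> u \<in> \<Omega> \<Longrightarrow> (f has_derivative DD f u) (at u)"
  using DD_has_derivative smooth_on_differentiable by blast

lemma smooth_on_const: "smooth_on \<Omega> (\<lambda>u. c)"
  unfolding smooth_on_def by (simp add: Ck_on_const)

lemma smooth_on_add: "open \<Omega> \<Longrightarrow> smooth_on \<Omega> f \<Longrightarrow> smooth_on \<Omega> g \<Longrightarrow> smooth_on \<Omega> (\<lambda>u. f u + g u)"
  unfolding smooth_on_def by (simp add: Ck_on_add)

lemma smooth_on_scaleR: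
  "open \<Omega> \<Longrightarrow> smooth_on \<Omega> f \<Longrightarrow> smooth_on \<Omega> g \<Longrightarrow> smooth_on \<Omega> (\<lambda>u. f u *\<^sub>R g u)"
  unfolding smooth_on_def by (simp add: bounded_bilinear.Ck_on_bilinear[OF bounded_bilinear_scaleR])

lemma smooth_on_mult:
  fixes f g :: "_ \<Rightarrow> real"
  shows "open \<Omega> \<Longrightarrow> smooth_on \<Omega> f \<Longrightarrow> smooth_on \<Omega> g \<Longrightarrow> smooth_on \<Omega> (\<lambda>u. f u * g u)"
  unfolding smooth_on_def by (simp add: bounded_bilinear.Ck_on_bilinear[OF bounded_bilinear_mult])

lemma smooth_on_bounded_linear:
  "open \<Omega> \<Longrightarrow> smooth_on \<Omega> g \<Longrightarrow> bounded_linear L \<Longrightarrow> smooth_on \<Omega> (\<lambda>u. L (g u))"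
  unfolding smooth_on_def by (simp add: bounded_linear.Ck_on_linear)

lemma smooth_on_uminus:
  "open \<Omega> \<Longrightarrow> smooth_on \<Omega> g \<Longrightarrow> smooth_on \<Omega> (\<lambda>u. - g u)"
  using smooth_on_bounded_linear[of \<Omega> g uminus] bounded_linear_minus[OF bounded_linear_ident] by simp

lemma smooth_on_diff:
  "open \<Omega> \<Longrightarrow> smooth_on \<Omega> f \<Longrightarrow> smooth_on \<Omega> g \<Longrightarrow> smooth_on \<Omega> (\<lambda>u. f u - g u)"
  using smooth_on_add[of \<Omega> f "\<lambda>u. - g u"] smooth_on_uminus by auto

lemma smooth_on_vec_nth:
  fixes g :: "_ \<Rightarrow> real^'n"
  shows "open \<Omega> \<Longrightarrow> smooth_on \<Omega> g \<Longrightarrow> smooth_on \<Omega> (\<lambda>u. g u $ i)"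
  by (rule smooth_on_bounded_linear) (auto simp: bounded_linear_vec_nth)

lemma smooth_on_inverse:
  fixes f :: "_ \<Rightarrow> real"
  shows "open \<Omega> \<Longrightarrow> smooth_on \<Omega> f \<Longrightarrow> (\<And>u. u \<in> \<Omega> \<Longrightarrow> f u \<noteq> 0) \<Longrightarrow> smooth_on \<Omega> (\<lambda>u. inverse (f u))"
  unfolding smooth_on_def by (simp add: Ck_on_inverse)

lemma smooth_on_sqrt:
  fixes f :: "_ \<Rightarrow> real"
  shows "open \<Omega> \<Longrightarrow> smooth_on \<Omega> f \<Longrightarrow> (\<And>u. u \<in> \<Omega> \<Longrightarrow> f u > 0) \<Longrightarrow> smooth_on \<Omega> (\<lambda>u. sqrt (f u))"
  unfolding smooth_on_def by (simp add: Ck_on_sqrt)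

lemma smooth_on_divide:
  fixes f :: "_ \<Rightarrow> real"
  shows "open \<Omega> \<Longrightarrow> smooth_on \<Omega> f \<Longrightarrow> smooth_on \<Omega> g \<Longrightarrow> (\<And>u. u \<in> \<Omega> \<Longrightarrow> g u \<noteq> 0) \<Longrightarrow> smooth_on \<Omega> (\<lambda>u. f u / g u)"
  unfolding divide_inverse by (intro smooth_on_mult smooth_on_inverse)

lemma smooth_on_sum:
  assumes "open \<Omega>" "\<And>i. i \<in> I \<Longrightarrow> smooth_on \<Omega> (f i)"
  shows "smooth_on \<Omega> (\<lambda>u. \<Sum>i\<in>I. f i u)"
  using assms(2)
  by (induction I rule: infinite_finite_induct) (auto intro!: smooth_on_add[OF assms(1)] smooth_on_const)

lemma smooth_on_prod:
  fixes f :: "_ \<Rightarrow> _ \<Rightarrow> real"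
  assumes "open \<Omega>" "\<And>i. i \<in> I \<Longrightarrow> smooth_on \<Omega> (f i)"
  shows "smooth_on \<Omega> (\<lambda>u. \<Prod>i\<in>I. f i u)"
  using assms(2)
  by (induction I rule: infinite_finite_induct) (auto intro!: smooth_on_mult[OF assms(1)] smooth_on_const)

lemma smooth_on_vec_lambda:
  fixes f :: "'a::real_normed_vector \<Rightarrow> 'n::finite \<Rightarrow> real"
  assumes "open \<Omega>" "\<And>i. smooth_on \<Omega> (\<lambda>u. f u i)"
  shows "smooth_on \<Omega> (\<lambda>u. \<chi> i. f u i)"
proof (rule smooth_on_cong[OF assms(1)])
  show "smooth_on \<Omega> (\<lambda>u. \<Sum>i\<in>UNIV. f u i *\<^sub>R axis i (1::real))"
    by (intro smooth_on_sum smooth_on_scaleR smooth_on_const assms)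
qed (simp add: vec_eq_iff axis_def if_distrib cong: if_cong)

lemma smooth_on_det:
  fixes f :: "'a::real_normed_vector \<Rightarrow> 'n::finite \<Rightarrow> 'n \<Rightarrow> real"
  assumes "open \<Omega>" "\<And>i j. smooth_on \<Omega> (\<lambda>u. f u i j)"
  shows "smooth_on \<Omega> (\<lambda>u. det (\<chi> i j. f u i j))"
  unfolding det_def by (auto intro!: smooth_on_sum smooth_on_mult smooth_on_const smooth_on_prod assms)

section \<open>Solutions of linear systems and fields of linear maps\<close>

lemma linear_axis: "linear l \<Longrightarrow> l (v :: real^'n) = (\<Sum>j\<in>UNIV. v $ j *\<^sub>R l (axis j 1))"
  using linear_sum[of l "\<lambda>j. v $ j *\<^sub>R axis j 1" UNIV] basis_expansion[of v]
  by (simp add: linear_cmul scalar_mult_eq_scaleR)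

lemma linear_axis_real: "linear l \<Longrightarrow> l (v :: real^'n) = (\<Sum>j\<in>UNIV. v $ j * l (axis j 1) :: real)"
  using linear_axis[of l v] by simp

lemma vector_4: "vector [a, b, c, d] $ (1::4) = a" "vector [a, b, c, d] $ (2::4) = b"
    "vector [a, b, c, d] $ (3::4) = c" "vector [a, b, c, d] $ (4::4) = d"
  by (simp_all add: vector_def)

lemma det_nonzeroI:
  fixes M :: "real^'n^'n"
  assumes "\<And>x. M *v x = 0 \<Longrightarrow> x = 0"
  shows "det M \<noteq> 0"
  using assms matrix_left_invertible_ker[of M] invertible_left_inverse[of M] invertible_det_nz[of M] by blast

text \<open>Cramer's rule writes the solution as quotients of determinants. This yields smoothness
  of quantities known only through an equation, such as the tensors defined with
  \<open>THE\<close>.\<close>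

lemma smooth_on_linear_solve:
  fixes M :: "'a::real_normed_vector \<Rightarrow> real^'n^'n" and x b :: "'a \<Rightarrow> real^'n"
  assumes "open \<Omega>" "\<And>i j. smooth_on \<Omega> (\<lambda>u. M u $ i $ j)" "smooth_on \<Omega> b"
    and "\<And>u. u \<in> \<Omega> \<Longrightarrow> det (M u) \<noteq> 0" "\<And>u. u \<in> \<Omega> \<Longrightarrow> M u *v x u = b u"
  shows "smooth_on \<Omega> x"
proof (rule smooth_on_cong[OF assms(1)])
  have ifs: "smooth_on \<Omega> (\<lambda>u. if P then f u else g u)" if "smooth_on \<Omega> f" "smooth_on \<Omega> g" for P and f g :: "'a \<Rightarrow> real"
    by (cases P) (simp_all add: that)
  have d: "smooth_on \<Omega> (\<lambda>u. det (M u))"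
    using smooth_on_det[OF assms(1), of "\<lambda>u i j. M u $ i $ j"] assms(2) by simp
  show "smooth_on \<Omega> (\<lambda>u. \<chi> k. det (\<chi> i j. if j = k then b u $ i else M u $ i $ j) / det (M u))"
    by (intro assms(1,2,4) d smooth_on_vec_lambda smooth_on_divide smooth_on_det ifs smooth_on_vec_nth[OF assms(1,3)])
  show "(\<chi> k. det (\<chi> i j. if j = k then b u $ i else M u $ i $ j) / det (M u)) = x u" if "u \<in> \<Omega>" for u
    using assms(4,5)[OF that] cramer[of "M u" "x u" "b u"] by simp
qed

text \<open>Smoothness in the base point is known only for each fixed argument. Expanding the moving
  argument in the standard basis leaves finitely many products, and the product rule gives one term
  from the base point and one from the argument.\<close>

lemma linear_field_apply:
  fixes H :: "real^3 \<Rightarrow> real^3 \<Rightarrow> 'b::real_normed_vector"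
  assumes "open \<Omega>" "\<And>w. w \<in> \<Omega> \<Longrightarrow> linear (H w)" "\<And>v. smooth_on \<Omega> (\<lambda>w. H w v)" "smooth_on \<Omega> g"
  shows smooth_on_apply: "smooth_on \<Omega> (\<lambda>w. H w (g w))"
    and DD_apply: "u \<in> \<Omega> \<Longrightarrow> DD (\<lambda>w. H w (g w)) u X = DD (\<lambda>w. H w (g u)) u X + H u (DD g u X)"
proof -
  have e: "H w v = (\<Sum>i\<in>UNIV. v $ i *\<^sub>R H w (axis i 1))" if "w \<in> \<Omega>" for w v
    by (rule linear_axis[OF assms(2)[OF that]])
  let ?S = "\<lambda>w. \<Sum>i\<in>UNIV. g w $ i *\<^sub>R H w (axis i 1)"
  have "smooth_on \<Omega> ?S"
    by (intro smooth_on_sum smooth_on_scaleR smooth_on_vec_nth assms)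
  then show s: "smooth_on \<Omega> (\<lambda>w. H w (g w))"
    by (rule smooth_on_cong[OF assms(1), rotated]) (use e in auto)
  assume u: "u \<in> \<Omega>"
  have g: "(g has_derivative DD g u) (at u)" and H: "((\<lambda>w. H w v) has_derivative DD (\<lambda>w. H w v) u) (at u)" for v
    using smooth_on_has_derivative assms u by blast+
  have "((\<lambda>w. g w $ i *\<^sub>R H w (axis i 1)) has_derivative
     (\<lambda>X. g u $ i *\<^sub>R DD (\<lambda>w. H w (axis i 1)) u X + (DD g u X $ i) *\<^sub>R H u (axis i 1))) (at u)" for i
    by (intro has_derivative_scaleR H bounded_linear.has_derivative[OF bounded_linear_vec_nth g])
  then have 1: "(?S has_derivative (\<lambda>X. \<Sum>i\<in>UNIV. g u $ i *\<^sub>R DD (\<lambda>w. H w (axis i 1)) u X + (DD g u X $ i) *\<^sub>R H u (axis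
      i 1))) (at u)"
    by (intro has_derivative_sum)
  have "((\<lambda>w. g u $ i *\<^sub>R H w (axis i 1)) has_derivative
     (\<lambda>X. g u $ i *\<^sub>R DD (\<lambda>w. H w (axis i 1)) u X)) (at u)" for i
    by (intro has_derivative_scaleR_right H)
  then have 2: "((\<lambda>w. \<Sum>i\<in>UNIV. g u $ i *\<^sub>R H w (axis i 1)) has_derivative (\<lambda>X. \<Sum>i\<in>UNIV. g u $ i *\<^sub>R DD (\<lambda>w. H w (axis i
      1)) u X)) (at u)"
    by (intro has_derivative_sum)
  have "DD (\<lambda>w. H w (g w)) u X = (\<Sum>i\<in>UNIV. g u $ i *\<^sub>R DD (\<lambda>w. H w (axis i 1)) u X + (DD g u X $ i) *\<^sub>R H u (axis i 1))"
    using e u by (intro DD_eqI has_derivative_transform_within_open[OF 1 assms(1) u]) auto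
  moreover have "DD (\<lambda>w. H w (g u)) u X = (\<Sum>i\<in>UNIV. g u $ i *\<^sub>R DD (\<lambda>w. H w (axis i 1)) u X)"
    using e u by (intro DD_eqI has_derivative_transform_within_open[OF 2 assms(1) u]) auto
  ultimately show "DD (\<lambda>w. H w (g w)) u X = DD (\<lambda>w. H w (g u)) u X + H u (DD g u X)"
    using e[OF u, of "DD g u X"] by (simp add: sum.distrib)
qed

section \<open>Rules for directional derivatives and symmetry of second derivatives\<close>

lemma DD_add: "f differentiable (at u) \<Longrightarrow> g differentiable (at u) \<Longrightarrow> DD (\<lambda>w. f w + g w) u X = DD f u X + DD g u X"
  by (intro DD_eqI has_derivative_add DD_has_derivative)

lemma DD_diff: "f differentiable (at u) \<Longrightarrow> g differentiable (at u) \<Longrightarrow> DD (\<lambda>w. f w - g w) u X = DD f u X - DD g u X"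
  by (intro DD_eqI has_derivative_diff DD_has_derivative)

lemma DD_uminus: "f differentiable (at u) \<Longrightarrow> DD (\<lambda>w. - f w) u X = - DD f u X"
  by (intro DD_eqI has_derivative_minus DD_has_derivative)

lemma DD_scaleR: "f differentiable (at u) \<Longrightarrow> g differentiable (at u)
    \<Longrightarrow> DD (\<lambda>w. f w *\<^sub>R g w) u X = f u *\<^sub>R DD g u X + DD f u X *\<^sub>R g u"
  by (intro DD_eqI has_derivative_scaleR DD_has_derivative)

lemma DD_mult:
  fixes f g :: "_ \<Rightarrow> real"
  shows "f differentiable (at u) \<Longrightarrow> g differentiable (at u)
    \<Longrightarrow> DD (\<lambda>w. f w * g w) u X = f u * DD g u X + DD f u X * g u"
  by (intro DD_eqI has_derivative_mult DD_has_derivative)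

lemma DD_linear: "f differentiable (at u) \<Longrightarrow> bounded_linear L \<Longrightarrow> DD (\<lambda>w. L (f w)) u X = L (DD f u X)"
  by (rule DD_eqI[OF bounded_linear.has_derivative[OF _ DD_has_derivative]])

text \<open>The second difference of g over the parallelogram spanned by t X and t Y is symmetric in
  X and Y. Two applications of the mean value theorem turn it into t^2 times a mixed derivative at a
  point of the parallelogram, in either order, and continuity at u allows the two to be
  compared.\<close>

lemma second_derivative_sym_real:
  fixes g :: "'a::real_normed_vector \<Rightarrow> real"
  assumes "open \<Omega>" "u \<in> \<Omega>" "smooth_on \<Omega> g"
  shows "DD (\<lambda>w. DD g w Y) u X = DD (\<lambda>w. DD g w X) u Y"
proof -
  define P where "P X Y = (\<lambda>w. DD (\<lambda>w. DD g w Y) w X)" for X Y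
  have mv: "\<exists>s\<in>{0<..<t}. \<exists>r\<in>{0<..<t}. g (u + t *\<^sub>R X + t *\<^sub>R Y) - g (u + t *\<^sub>R X) - g (u + t *\<^sub>R Y) + g u
        = t * (t * P Y X (u + s *\<^sub>R X + r *\<^sub>R Y))"
    if t: "t > 0" and sub: "\<And>s r. 0 \<le> s \<Longrightarrow> s \<le> t \<Longrightarrow> 0 \<le> r \<Longrightarrow> r \<le> t \<Longrightarrow> u + s *\<^sub>R X + r *\<^sub>R Y \<in> \<Omega>" for t X Y
  proof -
    have lg: "linear (DD g w)" "linear (DD (\<lambda>w. DD g w X) w)" if "w \<in> \<Omega>" for w
      using smooth_on_linear_DD assms(3) smooth_on_DD that by blast+
    have d1: "((\<lambda>s. g (u + s *\<^sub>R X + c *\<^sub>R Y)) has_real_derivative DD g (u + s *\<^sub>R X + c *\<^sub>R Y) X) (at s)"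
      if "0 \<le> s" "s \<le> t" "0 \<le> c" "c \<le> t" for s c
    proof -
      have "((\<lambda>s. g (u + s *\<^sub>R X + c *\<^sub>R Y)) has_derivative (\<lambda>k. DD g (u + s *\<^sub>R X + c *\<^sub>R Y) (k *\<^sub>R X))) (at s)"
        by (rule has_derivative_compose[of "\<lambda>s. u + s *\<^sub>R X + c *\<^sub>R Y", OF _ smooth_on_has_derivative[OF assms(3) sub[OF
            that]]])
           (auto intro!: derivative_eq_intros)
      then show ?thesis
        unfolding has_field_derivative_def
        by (rule has_derivative_eq_rhs) (use lg(1)[OF sub[OF that]] in \<open>auto simp: linear_cmul\<close>)
    qed
    have d2: "((\<lambda>r. DD g (u + c *\<^sub>R X + r *\<^sub>R Y) X) has_real_derivative P Y X (u + c *\<^sub>R X + s *\<^sub>R Y)) (at s)"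
      if "0 \<le> s" "s \<le> t" "0 \<le> c" "c \<le> t" for s c
    proof -
      have "((\<lambda>r. DD g (u + c *\<^sub>R X + r *\<^sub>R Y) X) has_derivative (\<lambda>k. DD (\<lambda>w. DD g w X) (u + c *\<^sub>R X + s *\<^sub>R Y) (k *\<^sub>R
          Y))) (at s)"
        by (rule has_derivative_compose[of "\<lambda>s. u + c *\<^sub>R X + s *\<^sub>R Y", OF _ smooth_on_has_derivative[OF smooth_on_DD[OF
            assms(3)] sub[OF that(3,4,1,2)]]])
           (auto intro!: derivative_eq_intros)
      then show ?thesis
        unfolding has_field_derivative_def P_def
        by (rule has_derivative_eq_rhs) (use lg(2)[OF sub[OF that(3,4,1,2)]] in \<open>auto simp: linear_cmul\<close>)
    qed
    have "\<exists>s. 0 < s \<and> s < t \<and>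
       (g (u + t *\<^sub>R X + t *\<^sub>R Y) - g (u + t *\<^sub>R X + 0 *\<^sub>R Y)) - (g (u + 0 *\<^sub>R X + t *\<^sub>R Y) - g (u + 0 *\<^sub>R X + 0 *\<^sub>R Y))
         = (t - 0) * (DD g (u + s *\<^sub>R X + t *\<^sub>R Y) X - DD g (u + s *\<^sub>R X + 0 *\<^sub>R Y) X)"
      using t by (intro MVT2[of 0 t "\<lambda>s. g (u + s *\<^sub>R X + t *\<^sub>R Y) - g (u + s *\<^sub>R X + 0 *\<^sub>R Y)"] DERIV_diff d1) auto
    then obtain s where s: "0 < s" "s < t" "g (u + t *\<^sub>R X + t *\<^sub>R Y) - g (u + t *\<^sub>R X) - g (u + t *\<^sub>R Y) + g u
         = t * (DD g (u + s *\<^sub>R X + t *\<^sub>R Y) X - DD g (u + s *\<^sub>R X + 0 *\<^sub>R Y) X)"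
      by (auto simp: algebra_simps)
    have "\<exists>r. 0 < r \<and> r < t \<and> DD g (u + s *\<^sub>R X + t *\<^sub>R Y) X - DD g (u + s *\<^sub>R X + 0 *\<^sub>R Y) X = (t - 0) * P Y X (u + s
        *\<^sub>R X + r *\<^sub>R Y)"
      using t s by (intro MVT2[of 0 t "\<lambda>r. DD g (u + s *\<^sub>R X + r *\<^sub>R Y) X"] d2) auto
    then obtain r where r: "0 < r" "r < t" "DD g (u + s *\<^sub>R X + t *\<^sub>R Y) X - DD g (u + s *\<^sub>R X + 0 *\<^sub>R Y) X = t * P Y X
        (u + s *\<^sub>R X + r *\<^sub>R Y)"
      by auto
    then show ?thesis using s by (intro bexI[of _ s] bexI[of _ r]) auto
  qed
  have cont: "isCont (P X Y) u" for X Y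
    using smooth_on_continuous_on[OF smooth_on_DD[OF smooth_on_DD[OF assms(3)]]]
    unfolding P_def by (simp add: continuous_on_eq_continuous_at[OF assms(1)] assms(2))
  have "\<bar>P Y X u - P X Y u\<bar> < e" if e: "e > 0" for e
  proof -
    obtain d0 where d0: "d0 > 0" "ball u d0 \<subseteq> \<Omega>" using assms openE by blast
    obtain d1 where d1: "d1 > 0" "\<And>w. dist w u < d1 \<Longrightarrow> dist (P X Y w) (P X Y u) < e/2"
      using cont[of X Y, unfolded continuous_at_eps_delta] half_gt_zero[OF e] by blast
    obtain d2 where d2: "d2 > 0" "\<And>w. dist w u < d2 \<Longrightarrow> dist (P Y X w) (P Y X u) < e/2"
      using cont[of Y X, unfolded continuous_at_eps_delta] half_gt_zero[OF e] by blast
    define d where "d = min d0 (min d1 d2)"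
    \<comment> \<open>All points used lie within t (|X| + |Y|) of u, hence within d/2; the summand 1
      keeps the denominator positive when both vectors vanish.\<close>
    define t where "t = d / (2 * (norm X + norm Y + 1))"
    have dpos: "d > 0" using d0 d1 d2 by (simp add: d_def)
    have N: "norm X + norm Y + 1 > 0" by (simp add: add_nonneg_pos)
    have t: "t > 0" using dpos N by (simp add: t_def)
    have near: "dist (u + s *\<^sub>R X + r *\<^sub>R Y) u < d" if "0 \<le> s" "s \<le> t" "0 \<le> r" "r \<le> t" for s r
    proof -
      have "dist (u + s *\<^sub>R X + r *\<^sub>R Y) u = norm (s *\<^sub>R X + r *\<^sub>R Y)" by (simp add: dist_norm algebra_simps)
      also have "\<dots> \<le> s * norm X + r * norm Y" using norm_triangle_ineq[of "s *\<^sub>R X" "r *\<^sub>R Y"] that by simp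
      also have "\<dots> \<le> t * norm X + t * norm Y" using that by (intro add_mono mult_right_mono) auto
      also have "\<dots> \<le> t * (norm X + norm Y + 1)" using t by (simp add: algebra_simps)
      also have "\<dots> = d / 2" using N by (simp add: t_def field_simps)
      also have "\<dots> < d" using dpos by simp
      finally show ?thesis .
    qed
    have sub: "u + s *\<^sub>R X + r *\<^sub>R Y \<in> \<Omega>" "u + r *\<^sub>R Y + s *\<^sub>R X \<in> \<Omega>" if "0 \<le> s" "s \<le> t" "0 \<le> r" "r \<le> t" for s r
      using near[OF that] d0 by (auto simp: d_def dist_commute subset_iff algebra_simps)
    obtain s r where 1: "s \<in> {0<..<t}" "r \<in> {0<..<t}" "g (u + t *\<^sub>R X + t *\<^sub>R Y) - g (u + t *\<^sub>R X) - g (u + t *\<^sub>R Y) + g u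
        = t * (t * P Y X (u + s *\<^sub>R X + r *\<^sub>R Y))"
      using mv[OF t, of X Y] sub by blast
    obtain s' r' where 2: "s' \<in> {0<..<t}" "r' \<in> {0<..<t}"
        "g (u + t *\<^sub>R Y + t *\<^sub>R X) - g (u + t *\<^sub>R Y) - g (u + t *\<^sub>R X) + g u
        = t * (t * P X Y (u + s' *\<^sub>R Y + r' *\<^sub>R X))"
      using mv[OF t, of Y X] sub by blast
    have "t * (t * P Y X (u + s *\<^sub>R X + r *\<^sub>R Y)) = t * (t * P X Y (u + s' *\<^sub>R Y + r' *\<^sub>R X))"
      using 1(3) 2(3) by (simp add: algebra_simps)
    then have "P Y X (u + s *\<^sub>R X + r *\<^sub>R Y) = P X Y (u + r' *\<^sub>R X + s' *\<^sub>R Y)" using t by (simp add: algebra_simps)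
    moreover have "dist (P Y X (u + s *\<^sub>R X + r *\<^sub>R Y)) (P Y X u) < e/2"
      using 1 near[of s r] by (intro d2) (auto simp: d_def)
    moreover have "dist (P X Y (u + r' *\<^sub>R X + s' *\<^sub>R Y)) (P X Y u) < e/2"
      using 2 near[of r' s'] by (intro d1) (auto simp: d_def)
    ultimately show ?thesis unfolding dist_real_def by linarith
  qed
  from this[of "\<bar>P Y X u - P X Y u\<bar>"] have "P Y X u = P X Y u" by auto
  then show ?thesis by (simp add: P_def)
qed

lemma second_derivative_sym:
  fixes g :: "'a::real_normed_vector \<Rightarrow> 'b::euclidean_space"
  assumes "open \<Omega>" "u \<in> \<Omega>" "smooth_on \<Omega> g"
  shows "DD (\<lambda>w. DD g w Y) u X = DD (\<lambda>w. DD g w X) u Y"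
proof (rule euclidean_eqI)
  fix b :: 'b
  have bl: "bounded_linear (\<lambda>x. x \<bullet> b)" by (rule bounded_linear_inner_left)
  have s: "smooth_on \<Omega> (\<lambda>w. g w \<bullet> b)" by (rule smooth_on_bounded_linear[OF assms(1,3) bl])
  have 1: "DD (\<lambda>w. g w \<bullet> b) w Y = DD g w Y \<bullet> b" if "w \<in> \<Omega>" for w Y
    by (rule DD_linear[OF smooth_on_differentiable[OF assms(3) that] bl])
  have 2: "DD (\<lambda>w. DD (\<lambda>w. g w \<bullet> b) w Y) u X = DD (\<lambda>w. DD g w Y) u X \<bullet> b" for X Y
  proof -
    have "DD (\<lambda>w. DD (\<lambda>w. g w \<bullet> b) w Y) u X = DD (\<lambda>w. DD g w Y \<bullet> b) u X"
      using DD_cong[OF assms(1,2), of "\<lambda>w. DD (\<lambda>w. g w \<bullet> b) w Y" "\<lambda>w. DD g w Y \<bullet> b"] 1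
        smooth_on_differentiable[OF smooth_on_DD[OF s] assms(2)] by simp
    also have "\<dots> = DD (\<lambda>w. DD g w Y) u X \<bullet> b"
      by (rule DD_linear[OF smooth_on_differentiable[OF smooth_on_DD[OF assms(3)] assms(2)] bl])
    finally show ?thesis .
  qed
  show "DD (\<lambda>w. DD g w Y) u X \<bullet> b = DD (\<lambda>w. DD g w X) u Y \<bullet> b"
    using second_derivative_sym_real[OF assms(1,2) s, of Y X] 2 by simp
qed

lemma linear_DD_field:
  fixes H :: "'a::real_normed_vector \<Rightarrow> 'c::real_vector \<Rightarrow> 'b::real_normed_vector"
  assumes "open \<Omega>" "u \<in> \<Omega>" "\<And>w. w \<in> \<Omega> \<Longrightarrow> linear (H w)" "\<And>v. smooth_on \<Omega> (\<lambda>w. H w v)"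
  shows "linear (\<lambda>v. DD (\<lambda>w. H w v) u X)"
proof (rule linearI)
  have d: "(\<lambda>w. H w v) differentiable (at u)" for v
    by (rule smooth_on_differentiable[OF assms(4,2)])
  fix v v' and c :: real
  have "DD (\<lambda>w. H w (v + v')) u = DD (\<lambda>w. H w v + H w v') u"
    using linear_add[OF assms(3)] by (intro DD_cong[OF assms(1,2)] d)
  then show "DD (\<lambda>w. H w (v + v')) u X = DD (\<lambda>w. H w v) u X + DD (\<lambda>w. H w v') u X"
    using DD_add[OF d[of v] d[of v']] by simp
  have "DD (\<lambda>w. H w (c *\<^sub>R v)) u = DD (\<lambda>w. c *\<^sub>R H w v) u"
    using linear_cmul[OF assms(3)] by (intro DD_cong[OF assms(1,2)] d)
  then show "DD (\<lambda>w. H w (c *\<^sub>R v)) u X = c *\<^sub>R DD (\<lambda>w. H w v) u X"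
    using DD_linear[OF d[of v] bounded_linear_scaleR_right] by simp
qed

lemma bilinear_field_apply:
  fixes B :: "real^3 \<Rightarrow> real^3 \<Rightarrow> real^3 \<Rightarrow> 'b::real_normed_vector"
  assumes "open \<Omega>" "\<And>w y. w \<in> \<Omega> \<Longrightarrow> linear (\<lambda>x. B w x y)" "\<And>w x. w \<in> \<Omega> \<Longrightarrow> linear (B w x)"
    and "\<And>x y. smooth_on \<Omega> (\<lambda>w. B w x y)" "smooth_on \<Omega> P" "smooth_on \<Omega> Q"
  shows smooth_on_apply2: "smooth_on \<Omega> (\<lambda>w. B w (P w) (Q w))"
    and DD_apply2: "u \<in> \<Omega> \<Longrightarrow> DD (\<lambda>w. B w (P w) (Q w)) u X =
       DD (\<lambda>w. B w (P u) (Q u)) u X + B u (DD P u X) (Q u) + B u (P u) (DD Q u X)"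
proof -
  have 1: "smooth_on \<Omega> (\<lambda>w. B w (P w) y)" for y
    by (rule smooth_on_apply[OF assms(1), of "\<lambda>w x. B w x y"]) (use assms in auto)
  show "smooth_on \<Omega> (\<lambda>w. B w (P w) (Q w))"
    by (rule smooth_on_apply[OF assms(1), of "\<lambda>w. B w (P w)"]) (use assms 1 in auto)
  assume u: "u \<in> \<Omega>"
  have "DD (\<lambda>w. B w (P w) (Q w)) u X = DD (\<lambda>w. B w (P w) (Q u)) u X + B u (P u) (DD Q u X)"
    by (rule DD_apply[OF assms(1), of "\<lambda>w. B w (P w)"]) (use assms 1 u in auto)
  moreover have "DD (\<lambda>w. B w (P w) (Q u)) u X = DD (\<lambda>w. B w (P u) (Q u)) u X + B u (DD P u X) (Q u)"
    by (rule DD_apply[OF assms(1), of "\<lambda>w x. B w x (Q u)"]) (use assms 1 u in auto)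
  ultimately show "DD (\<lambda>w. B w (P w) (Q w)) u X =
       DD (\<lambda>w. B w (P u) (Q u)) u X + B u (DD P u X) (Q u) + B u (P u) (DD Q u X)" by simp
qed

lemma DD_eq_on:
  assumes "open \<Omega>" "u \<in> \<Omega>" "\<And>w. w \<in> \<Omega> \<Longrightarrow> F w = G w" "smooth_on \<Omega> F"
  shows "DD F u X = DD G u X"
  using DD_cong[OF assms(1-3) smooth_on_differentiable[OF assms(4,2)]] by simp

section \<open>Traces and positive definite forms\<close>

definition tr :: "(real^3 \<Rightarrow> real^3) \<Rightarrow> real" where
  "tr A = (\<Sum>i\<in>UNIV. A (axis i 1) $ i)"

lemma tr_add: "tr (\<lambda>v. A v + B v) = tr A + tr B"
  and tr_diff: "tr (\<lambda>v. A v - B v) = tr A - tr B"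
  by (simp_all add: tr_def sum.distrib sum_subtractf)

lemma tr_comm:
  assumes "linear A" "linear B"
  shows "tr (\<lambda>v. A (B v)) = tr (\<lambda>v. B (A v))"
proof -
  have e: "L v $ i = (\<Sum>j\<in>UNIV. v $ j * L (axis j 1) $ i)" if "linear L" for L :: "real^3 \<Rightarrow> real^3" and v i
    using linear_axis[OF that, of v] by simp
  have "tr (\<lambda>v. A (B v)) = (\<Sum>i\<in>UNIV. \<Sum>j\<in>UNIV. B (axis i 1) $ j * A (axis j 1) $ i)"
    unfolding tr_def by (rule sum.cong[OF refl]) (rule e[OF assms(1)])
  also have "\<dots> = (\<Sum>j\<in>UNIV. \<Sum>i\<in>UNIV. A (axis j 1) $ i * B (axis i 1) $ j)"
    by (subst sum.swap) (simp add: mult.commute)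
  also have "\<dots> = tr (\<lambda>v. B (A v))"
    unfolding tr_def by (rule sum.cong[OF refl]) (rule e[OF assms(2), symmetric])
  finally show ?thesis .
qed

text \<open>The trace is defined in the fixed coordinates, where it can be differentiated. Here it
  becomes computable in any basis, in particular in an orthonormal frame that exists at a single
  point only.\<close>

lemma tr_dual_basis:
  assumes "linear A" "\<And>v. v = p v *\<^sub>R a + q v *\<^sub>R b + r v *\<^sub>R c" "linear p" "linear q" "linear r"
  shows "tr A = p (A a) + q (A b) + r (A c)"
proof -
  note e = linear_axis_real
  have "A (axis i 1) $ i = A a $ i * p (axis i 1) + A b $ i * q (axis i 1) + A c $ i * r (axis i 1)" for i
    by (subst assms(2)[of "axis i 1"]) (simp add: lins[OF assms(1)])
  then show ?thesis
    using e[OF assms(3), of "A a"] e[OF assms(4), of "A b"] e[OF assms(5), of "A c"]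
    by (simp add: tr_def sum.distrib)
qed

lemma smooth_on_tr:
  assumes "open \<Omega>" "\<And>v. smooth_on \<Omega> (\<lambda>w. A w v)"
  shows "smooth_on \<Omega> (\<lambda>w. tr (A w))"
  unfolding tr_def by (intro smooth_on_sum smooth_on_vec_nth assms)

lemma DD_tr:
  assumes "\<And>v. (\<lambda>w. A w v) differentiable (at u)"
  shows "DD (\<lambda>w. tr (A w)) u X = tr (\<lambda>v. DD (\<lambda>w. A w v) u X)"
  unfolding tr_def
  by (intro DD_eqI has_derivative_sum bounded_linear.has_derivative[OF bounded_linear_vec_nth DD_has_derivative] assms)

locale pos_form =
  fixes h :: "real^3 \<Rightarrow> real^3 \<Rightarrow> real"
  assumes lin: "linear (h X)" and sym: "h X Y = h Y X" and pos: "X \<noteq> 0 \<Longrightarrow> h X X > 0"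
begin

lemma lin': "linear (\<lambda>X. h X Y)"
  using lin[of Y] by (simp add: sym[of _ Y])

lemmas simps = lins[OF lin] lins[OF lin']

lemma eqI: "(\<And>Z. h X Z = h Y Z) \<Longrightarrow> X = Y"
  using pos[of "X - Y"] by (auto simp: simps)

lemma matrix_eq: "(\<chi> i j. h (axis i 1) (axis j 1) :: real^3^3) *v Z = (\<chi> i. h Z (axis i 1))"
  by (simp add: vec_eq_iff matrix_vector_mult_def sym[of Z] linear_axis_real[OF lin, of _ Z] mult.commute)

lemma det_nz: "det (\<chi> i j. h (axis i 1) (axis j 1) :: real^3^3) \<noteq> 0"
proof (rule det_nonzeroI)
  fix v assume "(\<chi> i j. h (axis i 1) (axis j 1) :: real^3^3) *v v = 0"
  then have "h v (axis i 1) = 0" for i unfolding matrix_eq by (simp add: vec_eq_iff)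
  then have "h v v = 0" using linear_axis_real[OF lin, of v v] by simp
  then show "v = 0" using pos[of v] by auto
qed

lemma riesz:
  assumes "linear l"
  shows "\<exists>Z. \<forall>V. h Z V = l V"
proof -
  let ?M = "\<chi> i j. h (axis i 1) (axis j 1) :: real^3^3"
  obtain Z where Z: "?M *v Z = (\<chi> i. l (axis i 1))"
    using cramer[OF det_nz] by blast
  have hl: "h Z (axis i 1) = l (axis i 1)" for i
    using Z unfolding matrix_eq by (simp add: vec_eq_iff)
  have "h Z V = l V" for V
    using linear_axis_real[OF assms, of V] linear_axis_real[OF lin, of Z V] by (simp add: hl)
  then show ?thesis by blast
qed

end

locale pos_frame = pos_form +
  fixes e1 e2 e3 :: "real^3"
  assumes orthonormal: "orthonormal3 h e1 e2 e3"
begin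

text \<open>\<open>orthonormal3\<close> also admits the value -1 on the diagonal; a positive form
  excludes it.\<close>

lemma frame: "h e1 e1 = 1" "h e2 e2 = 1" "h e3 e3 = 1" "h e1 e2 = 0" "h e1 e3 = 0" "h e2 e3 = 0"
   "h e2 e1 = 0" "h e3 e1 = 0" "h e3 e2 = 0"
proof -
  have "h X X \<ge> 0" for X using pos[of X] by (cases "X = 0") (auto simp: simps)
  then show "h e1 e1 = 1" "h e2 e2 = 1" "h e3 e3 = 1" "h e1 e2 = 0" "h e1 e3 = 0" "h e2 e3 = 0"
   "h e2 e1 = 0" "h e3 e1 = 0" "h e3 e2 = 0"
    using orthonormal by (auto simp: orthonormal3_def sym[of e2 e1] sym[of e3 e1] sym[of e3 e2] abs_of_nonneg)
qed

lemma expand: "v = h v e1 *\<^sub>R e1 + h v e2 *\<^sub>R e2 + h v e3 *\<^sub>R e3"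
proof -
  have ind: "independent {e1, e2, e3} \<and> card {e1, e2, e3} = 3"
  proof -
    have ne: "e1 \<noteq> e2" "e1 \<noteq> e3" "e2 \<noteq> e3" using frame by auto
    have "independent {e1, e2, e3}"
    proof (rule independent_if_scalars_zero)
      fix g x assume s: "(\<Sum>x\<in>{e1, e2, e3}. g x *\<^sub>R x) = 0" and x: "x \<in> {e1, e2, e3}"
      have s': "g e1 *\<^sub>R e1 + (g e2 *\<^sub>R e2 + g e3 *\<^sub>R e3) = 0" using s ne by simp
      have "g e1 = 0" "g e2 = 0" "g e3 = 0"
        using arg_cong[OF s', of "h e1"] arg_cong[OF s', of "h e2"] arg_cong[OF s', of "h e3"]
        by (simp_all add: simps frame)
      then show "g x = 0" using x by auto
    qed simp
    then show ?thesis using ne by simp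
  qed
  have "v \<in> span {e1, e2, e3}"
    using card_ge_dim_independent[of "{e1, e2, e3}" "UNIV :: (real^3) set"] ind by auto
  then obtain a where "v - a *\<^sub>R e1 \<in> span {e2, e3}"
    using span_breakdown_eq[of v e1 "{e2, e3}"] by blast
  then obtain b where "v - a *\<^sub>R e1 - b *\<^sub>R e2 \<in> span {e3}"
    using span_breakdown_eq[of _ e2 "{e3}"] by blast
  then obtain c where "v - a *\<^sub>R e1 - b *\<^sub>R e2 - c *\<^sub>R e3 \<in> span {}"
    using span_breakdown_eq[of _ e3 "{}"] by blast
  then have v: "v = a *\<^sub>R e1 + b *\<^sub>R e2 + c *\<^sub>R e3"
    by (simp add: span_empty algebra_simps)
  then have "h v e1 = a" "h v e2 = b" "h v e3 = c"
    by (simp_all add: simps frame)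
  then show ?thesis using v by simp
qed

lemma h_expand: "h v w = h v e1 * h w e1 + h v e2 * h w e2 + h v e3 * h w e3"
  using arg_cong[OF expand[of w], of "h v"] by (simp add: simps mult.commute)

lemma tr_frame: "linear A \<Longrightarrow> tr A = h (A e1) e1 + h (A e2) e2 + h (A e3) e3"
  by (rule tr_dual_basis[OF _ expand lin' lin' lin'])

lemma eq_frameI:
  assumes "h v e1 = h w e1" "h v e2 = h w e2" "h v e3 = h w e3"
  shows "v = w"
  by (rule trans[OF expand[of v] trans[OF _ expand[of w, symmetric]]]) (simp only: assms)

lemma linear_expand:
  assumes "linear L"
  shows "L v = h v e1 *\<^sub>R L e1 + h v e2 *\<^sub>R L e2 + h v e3 *\<^sub>R L e3"
  using arg_cong[OF expand[of v], of L] by (simp add: lins[OF assms])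

end

section \<open>The structure equations of a locally strictly convex hypersurface\<close>

text \<open>The difference of two candidates is a trilinear expression that is symmetric in the
  first two arguments and skew in the last two. Alternating these two swaps three times returns to
  the start with the opposite sign, so it vanishes.\<close>

lemma levi_civita_christoffel_eqI:
  assumes "pos_form (H u)" "\<And>X Y. G X Y = G Y X"
    and "\<And>X Y Z. DD (\<lambda>w. H w Y Z) u X = H u (G X Y) Z + H u Y (G X Z)"
  shows "levi_civita_christoffel H u = G"
  unfolding levi_civita_christoffel_def
proof (rule the_equality)
  interpret pos_form "H u" by fact
  show "(\<forall>X Y. G X Y = G Y X) \<and> (\<forall>X Y Z. DD (\<lambda>w. H w Y Z) u X = H u (G X Y) Z + H u Y (G X Z))"
    using assms by blast
  fix G' assume G': "(\<forall>X Y. G' X Y = G' Y X) \<and> (\<forall>X Y Z. DD (\<lambda>w. H w Y Z) u X = H u (G' X Y) Z + H u Y (G' X Z))"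
  define a where "a X Y Z = H u (G' X Y - G X Y) Z" for X Y Z
  have 1: "a X Y Z = a Y X Z" for X Y Z
    using G' assms(2) by (simp add: a_def)
  have 2: "a X Y Z = - a X Z Y" for X Y Z
  proof -
    have "H u (G' X Y) Z + H u Y (G' X Z) = H u (G X Y) Z + H u Y (G X Z)"
      using G' assms(3)[of Y Z X] by simp
    then show ?thesis by (simp add: a_def simps sym[of Y])
  qed
  have "a X Y Z = 0" for X Y Z
    using 2[of X Y Z] 1[of X Z Y] 2[of Z X Y] 1[of Z Y X] 2[of Y Z X] 1[of Y X Z] by linarith
  then have "G' X Y - G X Y = 0" for X Y
    by (intro eqI) (simp add: a_def simps)
  then show "G' = G" by (intro ext) simp
qed

locale convex_hypersurface =
  fixes W :: "(real^3) set" and f \<eta> :: "real^3 \<Rightarrow> real^4"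
  assumes open_W: "open W"
    and smooth_f: "smooth_on W f" and smooth_eta: "smooth_on W \<eta>"
    and inj_df: "u \<in> W \<Longrightarrow> inj (DD f u)"
    and transversal: "u \<in> W \<Longrightarrow> \<eta> u \<notin> range (DD f u)"
    and tangential: "u \<in> W \<Longrightarrow> DD \<eta> u X \<in> range (DD f u)"
    and convex: "u \<in> W \<Longrightarrow> X \<noteq> 0 \<Longrightarrow> affine_metric f \<eta> u X X > 0"
begin

abbreviation "h \<equiv> affine_metric f \<eta>"
abbreviation "Gam \<equiv> induced_christoffel f \<eta>"
abbreviation "Sh \<equiv> shape_operator f \<eta>"
abbreviation "K \<equiv> difference_tensor f \<eta>"

lemma linear_df: "u \<in> W \<Longrightarrow> linear (DD f u)"
  by (rule smooth_on_linear_DD[OF smooth_f])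

text \<open>Transversality separates the coefficients, injectivity of the differential the vectors.
  The structure equations are read off below by comparing two such decompositions of one
  vector.\<close>

lemma decomp_unique:
  assumes u: "u \<in> W" and e: "DD f u Z + a *\<^sub>R \<eta> u = DD f u Z' + a' *\<^sub>R \<eta> u"
  shows "Z = Z'" "a = a'"
proof -
  have 1: "(a - a') *\<^sub>R \<eta> u = DD f u (Z' - Z)"
    using e by (simp add: linear_diff[OF linear_df[OF u]] algebra_simps)
  show "a = a'"
  proof (rule ccontr)
    assume "a \<noteq> a'"
    then have "\<eta> u = (1 / (a - a')) *\<^sub>R ((a - a') *\<^sub>R \<eta> u)" by simp
    also have "\<dots> = DD f u ((1 / (a - a')) *\<^sub>R (Z' - Z))"
      unfolding 1 by (simp add: linear_cmul[OF linear_df[OF u]])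
    finally show False using transversal[OF u] by blast
  qed
  then show "Z = Z'" using e inj_df[OF u] by (simp add: inj_eq)
qed

text \<open>The columns are the coordinate tangent vectors followed by the transversal vector.
  Splitting a vector into its tangential and transversal parts becomes a linear system, so Cramer's
  rule gives existence and smooth dependence of the parts.\<close>

definition frame_matrix :: "real^3 \<Rightarrow> real^4^4" where
  "frame_matrix u = (\<chi> i j. if j = 1 then DD f u (axis 1 1) $ i else if j = 2 then DD f u (axis 2 1) $ i
      else if j = 3 then DD f u (axis 3 1) $ i else \<eta> u $ i)"

lemma frame_matrix_mult:
  assumes "u \<in> W"
  shows "frame_matrix u *v x = DD f u (vector [x$1, x$2, x$3]) + x$4 *\<^sub>R \<eta> u"
proof -
  let ?v = "vector [x$1, x$2, x$3] :: real^3"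
  have "DD f u ?v = (\<Sum>j\<in>UNIV. ?v $ j *\<^sub>R DD f u (axis j 1))"
    by (rule linear_axis[OF linear_df[OF assms]])
  then show ?thesis
    by (simp add: vec_eq_iff frame_matrix_def matrix_vector_mult_def sum_4 sum_3 vector_3 mult.commute)
qed

lemma det_frame_matrix:
  assumes "u \<in> W"
  shows "det (frame_matrix u) \<noteq> 0"
proof (rule det_nonzeroI)
  fix x assume "frame_matrix u *v x = 0"
  then have "DD f u (vector [x$1, x$2, x$3]) + x$4 *\<^sub>R \<eta> u = DD f u 0 + 0 *\<^sub>R \<eta> u"
    by (simp add: frame_matrix_mult[OF assms] linear_0[OF linear_df[OF assms]])
  from decomp_unique[OF assms this] show "x = 0"
    by (simp add: vec_eq_iff forall_4 forall_3 vector_3)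
qed

lemma decomp_exists:
  assumes "u \<in> W"
  shows "\<exists>Z a. v = DD f u Z + a *\<^sub>R \<eta> u"
proof -
  obtain x where "frame_matrix u *v x = v"
    using cramer[OF det_frame_matrix[OF assms]] by blast
  then show ?thesis using frame_matrix_mult[OF assms] by metis
qed

lemma smooth_decomp:
  assumes "smooth_on W v" "\<And>u. u \<in> W \<Longrightarrow> v u = DD f u (Z u) + a u *\<^sub>R \<eta> u"
  shows "smooth_on W Z" "smooth_on W a"
proof -
  let ?x = "\<lambda>u. vector [Z u $ 1, Z u $ 2, Z u $ 3, a u] :: real^4"
  have s: "smooth_on W ?x"
  proof (rule smooth_on_linear_solve[OF open_W _ assms(1)])
    have "smooth_on W (\<lambda>u. if P then F u else G u)" if "smooth_on W F" "smooth_on W G" for P and F G :: "real^3 \<Rightarrow> real"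
      by (cases P) (simp_all add: that)
    then show "smooth_on W (\<lambda>u. frame_matrix u $ i $ j)" for i j
      by (simp add: frame_matrix_def smooth_on_vec_nth[OF open_W smooth_on_DD[OF smooth_f]] smooth_on_vec_nth[OF open_W
          smooth_eta])
    show "det (frame_matrix u) \<noteq> 0" if "u \<in> W" for u by (rule det_frame_matrix[OF that])
    have "vector [Z u $ 1, Z u $ 2, Z u $ 3] = Z u" for u
      by (simp add: vec_eq_iff forall_3 vector_3)
    then show "frame_matrix u *v ?x u = v u" if "u \<in> W" for u
      by (simp add: frame_matrix_mult[OF that] vector_4 assms(2)[OF that])
  qed
  have zi: "smooth_on W (\<lambda>u. Z u $ i)" for i
    using smooth_on_vec_nth[OF open_W s, of 1] smooth_on_vec_nth[OF open_W s, of 2] smooth_on_vec_nth[OF open_W s, of 3]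
      exhaust_3[of i] by (auto simp: vector_4)
  show "smooth_on W Z"
    using smooth_on_vec_lambda[OF open_W, of "\<lambda>u i. Z u $ i"] zi by simp
  show "smooth_on W a"
    using smooth_on_vec_nth[OF open_W s, of 4] by (simp add: vector_4)
qed

text \<open>This evaluates the two \<open>THE\<close> operators: a splitting exists because
  \<open>frame_matrix\<close> is invertible, and it is unique by
  \<open>decomp_unique\<close>.\<close>

lemma gauss: "u \<in> W \<Longrightarrow> second_derivative f u X Y = DD f u (Gam u X Y) + h u X Y *\<^sub>R \<eta> u"
proof -
  assume u: "u \<in> W"
  obtain Z a where e: "second_derivative f u X Y = DD f u Z + a *\<^sub>R \<eta> u"
    using decomp_exists[OF u] by blast
  have "h u X Y = a"
    unfolding affine_metric_def using e decomp_unique(2)[OF u] by (intro the_equality) auto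
  moreover have "Gam u X Y = Z"
    unfolding induced_christoffel_def using e decomp_unique(1)[OF u] by (intro the_equality) auto
  ultimately show ?thesis using e by simp
qed

lemma weingarten: "u \<in> W \<Longrightarrow> DD \<eta> u X = - DD f u (Sh u X)"
proof -
  assume u: "u \<in> W"
  obtain V where V: "DD \<eta> u X = DD f u V" using tangential[OF u] by blast
  have "Sh u X = - V"
    unfolding shape_operator_def
  proof (rule the_equality)
    show "DD \<eta> u X = - DD f u (- V)" using V by (simp add: linear_neg[OF linear_df[OF u]])
    fix Z assume "DD \<eta> u X = - DD f u Z"
    then have "DD f u V = DD f u (- Z)" using V by (simp add: linear_neg[OF linear_df[OF u]])
    then have "V = - Z" using inj_df[OF u] by (simp add: inj_eq)
    then show "Z = - V" by simp
  qed
  then show ?thesis using V by (simp add: linear_neg[OF linear_df[OF u]])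
qed

lemma second_derivative_sym_f: "u \<in> W \<Longrightarrow> second_derivative f u X Y = second_derivative f u Y X"
  unfolding second_derivative_def by (rule second_derivative_sym[OF open_W _ smooth_f])

lemma sym_h: "u \<in> W \<Longrightarrow> h u X Y = h u Y X"
  and sym_Gam: "u \<in> W \<Longrightarrow> Gam u X Y = Gam u Y X"
proof -
  assume u: "u \<in> W"
  have "DD f u (Gam u X Y) + h u X Y *\<^sub>R \<eta> u = DD f u (Gam u Y X) + h u Y X *\<^sub>R \<eta> u"
    using second_derivative_sym_f[OF u] gauss[OF u] by simp
  from decomp_unique[OF u this] show "h u X Y = h u Y X" "Gam u X Y = Gam u Y X" by blast+
qed

lemma smooth_second: "smooth_on W (\<lambda>u. second_derivative f u X Y)"
  unfolding second_derivative_def by (intro smooth_on_DD smooth_f)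

lemma smooth_Gam: "smooth_on W (\<lambda>u. Gam u X Y)" and smooth_h: "smooth_on W (\<lambda>u. h u X Y)"
  using smooth_decomp[OF smooth_second gauss] by blast+

lemma smooth_Sh: "smooth_on W (\<lambda>u. Sh u X)"
  by (rule smooth_decomp(1)[where v = "\<lambda>u. - DD \<eta> u X" and a = "\<lambda>_. 0"])
     (auto simp: weingarten intro!: smooth_on_uminus open_W smooth_on_DD smooth_eta)

lemma linear_h: "u \<in> W \<Longrightarrow> linear (h u X)"
  and linear_Gam: "u \<in> W \<Longrightarrow> linear (Gam u X)"
proof -
  assume u: "u \<in> W"
  have lin: "linear (second_derivative f u X)"
    unfolding second_derivative_def
    by (rule linear_DD_field[OF open_W u]) (auto intro: linear_df smooth_on_DD smooth_f)
  have add: "DD f u (Gam u X (Y + Z)) + h u X (Y + Z) *\<^sub>R \<eta> u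
      = DD f u (Gam u X Y + Gam u X Z) + (h u X Y + h u X Z) *\<^sub>R \<eta> u" for Y Z
    using linear_add[OF lin, of Y Z] by (simp add: gauss[OF u] linear_add[OF linear_df[OF u]] algebra_simps)
  have scale: "DD f u (Gam u X (c *\<^sub>R Y)) + h u X (c *\<^sub>R Y) *\<^sub>R \<eta> u
      = DD f u (c *\<^sub>R Gam u X Y) + (c * h u X Y) *\<^sub>R \<eta> u" for Y c
    using linear_cmul[OF lin, of c Y] by (simp add: gauss[OF u] linear_cmul[OF linear_df[OF u]] algebra_simps)
  show "linear (h u X)" "linear (Gam u X)"
    by (rule linearI; use decomp_unique[OF u add] decomp_unique[OF u scale] in simp)+
qed

lemma linear_Gam': "u \<in> W \<Longrightarrow> linear (\<lambda>X. Gam u X Y)"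
  using linear_Gam[of u Y] by (simp add: sym_Gam[of u _ Y])

lemma linear_Sh: "u \<in> W \<Longrightarrow> linear (Sh u)"
proof -
  assume u: "u \<in> W"
  have lin: "linear (DD \<eta> u)" by (rule smooth_on_linear_DD[OF smooth_eta u])
  have "DD f u (Sh u (X + Y)) = DD f u (Sh u X + Sh u Y)" for X Y
    using arg_cong[OF linear_add[OF lin, of X Y], of uminus]
    by (simp add: weingarten[OF u] linear_add[OF linear_df[OF u]])
  moreover have "DD f u (Sh u (c *\<^sub>R X)) = DD f u (c *\<^sub>R Sh u X)" for c X
    using linear_cmul[OF lin, of c X] by (simp add: weingarten[OF u] linear_cmul[OF linear_df[OF u]])
  ultimately show ?thesis using inj_df[OF u] by (intro linearI) (auto simp: inj_eq)
qed

lemma pos_form_h: "u \<in> W \<Longrightarrow> pos_form (h u)"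
  by (intro pos_form.intro linear_h sym_h convex)

section \<open>The equations of Gauss, Codazzi and Ricci\<close>

lemma DD_tangent:
  assumes "smooth_on W Z" "u \<in> W"
  shows "DD (\<lambda>w. DD f w (Z w)) u X = DD f u (DD Z u X + Gam u X (Z u)) + h u X (Z u) *\<^sub>R \<eta> u"
proof -
  have "DD (\<lambda>w. DD f w (Z w)) u X = second_derivative f u X (Z u) + DD f u (DD Z u X)"
    unfolding second_derivative_def
    by (rule DD_apply[OF open_W]) (auto intro: linear_df smooth_on_DD smooth_f assms)
  then show ?thesis by (simp add: gauss assms linear_add[OF linear_df])
qed

lemma smooth_tangent: "smooth_on W Z \<Longrightarrow> smooth_on W (\<lambda>w. DD f w (Z w))"
  by (rule smooth_on_apply[OF open_W]) (auto intro: linear_df smooth_on_DD smooth_f)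

lemma DD_decomp:
  assumes "smooth_on W Z" "smooth_on W a" "u \<in> W"
  shows "DD (\<lambda>w. DD f w (Z w) + a w *\<^sub>R \<eta> w) u X =
    DD f u (DD Z u X + Gam u X (Z u) - a u *\<^sub>R Sh u X) + (h u X (Z u) + DD a u X) *\<^sub>R \<eta> u"
proof -
  have "DD (\<lambda>w. DD f w (Z w) + a w *\<^sub>R \<eta> w) u X
      = DD (\<lambda>w. DD f w (Z w)) u X + DD (\<lambda>w. a w *\<^sub>R \<eta> w) u X"
    by (intro DD_add smooth_on_differentiable[OF _ assms(3)] smooth_tangent smooth_on_scaleR open_W assms smooth_eta)
  also have "DD (\<lambda>w. a w *\<^sub>R \<eta> w) u X = a u *\<^sub>R DD \<eta> u X + DD a u X *\<^sub>R \<eta> u"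
    by (intro DD_scaleR smooth_on_differentiable[OF _ assms(3)] assms smooth_eta)
  finally show ?thesis
    by (simp add: DD_tangent assms weingarten lins[OF linear_df] algebra_simps)
qed

text \<open>Mixed derivatives of \<open>DD f w Z\<close> in the directions X and Y agree. The
  tangential part of this equality is the Gauss equation, the transversal part the Codazzi equation
  of h. Coordinate vectors are constant, so no bracket terms occur.\<close>

lemma gauss_equation:
  assumes "u \<in> W"
  shows "DD (\<lambda>w. Gam w Y Z) u X + Gam u X (Gam u Y Z) - h u Y Z *\<^sub>R Sh u X
       = DD (\<lambda>w. Gam w X Z) u Y + Gam u Y (Gam u X Z) - h u X Z *\<^sub>R Sh u Y" (is ?G)
    and codazzi_h: "h u X (Gam u Y Z) + DD (\<lambda>w. h w Y Z) u X = h u Y (Gam u X Z) + DD (\<lambda>w. h w X Z) u Y" (is ?C)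
proof -
  have e: "DD (\<lambda>w. DD (\<lambda>w. DD f w Z) w Y) u X =
     DD f u (DD (\<lambda>w. Gam w Y Z) u X + Gam u X (Gam u Y Z) - h u Y Z *\<^sub>R Sh u X) + (h u X (Gam u Y Z) + DD (\<lambda>w. h w Y Z)
         u X) *\<^sub>R \<eta> u" for X Y
  proof -
    have "DD (\<lambda>w. DD (\<lambda>w. DD f w Z) w Y) u X = DD (\<lambda>w. DD f w (Gam w Y Z) + h w Y Z *\<^sub>R \<eta> w) u X"
      using gauss smooth_second[of Y Z] unfolding second_derivative_def
      by (intro DD_eq_on[OF open_W assms]) auto
    then show ?thesis by (simp add: DD_decomp[OF smooth_Gam smooth_h assms])
  qed
  from decomp_unique[OF assms second_derivative_sym[OF open_W assms smooth_on_DD[OF smooth_f], of Z Y X, unfolded e]]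
  show ?G ?C by blast+
qed

text \<open>The same comparison for the mixed derivatives of \<eta>: the transversal part makes S
  self-adjoint, the tangential part is its Codazzi equation.\<close>

lemma ricci: "u \<in> W \<Longrightarrow> h u (Sh u X) Y = h u X (Sh u Y)"
  and codazzi_Sh: "u \<in> W \<Longrightarrow> DD (\<lambda>w. Sh w Y) u X + Gam u X (Sh u Y) = DD (\<lambda>w. Sh w X) u Y + Gam u Y (Sh u X)"
proof -
  assume u: "u \<in> W"
  have e: "DD (\<lambda>w. DD \<eta> w Y) u X = DD f u (- (DD (\<lambda>w. Sh w Y) u X + Gam u X (Sh u Y))) + (- h u X (Sh u Y)) *\<^sub>R \<eta> u" for X Y
  proof -
    have "DD (\<lambda>w. DD \<eta> w Y) u X = DD (\<lambda>w. - DD f w (Sh w Y)) u X"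
      using weingarten by (intro DD_eq_on[OF open_W u] smooth_on_DD smooth_eta) auto
    also have "\<dots> = - DD (\<lambda>w. DD f w (Sh w Y)) u X"
      by (intro DD_uminus smooth_on_differentiable[OF _ u] smooth_tangent smooth_Sh)
    finally show ?thesis
      by (simp add: DD_tangent smooth_Sh u lins[OF linear_df[OF u]])
  qed
  note d = decomp_unique[OF u second_derivative_sym[OF open_W u smooth_eta, of Y X, unfolded e]]
  show "h u (Sh u X) Y = h u X (Sh u Y)" using d(2) by (simp add: sym_h[OF u])
  show "DD (\<lambda>w. Sh w Y) u X + Gam u X (Sh u Y) = DD (\<lambda>w. Sh w X) u Y + Gam u Y (Sh u X)"
    using d(1) by (simp only: neg_equal_iff_equal)
qed

lemma linear_Dh: "u \<in> W \<Longrightarrow> linear (\<lambda>Z. DD (\<lambda>w. h w Y Z) u X)"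
  by (rule linear_DD_field[OF open_W]) (auto intro: linear_h smooth_h)

text \<open>Let C be the right hand side, which is minus half the covariant derivative of h for the
  induced connection. Codazzi makes C symmetric in X and Y, and symmetry of h makes it symmetric in
  Y and Z. Subtracting the tensor dual to C from \<open>Gam\<close> therefore leaves a torsion free
  metric connection, which is the Levi-Civita connection by uniqueness.\<close>

lemma difference_tensor_char:
  assumes u: "u \<in> W"
  shows "h u (K u X Y) Z = - 1/2 * (DD (\<lambda>w. h w Y Z) u X - h u (Gam u X Y) Z - h u Y (Gam u X Z))"
proof -
  interpret pos_form "h u" by (rule pos_form_h[OF u])
  define C where "C X Y Z = - 1/2 * (DD (\<lambda>w. h w Y Z) u X - h u (Gam u X Y) Z - h u Y (Gam u X Z))" for X Y Z
  have Dh_sym: "DD (\<lambda>w. h w Y Z) u X = DD (\<lambda>w. h w Z Y) u X" for X Y Z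
    by (rule DD_eq_on[OF open_W u]) (simp_all add: sym_h smooth_h)
  have C_sym: "C X Y Z = C Y X Z" for X Y Z
    using codazzi_h[OF u, of X Y Z] by (simp add: C_def sym_Gam[OF u, of X Y])
  have lin_C: "linear (C X Y)" for X Y
    by (rule linearI) (simp_all add: C_def lins[OF linear_Dh[OF u]] simps
        lins[OF linear_Gam[OF u]] algebra_simps)
  obtain Kc where Kc: "\<And>X Y Z. h u (Kc X Y) Z = C X Y Z"
    using riesz[OF lin_C] by metis
  have Kc_sym: "Kc X Y = Kc Y X" for X Y
    by (rule eqI) (simp add: Kc C_sym[of X Y])
  have "levi_civita_christoffel h u = (\<lambda>X Y. Gam u X Y - Kc X Y)"
  proof (rule levi_civita_christoffel_eqI[where H = h, OF pos_form_h[OF u]])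
    show "Gam u X Y - Kc X Y = Gam u Y X - Kc Y X" for X Y
      by (simp add: Kc_sym[of X Y] sym_Gam[OF u, of X Y])
    fix X Y Z
    have "C X Y Z = C X Z Y"
      using Dh_sym[of Y Z X] by (simp add: C_def sym[of "Gam u X Y" Z] sym[of "Gam u X Z" Y])
    then have "h u Y (Kc X Z) = C X Y Z"
      using Kc[of X Z Y] sym[of Y "Kc X Z"] by simp
    then show "DD (\<lambda>w. h w Y Z) u X = h u (Gam u X Y - Kc X Y) Z + h u Y (Gam u X Z - Kc X Z)"
      by (simp add: simps Kc) (simp add: C_def field_simps)
  qed
  then have "K u X Y = Kc X Y"
    by (simp add: difference_tensor_def)
  then show ?thesis by (simp add: Kc C_def)
qed

end

section \<open>Covariant derivatives of K and S for the Levi-Civita connection\<close>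

context convex_hypersurface
begin

text \<open>\<open>LC\<close> is the Levi-Civita connection of \<open>h\<close>; \<open>dK\<close> and \<open>dS\<close> are the covariant derivatives of \<open>K\<close>
  and \<open>S\<close> with respect to it, in the direction of the first vector.\<close>

definition "LC u X Y = Gam u X Y - K u X Y"

definition "dK u V X Y = DD (\<lambda>w. K w X Y) u V + LC u V (K u X Y) - K u (LC u V X) Y - K u X (LC u V Y)"

definition "dS u V X = DD (\<lambda>w. Sh w X) u V + LC u V (Sh u X) - Sh u (LC u V X)"

lemma Dh_sym: "u \<in> W \<Longrightarrow> DD (\<lambda>w. h w Y Z) u X = DD (\<lambda>w. h w Z Y) u X"
  by (rule DD_eq_on[OF open_W]) (simp_all add: sym_h smooth_h)

lemma sym_K: "u \<in> W \<Longrightarrow> K u X Y = K u Y X"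
proof -
  assume u: "u \<in> W"
  interpret pos_form "h u" by (rule pos_form_h[OF u])
  have "h u (K u X Y) Z = h u (K u Y X) Z" for Z
    unfolding difference_tensor_char[OF u]
    using codazzi_h[OF u, of X Y Z] by (simp add: sym_Gam[OF u, of X Y])
  then show ?thesis by (rule eqI)
qed

lemma cubic_sym: "u \<in> W \<Longrightarrow> h u (K u X Y) Z = h u (K u X Z) Y"
  using Dh_sym[of u Y Z X] sym_h[of u Z "Gam u X Y"] sym_h[of u Y "Gam u X Z"]
  by (simp add: difference_tensor_char)

lemma linear_K: "u \<in> W \<Longrightarrow> linear (K u X)"
proof -
  assume u: "u \<in> W"
  interpret pos_form "h u" by (rule pos_form_h[OF u])
  show ?thesis
    by (rule linearI; rule eqI) (simp_all add: cubic_sym[OF u, of X _ ] simps)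
qed

lemma linear_K': "u \<in> W \<Longrightarrow> linear (\<lambda>X. K u X Y)"
  using linear_K[of u Y] by (simp add: sym_K[of u _ Y])

lemma smooth_K: "smooth_on W (\<lambda>u. K u X Y)"
proof (rule smooth_on_linear_solve[OF open_W])
  show "smooth_on W (\<lambda>u. (\<chi> i j. h u (axis i 1) (axis j 1) :: real^3^3) $ i $ j)" for i j
    by (simp add: smooth_h)
  have "smooth_on W (\<lambda>u. - 1/2 * (DD (\<lambda>w. h w Y (axis i 1)) u X - h u (Gam u X Y) (axis i 1) - h u Y (Gam u X (axis i
      1))))" for i
    by (intro smooth_on_mult[OF open_W] smooth_on_const smooth_on_diff[OF open_W] smooth_on_DD smooth_h
       smooth_on_apply[OF open_W, of "\<lambda>w v. h w v (axis i 1)"] smooth_on_apply[OF open_W, of "\<lambda>w. h w Y"]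
       smooth_Gam linear_h pos_form.lin'[OF pos_form_h])
  then show "smooth_on W (\<lambda>u. \<chi> i. - 1/2 * (DD (\<lambda>w. h w Y (axis i 1)) u X - h u (Gam u X Y) (axis i 1) - h u Y (Gam u X
      (axis i 1))))"
    by (rule smooth_on_vec_lambda[OF open_W])
  show "det (\<chi> i j. h u (axis i 1) (axis j 1) :: real^3^3) \<noteq> 0" if "u \<in> W" for u
    by (rule pos_form.det_nz[OF pos_form_h[OF that]])
  show "(\<chi> i j. h u (axis i 1) (axis j 1) :: real^3^3) *v K u X Y =
     (\<chi> i. - 1/2 * (DD (\<lambda>w. h w Y (axis i 1)) u X - h u (Gam u X Y) (axis i 1) - h u Y (Gam u X (axis i 1))))"
    if "u \<in> W" for u
    unfolding pos_form.matrix_eq[OF pos_form_h[OF that]] difference_tensor_char[OF that] ..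
qed

lemma linear_LC: "u \<in> W \<Longrightarrow> linear (LC u X)"
  unfolding LC_def by (intro linear_compose_sub linear_Gam linear_K)

lemma linear_LC': "u \<in> W \<Longrightarrow> linear (\<lambda>X. LC u X Y)"
  unfolding LC_def by (intro linear_compose_sub linear_Gam' linear_K')

lemma sym_LC: "u \<in> W \<Longrightarrow> LC u X Y = LC u Y X"
  by (simp add: LC_def sym_Gam[of u X Y] sym_K[of u X Y])

lemma smooth_LC: "smooth_on W (\<lambda>u. LC u X Y)"
  unfolding LC_def by (intro smooth_on_diff open_W smooth_Gam smooth_K)

lemma Dh_LC: "u \<in> W \<Longrightarrow> DD (\<lambda>w. h w Y Z) u X = h u (LC u X Y) Z + h u Y (LC u X Z)"
proof -
  assume u: "u \<in> W"
  interpret pos_form "h u" by (rule pos_form_h[OF u])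
  show ?thesis
    using difference_tensor_char[OF u, of X Y Z] cubic_sym[OF u, of X Y Z] sym[of Y "K u X Z"]
    by (simp add: LC_def simps)
qed

lemma DD_h:
  assumes "smooth_on W P" "smooth_on W Q" "u \<in> W"
  shows "DD (\<lambda>w. h w (P w) (Q w)) u X = h u (DD P u X + LC u X (P u)) (Q u) + h u (P u) (DD Q u X + LC u X (Q u))"
proof -
  interpret pos_form "h u" by (rule pos_form_h[OF assms(3)])
  have "DD (\<lambda>w. h w (P w) (Q w)) u X = DD (\<lambda>w. h w (P u) (Q u)) u X + h u (DD P u X) (Q u) + h u (P u) (DD Q u X)"
    by (rule DD_apply2[OF open_W pos_form.lin'[OF pos_form_h] linear_h smooth_h assms])
  then show ?thesis by (simp add: Dh_LC assms(3) simps)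
qed

lemma smooth_h_apply: "smooth_on W P \<Longrightarrow> smooth_on W Q \<Longrightarrow> smooth_on W (\<lambda>w. h w (P w) (Q w))"
  by (rule smooth_on_apply2[OF open_W pos_form.lin'[OF pos_form_h] linear_h smooth_h])

lemma smooth_K_apply: "smooth_on W P \<Longrightarrow> smooth_on W Q \<Longrightarrow> smooth_on W (\<lambda>w. K w (P w) (Q w))"
  by (rule smooth_on_apply2[OF open_W linear_K' linear_K smooth_K])

lemma linear_DK: "u \<in> W \<Longrightarrow> linear (\<lambda>Y. DD (\<lambda>w. K w X Y) u V)"
  by (rule linear_DD_field[OF open_W]) (auto intro: linear_K smooth_K)

lemma linear_DS: "u \<in> W \<Longrightarrow> linear (\<lambda>Y. DD (\<lambda>w. Sh w Y) u V)"
  by (rule linear_DD_field[OF open_W]) (auto intro: linear_Sh smooth_Sh)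

lemma linear_dK: "u \<in> W \<Longrightarrow> linear (dK u V X)"
  unfolding dK_def
  by (rule linearI) (simp_all add: lins[OF linear_DK] lins[OF linear_LC] lins[OF linear_K] algebra_simps)

lemma linear_dK_dir: "u \<in> W \<Longrightarrow> linear (\<lambda>V. dK u V X Y)"
  unfolding dK_def
  by (rule linearI) (simp_all add: lins[OF smooth_on_linear_DD[OF smooth_K]] lins[OF linear_LC'] lins[OF linear_K]
      lins[OF linear_K'] algebra_simps)

lemma linear_dS: "u \<in> W \<Longrightarrow> linear (dS u V)"
  unfolding dS_def
  by (rule linearI) (simp_all add: lins[OF linear_DS] lins[OF linear_LC] lins[OF linear_Sh] algebra_simps)

lemma dK_sym: "u \<in> W \<Longrightarrow> dK u V X Y = dK u V Y X"
proof -
  assume u: "u \<in> W"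
  have "DD (\<lambda>w. K w X Y) u V = DD (\<lambda>w. K w Y X) u V"
    by (rule DD_eq_on[OF open_W u sym_K smooth_K])
  then show ?thesis
    by (simp add: dK_def sym_K[OF u, of X Y] sym_K[OF u, of "LC u V X" Y] sym_K[OF u, of "LC u V Y" X])
qed

lemma dK_cubic_sym: "u \<in> W \<Longrightarrow> h u (dK u V X Y) Z = h u (dK u V X Z) Y"
proof -
  assume u: "u \<in> W"
  interpret pos_form "h u" by (rule pos_form_h[OF u])
  have e: "DD (\<lambda>w. h w (K w X Y) Z) u V = h u (DD (\<lambda>w. K w X Y) u V + LC u V (K u X Y)) Z + h u (K u X Y) (LC u V Z)" for Y Z
    using DD_h[OF smooth_K smooth_on_const u, of X Y Z V] by simp
  have "DD (\<lambda>w. h w (K w X Y) Z) u V = DD (\<lambda>w. h w (K w X Z) Y) u V"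
    by (rule DD_eq_on[OF open_W u cubic_sym smooth_h_apply[OF smooth_K smooth_on_const]])
  then show ?thesis
    using cubic_sym[OF u, of X Y "LC u V Z"] cubic_sym[OF u, of X Z "LC u V Y"] cubic_sym[OF u, of "LC u V X" Y Z]
    by (simp add: e dK_def simps)
qed

lemma dS_self_adjoint: "u \<in> W \<Longrightarrow> h u (dS u V X) Y = h u X (dS u V Y)"
proof -
  assume u: "u \<in> W"
  interpret pos_form "h u" by (rule pos_form_h[OF u])
  have "DD (\<lambda>w. h w (Sh w X) Y) u V = h u (DD (\<lambda>w. Sh w X) u V + LC u V (Sh u X)) Y + h u (Sh u X) (LC u V Y)"
    using DD_h[OF smooth_Sh smooth_on_const u, of X Y V] by simp
  moreover have "DD (\<lambda>w. h w X (Sh w Y)) u V = h u (LC u V X) (Sh u Y) + h u X (DD (\<lambda>w. Sh w Y) u V + LC u V (Sh u Y))"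
    using DD_h[OF smooth_on_const smooth_Sh u, of X Y V] by simp
  moreover have "DD (\<lambda>w. h w (Sh w X) Y) u V = DD (\<lambda>w. h w X (Sh w Y)) u V"
    by (rule DD_eq_on[OF open_W u ricci smooth_h_apply[OF smooth_Sh smooth_on_const]])
  ultimately show ?thesis
    by (simp add: dS_def simps ricci[OF u])
qed

text \<open>Writing the induced connection as \<open>LC\<close> + K in the Codazzi equation of S
  moves the failure of \<open>dS\<close> to be symmetric into K.\<close>

lemma codazzi_dS: "u \<in> W \<Longrightarrow> dS u X Y - dS u Y X = K u Y (Sh u X) - K u X (Sh u Y)"
  using codazzi_Sh[of u Y X] by (simp add: dS_def LC_def sym_Gam[of u X Y] sym_K[of u X Y] algebra_simps)

text \<open>R is only half of the curvature operator, which is R X Y - R Y X; keeping both halves on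
  separate sides avoids subtractions. The first claim is the Gauss equation with \<open>Gam\<close>
  = \<open>LC\<close> + K. The second, skewness of the curvature for h, comes from the symmetry of
  the second derivatives of the function h(Z, V).\<close>

lemma curvature_LC:
  fixes u defines "R \<equiv> \<lambda>X Y Z. DD (\<lambda>w. LC w Y Z) u X + LC u X (LC u Y Z)"
  assumes u: "u \<in> W"
  shows curvature_LC_eq: "R X Y Z + dK u X Y Z + K u X (K u Y Z) - h u Y Z *\<^sub>R Sh u X
     = R Y X Z + dK u Y X Z + K u Y (K u X Z) - h u X Z *\<^sub>R Sh u Y" (is ?A)
    and curvature_LC_skew: "h u (R X Y Z) V + h u Z (R X Y V) = h u (R Y X Z) V + h u Z (R Y X V)" (is ?B)
proof -
  interpret pos_form "h u" by (rule pos_form_h[OF u])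
  have "DD (\<lambda>w. LC w Y Z) u X = DD (\<lambda>w. Gam w Y Z) u X - DD (\<lambda>w. K w Y Z) u X" for X Y Z
    unfolding LC_def by (intro DD_diff smooth_on_differentiable[OF _ u] smooth_Gam smooth_K)
  then have G: "DD (\<lambda>w. Gam w Y Z) u X = DD (\<lambda>w. LC w Y Z) u X + DD (\<lambda>w. K w Y Z) u X" for X Y Z
    by simp
  have G': "Gam u X Y = LC u X Y + K u X Y" for X Y by (simp add: LC_def)
  show ?A
    using gauss_equation[OF u, of Y Z X]
    unfolding G G' R_def dK_def
    by (simp add: linear_add[OF linear_LC[OF u]] linear_add[OF linear_K[OF u]] sym_LC[OF u, of X Y] algebra_simps)
  have e: "DD (\<lambda>w. DD (\<lambda>w. h w Z V) w Y) u X = h u (R X Y Z) V + h u (LC u Y Z) (LC u X V) + (h u (LC u X Z) (LC u Y V)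
      + h u Z (R X Y V))" for X Y
  proof -
    have "DD (\<lambda>w. DD (\<lambda>w. h w Z V) w Y) u X = DD (\<lambda>w. h w (LC w Y Z) V + h w Z (LC w Y V)) u X"
      by (rule DD_eq_on[OF open_W u Dh_LC smooth_on_DD[OF smooth_h]])
    also have "\<dots> = DD (\<lambda>w. h w (LC w Y Z) V) u X + DD (\<lambda>w. h w Z (LC w Y V)) u X"
      by (intro DD_add smooth_on_differentiable[OF _ u] smooth_h_apply smooth_on_const smooth_LC)
    finally show ?thesis
      using DD_h[OF smooth_LC smooth_on_const u, of Y Z V X] DD_h[OF smooth_on_const smooth_LC u, of Z Y V X]
      by (simp add: R_def)
  qed
  show ?B
    using second_derivative_sym[OF open_W u smooth_h, of Z V Y X] unfolding e
    by (simp add: sym[of "LC u Y Z"])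
qed

text \<open>The Gauss equation is paired with V and then again with Z and V exchanged, and the two
  are added. The curvature cancels because it is skew, and so does the commutator of
  \<open>K u X\<close> and \<open>K u Y\<close>; only \<open>dK\<close> and S survive.\<close>

lemma codazzi_dK:
  assumes u: "u \<in> W"
  shows "2 * (h u (dK u X Y Z) V - h u (dK u Y X Z) V) = h u Y Z * h u (Sh u X) V + h u Y V * h u (Sh u X) Z
      - h u X Z * h u (Sh u Y) V - h u X V * h u (Sh u Y) Z"
proof -
  interpret pos_form "h u" by (rule pos_form_h[OF u])
  let ?R = "\<lambda>X Y Z. DD (\<lambda>w. LC w Y Z) u X + LC u X (LC u Y Z)"
  have A: "h u (?R X Y Z) V + h u (dK u X Y Z) V + h u (K u X V) (K u Y Z) - h u Y Z * h u (Sh u X) V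
     = h u (?R Y X Z) V + h u (dK u Y X Z) V + h u (K u Y V) (K u X Z) - h u X Z * h u (Sh u Y) V" for Z V
    using arg_cong[OF curvature_LC_eq[OF u, where X = X and Y = Y and Z = Z], of "\<lambda>v. h u v V"]
    by (simp add: simps cubic_sym[OF u, of _ _ V])
  \<comment> \<open>The terms are abstracted to real variables: d for \<open>dK\<close>, r and s for
    curvature, k for products of K, p for the terms with S.\<close>
  have ring: "2 * (d1 - d2) = p1 + p3 - p2 - p4"
    if "r1 + d1 + k1 - p1 = r2 + d2 + k2 - p2" "r3 + d3 + k3 - p3 = r4 + d4 + k4 - p4" "r1 + s3 = r2 + s4"
      "d1 = d3" "d2 = d4" "s3 = r3" "s4 = r4" "k2 = k3" "k1 = k4"
    for d1 d2 d3 d4 k1 k2 k3 k4 p1 p2 p3 p4 r1 r2 r3 r4 s3 s4 :: real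
    using that by (simp add: algebra_simps)
  show ?thesis
    by (rule ring[OF A[of Z V] A[of V Z] curvature_LC_skew[OF u, where X = X and Y = Y and Z = Z and V = V]
      dK_cubic_sym[OF u] dK_cubic_sym[OF u] sym sym sym sym])
qed

end

section \<open>The symmetry group in an adapted frame\<close>

context pos_frame
begin

text \<open>With the frame vectors as columns of E, the matrix of g and the matrix A of its frame
  components satisfy \<open>matrix g ** E = E ** A\<close>, so they have the same
  determinant.\<close>

lemma det_matrix_frame:
  assumes "linear g"
  shows "det (matrix g) = h (g e1) e1 * (h (g e2) e2 * h (g e3) e3 - h (g e3) e2 * h (g e2) e3)
     - h (g e2) e1 * (h (g e1) e2 * h (g e3) e3 - h (g e3) e2 * h (g e1) e3)
     + h (g e3) e1 * (h (g e1) e2 * h (g e2) e3 - h (g e2) e2 * h (g e1) e3)"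
proof -
  define e where "e i = (if i = 1 then e1 else if i = 2 then e2 else e3)" for i :: 3
  define E :: "real^3^3" where "E = (\<chi> i j. e j $ i)"
  define A :: "real^3^3" where "A = (\<chi> i j. h (g (e j)) (e i))"
  have e: "e 1 = e1" "e 2 = e2" "e 3 = e3" by (simp_all add: e_def)
  have Ev: "E *v x = x$1 *\<^sub>R e1 + x$2 *\<^sub>R e2 + x$3 *\<^sub>R e3" for x
    by (simp add: vec_eq_iff E_def matrix_vector_mult_def sum_3 e mult.commute)
  have "det E \<noteq> 0"
  proof (rule det_nonzeroI)
    fix x assume "E *v x = 0"
    then have z: "h (E *v x) v = 0" for v by (simp add: simps)
    show "x = 0" using z[of e1] z[of e2] z[of e3] unfolding Ev by (simp add: vec_eq_iff forall_3 simps frame)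
  qed
  moreover have "matrix g ** E = E ** A"
  proof -
    have "(matrix g ** E) $ i $ j = (E ** A) $ i $ j" for i j
    proof -
      have "(matrix g ** E) $ i $ j = (matrix g *v e j) $ i"
        by (simp add: matrix_matrix_mult_def matrix_vector_mult_def E_def)
      also have "\<dots> = g (e j) $ i" using matrix_works assms linear_matrix_vector_mul_eq by (metis matrix_vector_mul)
      also have "\<dots> = (h (g (e j)) e1 *\<^sub>R e1 + h (g (e j)) e2 *\<^sub>R e2 + h (g (e j)) e3 *\<^sub>R e3) $ i"
        using expand[of "g (e j)"] by simp
      also have "\<dots> = (E ** A) $ i $ j"
        by (simp add: matrix_matrix_mult_def E_def A_def sum_3 e mult.commute)
      finally show ?thesis .
    qed
    then show ?thesis by (simp add: vec_eq_iff)
  qed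
  ultimately have "det (matrix g) = det A"
    using det_mul[of "matrix g" E] det_mul[of E A] by simp
  then show ?thesis
    by (simp add: det_3 A_def e algebra_simps)
qed

end

text \<open>In an adapted frame the cubic form \<open>h(K(X,X),X)\<close> is \<open>6 b x\<^sub>1 x\<^sub>2 x\<^sub>3\<close> and \<open>S\<close> is diagonal.\<close>
definition adapted ::
    "(real^3 \<Rightarrow> real^3 \<Rightarrow> real) \<Rightarrow> (real^3 \<Rightarrow> real^3 \<Rightarrow> real^3) \<Rightarrow> (real^3 \<Rightarrow> real^3)
      \<Rightarrow> real^3 \<Rightarrow> real^3 \<Rightarrow> real^3 \<Rightarrow> real \<Rightarrow> real \<Rightarrow> real \<Rightarrow> real \<Rightarrow> bool" where
  "adapted h K S e1 e2 e3 b l1 l2 l3 \<longleftrightarrow> orthonormal3 h e1 e2 e3 \<and>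
     K e1 e1 = 0 \<and> K e2 e2 = 0 \<and> K e3 e3 = 0 \<and>
     K e1 e2 = b *\<^sub>R e3 \<and> K e2 e3 = b *\<^sub>R e1 \<and> K e3 e1 = b *\<^sub>R e2 \<and>
     S e1 = l1 *\<^sub>R e1 \<and> S e2 = l2 *\<^sub>R e2 \<and> S e3 = l3 *\<^sub>R e3"

locale adapted_frame = pos_form +
  fixes K :: "real^3 \<Rightarrow> real^3 \<Rightarrow> real^3" and S e1 e2 e3 b l1 l2 l3
  assumes K_sym: "K X Y = K Y X" and K_lin: "linear (K X)" and S_lin: "linear S"
    and adapted: "adapted h K S e1 e2 e3 b l1 l2 l3"
begin

sublocale pos_frame h e1 e2 e3
  using adapted by unfold_locales (simp add: adapted_def)

lemma KS: "K e1 e1 = 0" "K e2 e2 = 0" "K e3 e3 = 0" "K e1 e2 = b *\<^sub>R e3" "K e2 e3 = b *\<^sub>R e1" "K e3 e1 = b *\<^sub>R e2"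
   "K e2 e1 = b *\<^sub>R e3" "K e3 e2 = b *\<^sub>R e1" "K e1 e3 = b *\<^sub>R e2"
   "S e1 = l1 *\<^sub>R e1" "S e2 = l2 *\<^sub>R e2" "S e3 = l3 *\<^sub>R e3"
  using adapted K_sym[of e2 e1] K_sym[of e3 e2] K_sym[of e1 e3] by (simp_all add: adapted_def)

lemma K_comp:
  "h (K X Y) e1 = b * (h X e2 * h Y e3 + h X e3 * h Y e2)"
  "h (K X Y) e2 = b * (h X e1 * h Y e3 + h X e3 * h Y e1)"
  "h (K X Y) e3 = b * (h X e1 * h Y e2 + h X e2 * h Y e1)"
proof -
  have "K X e = h X e1 *\<^sub>R K e1 e + h X e2 *\<^sub>R K e2 e + h X e3 *\<^sub>R K e3 e" for e
    using linear_expand[OF K_lin[of e], of X] by (simp add: K_sym[of _ e])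
  note 1 = this[of e1] this[of e2] this[of e3]
  show "h (K X Y) e1 = b * (h X e2 * h Y e3 + h X e3 * h Y e2)"
    "h (K X Y) e2 = b * (h X e1 * h Y e3 + h X e3 * h Y e1)"
    "h (K X Y) e3 = b * (h X e1 * h Y e2 + h X e2 * h Y e1)"
    using linear_expand[OF K_lin[of X], of Y] 1
    by (simp_all add: KS simps frame algebra_simps)
qed

lemma S_comp: "h (S X) e1 = l1 * h X e1" "h (S X) e2 = l2 * h X e2" "h (S X) e3 = l3 * h X e3"
  using linear_expand[OF S_lin, of X] by (simp_all add: KS simps frame)

text \<open>A diagonal sign change preserves the product of the three coordinates exactly when the
  signs multiply to 1, which is also the orientation condition. Diagonal S commutes with it in any
  case.\<close>

lemma in_symmetry_group:
  assumes "linear g" "\<And>X. h (g X) e1 = s1 * h X e1" "\<And>X. h (g X) e2 = s2 * h X e2" "\<And>X. h (g X) e3 = s3 * h X e3"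
    and "s1 * s1 = 1" "s2 * s2 = 1" "s3 = s1 * s2"
  shows "g \<in> symmetry_group h K S"
proof -
  have s: "s1 = 1 \<or> s1 = -1" "s2 = 1 \<or> s2 = -1" using assms(5,6) by (simp_all add: square_eq_1_iff)
  have "det (matrix g) = 1"
    using s by (auto simp: det_matrix_frame[OF assms(1)] assms(2-4,7) frame)
  moreover have "h (g X) (g Y) = h X Y" for X Y
    using s by (subst (1 2) h_expand) (auto simp: assms(2-4,7))
  moreover have "K (g X) (g Y) = g (K X Y)" for X Y
    using s by (intro eq_frameI) (auto simp: K_comp assms(2-4,7))
  moreover have "S (g X) = g (S X)" for X
    by (intro eq_frameI) (auto simp: S_comp assms(2-4))
  ultimately show ?thesis using assms(1) by (simp add: symmetry_group_def)
qed

lemma half_turn_comp: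
  "h (half_turn h e1 X) e1 = h X e1" "h (half_turn h e1 X) e2 = - h X e2" "h (half_turn h e1 X) e3 = - h X e3"
  "h (half_turn h e2 X) e1 = - h X e1" "h (half_turn h e2 X) e2 = h X e2" "h (half_turn h e2 X) e3 = - h X e3"
  "h (half_turn h e3 X) e1 = - h X e1" "h (half_turn h e3 X) e2 = - h X e2" "h (half_turn h e3 X) e3 = h X e3"
  by (simp_all add: half_turn_def simps frame)

lemma linear_half_turn: "linear (half_turn h e)"
  unfolding half_turn_def by (rule linearI) (simp_all add: simps algebra_simps)

text \<open>Commuting with S, a symmetry preserves the axis of \<open>e3\<close> and its orthogonal
  plane. In that plane the \<open>e3\<close>-component of K(X, X) is a multiple of x1 x2, so the
  axes of \<open>e1\<close> and \<open>e2\<close> are kept or exchanged. Orientation rules out the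
  exchange and leaves four sign patterns.\<close>

lemma symmetry_group_eq:
  assumes b: "b \<noteq> 0" and l: "l1 = l2" "l2 \<noteq> l3"
  shows "symmetry_group h K S = {id, half_turn h e1, half_turn h e2, half_turn h e3}"
proof (intro equalityI subsetI)
  fix g assume "g \<in> {id, half_turn h e1, half_turn h e2, half_turn h e3}"
  then show "g \<in> symmetry_group h K S"
    using in_symmetry_group[OF linear_id, of 1 1 1] in_symmetry_group[OF linear_half_turn, of e1 1 "-1" "-1"]
      in_symmetry_group[OF linear_half_turn, of e2 "-1" 1 "-1"] in_symmetry_group[OF linear_half_turn, of e3 "-1" "-1" 1]
    by (auto simp: half_turn_comp)
next
  fix g assume "g \<in> symmetry_group h K S"
  then have g: "linear g" "det (matrix g) > 0" "\<And>X Y. h (g X) (g Y) = h X Y" "\<And>X Y. K (g X) (g Y) = g (K X Y)"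
      "\<And>X. S (g X) = g (S X)"
    by (auto simp: symmetry_group_def)
  have "l1 * h (g e3) e1 = l3 * h (g e3) e1" "l2 * h (g e3) e2 = l3 * h (g e3) e2"
    using S_comp(1)[of "g e3"] S_comp(2)[of "g e3"] by (auto simp: g(5) KS linear_cmul[OF g(1)] simps)
  then have c3: "h (g e3) e1 = 0" "h (g e3) e2 = 0" using l by auto
  have c33: "h (g e3) e3 * h (g e3) e3 = 1"
    using g(3)[of e3 e3] h_expand[of "g e3" "g e3"] by (simp add: c3 frame)
  then have nz: "h (g e3) e3 \<noteq> 0" by auto
  have c31: "h (g e1) e3 = 0" "h (g e2) e3 = 0"
    using g(3)[of e1 e3] h_expand[of "g e1" "g e3"] g(3)[of e2 e3] h_expand[of "g e2" "g e3"] nz by (simp_all add: c3 frame)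
  have n1: "h (g e1) e1 * h (g e1) e1 + h (g e1) e2 * h (g e1) e2 = 1"
    and n2: "h (g e2) e1 * h (g e2) e1 + h (g e2) e2 * h (g e2) e2 = 1"
    and n12: "h (g e1) e1 * h (g e2) e1 + h (g e1) e2 * h (g e2) e2 = 0"
    using g(3)[of e1 e1] h_expand[of "g e1" "g e1"] g(3)[of e2 e2] h_expand[of "g e2" "g e2"]
      g(3)[of e1 e2] h_expand[of "g e1" "g e2"] by (simp_all add: c31 frame)
  \<comment> \<open>K vanishes on (\<open>e1\<close>, \<open>e1\<close>), hence on
    (\<open>g e1\<close>, \<open>g e1\<close>), where its \<open>e3\<close>-component is twice b
    times this product.\<close>
  have k1: "h (g e1) e1 * h (g e1) e2 = 0"
    using K_comp(3)[of "g e1" "g e1"] b by (simp add: g(4) KS linear_0[OF g(1)] simps)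
  have k2: "h (g e1) e1 * h (g e2) e2 + h (g e1) e2 * h (g e2) e1 = h (g e3) e3"
    using K_comp(3)[of "g e1" "g e2"] b by (simp add: g(4) KS linear_cmul[OF g(1)] simps)
  have det: "(h (g e1) e1 * h (g e2) e2 - h (g e2) e1 * h (g e1) e2) * h (g e3) e3 > 0"
    using g(2) by (simp add: det_matrix_frame[OF g(1)] c3 c31 algebra_simps)
  \<comment> \<open>If the axes were exchanged, \<open>k2\<close> would identify the off-diagonal
    product with the \<open>e3\<close>-entry of g, and the determinant would be minus the square of
    that entry.\<close>
  have c12: "h (g e1) e2 = 0"
  proof (rule ccontr)
    assume ne: "h (g e1) e2 \<noteq> 0"
    then have "h (g e1) e1 = 0" using k1 by simp
    moreover from this have "h (g e2) e2 = 0" using n12 ne by simp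
    ultimately have "- (h (g e3) e3 * h (g e3) e3) > 0" using det k2 by (simp add: mult.commute)
    then show False using c33 by simp
  qed
  then have s1: "h (g e1) e1 = 1 \<or> h (g e1) e1 = - 1" using n1 by (simp add: square_eq_1_iff)
  then have c21: "h (g e2) e1 = 0" using n12 c12 by auto
  then have s2: "h (g e2) e2 = 1 \<or> h (g e2) e2 = - 1" using n2 by (simp add: square_eq_1_iff)
  have ge: "h (g X) e1 = h (g e1) e1 * h X e1" "h (g X) e2 = h (g e2) e2 * h X e2"
    "h (g X) e3 = h (g e1) e1 * h (g e2) e2 * h X e3" for X
    using linear_expand[OF g(1), of X] k2 by (simp_all add: simps c3 c31 c12 c21)
  define p q where "p = h (g e1) e1" and "q = h (g e2) e2"
  note ge' = ge[folded p_def q_def]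
  have frame_ext: "g = g'" if "\<And>X. h (g X) e1 = h (g' X) e1" "\<And>X. h (g X) e2 = h (g' X) e2"
      "\<And>X. h (g X) e3 = h (g' X) e3" for g'
    by (rule ext, rule eq_frameI) (fact that)+
  have "g = id" if "p = 1" "q = 1"
    by (rule frame_ext) (simp_all add: ge' that)
  moreover have "g = half_turn h e1" if "p = 1" "q = -1"
    by (rule frame_ext) (simp_all add: ge' that half_turn_comp)
  moreover have "g = half_turn h e2" if "p = -1" "q = 1"
    by (rule frame_ext) (simp_all add: ge' that half_turn_comp)
  moreover have "g = half_turn h e3" if "p = -1" "q = -1"
    by (rule frame_ext) (simp_all add: ge' that half_turn_comp)
  ultimately show "g \<in> {id, half_turn h e1, half_turn h e2, half_turn h e3}"
    using s1[folded p_def] s2[folded q_def] by blast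
qed

text \<open>If \<open>S\<close> is a multiple of the identity, then the cyclic permutation of the frame is a further symmetry.\<close>
lemma symmetry_group_ne:
  assumes l: "l1 = l2" "l2 = l3"
  shows "symmetry_group h K S \<noteq> {id, half_turn h e1, half_turn h e2, half_turn h e3}"
proof
  assume eq: "symmetry_group h K S = {id, half_turn h e1, half_turn h e2, half_turn h e3}"
  define g where "g X = h X e1 *\<^sub>R e2 + h X e2 *\<^sub>R e3 + h X e3 *\<^sub>R e1" for X
  have lin_g: "linear g" unfolding g_def by (rule linearI) (simp_all add: simps algebra_simps)
  have gc: "h (g X) e1 = h X e3" "h (g X) e2 = h X e1" "h (g X) e3 = h X e2" for X
    by (simp_all add: g_def simps frame)
  have "det (matrix g) = 1" by (simp add: det_matrix_frame[OF lin_g] gc frame)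
  moreover have "h (g X) (g Y) = h X Y" for X Y
    using h_expand[of "g X" "g Y"] h_expand[of X Y] by (simp add: gc)
  moreover have "K (g X) (g Y) = g (K X Y)" for X Y
    by (intro eq_frameI) (auto simp: K_comp gc)
  moreover have "S (g X) = g (S X)" for X
    by (intro eq_frameI) (auto simp: S_comp gc l)
  ultimately have "g \<in> symmetry_group h K S" using lin_g by (simp add: symmetry_group_def)
  then have "g \<in> {id, half_turn h e1, half_turn h e2, half_turn h e3}" using eq by blast
  then have "g e1 = e1 \<or> g e1 = half_turn h e1 e1 \<or> g e1 = half_turn h e2 e1 \<or> g e1 = half_turn h e3 e1"
    by auto
  then have "h (g e1) e2 = 0" by (auto simp: half_turn_comp frame)
  then show False by (simp add: gc frame)
qed

end

text \<open>A vector fixed by one half turn lies on its axis, and a vector fixed by two is zero.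
  K(e_i, e_i) is fixed by all half turns, while K(e_i, e_j) and S e_k are fixed by the one about the
  third axis, respectively about e_k. Total symmetry of the cubic form makes the three coefficients
  equal.\<close>

lemma adapted_of_half_turns:
  assumes "pos_form h" "\<And>X Y. K X Y = K Y X" "\<And>X Y Z. h (K X Y) Z = h (K X Z) Y"
    and K_lin: "\<And>X. linear (K X)" and "linear S" and "orthonormal3 h e1 e2 e3"
    and "{half_turn h e1, half_turn h e2, half_turn h e3} \<subseteq> symmetry_group h K S"
  shows "\<exists>b l1 l2 l3. adapted h K S e1 e2 e3 b l1 l2 l3"
proof -
  interpret pos_frame h e1 e2 e3 using assms(1,6) by (simp add: pos_frame_def pos_frame_axioms_def)
  have K_lin': "linear (\<lambda>X. K X Y)" for Y using K_lin[of Y] by (simp add: assms(2)[of _ Y])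
  note Ksimps = linear_neg[OF K_lin] linear_neg[OF K_lin'] linear_neg[OF assms(5)]
  have g: "K (half_turn h e X) (half_turn h e Y) = half_turn h e (K X Y)" "S (half_turn h e X) = half_turn h e (S X)"
    if "e \<in> {e1, e2, e3}" for e X Y
    using assms(7) that by (auto simp: symmetry_group_def)
  have t: "half_turn h e1 e1 = e1" "half_turn h e1 e2 = - e2" "half_turn h e1 e3 = - e3"
    "half_turn h e2 e1 = - e1" "half_turn h e2 e2 = e2" "half_turn h e2 e3 = - e3"
    "half_turn h e3 e1 = - e1" "half_turn h e3 e2 = - e2" "half_turn h e3 e3 = e3"
    by (simp_all add: half_turn_def frame scaleR_2)
  have fixed: "V = h V e *\<^sub>R e" if "V = half_turn h e V" for V e
  proof -
    have "2 *\<^sub>R V = 2 *\<^sub>R (h V e *\<^sub>R e)" using that by (simp add: half_turn_def scaleR_2 algebra_simps)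
    then show ?thesis by (simp only: scaleR_cancel_left) simp
  qed
  have zero: "V = 0" if "V = half_turn h e1 V" "V = half_turn h e2 V" for V
  proof -
    have "h V e1 = 0" using arg_cong[OF fixed[OF that(2)], of "\<lambda>v. h v e1"] by (simp add: simps frame)
    then show ?thesis using fixed[OF that(1)] by simp
  qed
  have "K e1 e1 = 0" "K e2 e2 = 0" "K e3 e3 = 0"
    using g(1)[of e1 e1 e1] g(1)[of e2 e1 e1] g(1)[of e1 e2 e2] g(1)[of e2 e2 e2] g(1)[of e1 e3 e3] g(1)[of e2 e3 e3]
    by (auto intro!: zero simp: t Ksimps)
  moreover have "K e1 e2 = h (K e1 e2) e3 *\<^sub>R e3" "K e2 e3 = h (K e2 e3) e1 *\<^sub>R e1" "K e3 e1 = h (K e3 e1) e2 *\<^sub>R e2"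
    "S e1 = h (S e1) e1 *\<^sub>R e1" "S e2 = h (S e2) e2 *\<^sub>R e2" "S e3 = h (S e3) e3 *\<^sub>R e3"
    using g(1)[of e3 e1 e2] g(1)[of e1 e2 e3] g(1)[of e2 e3 e1] g(2)[of e1 e1] g(2)[of e2 e2] g(2)[of e3 e3]
    by (auto intro!: fixed simp: t Ksimps)
  moreover have "h (K e2 e3) e1 = h (K e1 e2) e3" "h (K e3 e1) e2 = h (K e1 e2) e3"
    using assms(2)[of e2 e1] assms(2)[of e3 e1] assms(3)[of e2 e3 e1] assms(3)[of e1 e3 e2] by simp_all
  ultimately show ?thesis
    using assms(6) unfolding adapted_def by (metis (no_types))
qed

section \<open>Hypersurfaces with adapted frames\<close>

text \<open>No smoothness of the adapted frames is assumed. All information about derivatives is extracted by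
  differentiating the frame-free identities \<open>tr K\<^sub>X = 0\<close>, \<open>tr (K\<^sub>X K\<^sub>Y) = 2 b\<^sup>2 h(X, Y)\<close> and
  \<open>tr (K\<^sub>X S) = 0\<close>.\<close>
locale adapted_hypersurface = convex_hypersurface +
  assumes convex_W: "convex W"
    and adapted_ex: "u \<in> W \<Longrightarrow> \<exists>e1 e2 e3 b l1 l2 l3.
      adapted (h u) (K u) (Sh u) e1 e2 e3 b l1 l2 l3 \<and> \<not> (l1 = l2 \<and> l2 = l3)"
begin

lemma adapted_frameI:
  "u \<in> W \<Longrightarrow> adapted (h u) (K u) (Sh u) e1 e2 e3 b l1 l2 l3 \<Longrightarrow> adapted_frame (h u) (K u) (Sh u) e1 e2 e3 b l1 l2 l3"
  by (intro adapted_frame.intro pos_form_h adapted_frame_axioms.intro sym_K linear_K linear_Sh)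

text \<open>The number b is determined only up to a sign that depends on the frame. This quotient
  equals 2 b^2 for every adapted frame and is visibly smooth; any nonzero vector could take the
  place of the first coordinate vector.\<close>

definition phi :: "real^3 \<Rightarrow> real" where
  "phi u = tr (\<lambda>v. K u (axis 1 1) (K u (axis 1 1) v)) / h u (axis 1 1) (axis 1 1)"

lemma adapted_traces:
  assumes u: "u \<in> W" and ad: "adapted (h u) (K u) (Sh u) e1 e2 e3 b l1 l2 l3"
  shows "tr (K u X) = 0" "tr (\<lambda>v. K u X (Sh u v)) = 0" "tr (\<lambda>v. K u X (K u Y v)) = 2 * b\<^sup>2 * h u X Y"
    and phi_eq: "phi u = 2 * b\<^sup>2"
proof -
  interpret adapted_frame "h u" "K u" "Sh u" e1 e2 e3 b l1 l2 l3 by (rule adapted_frameI[OF u ad])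
  show "tr (K u X) = 0"
    by (simp add: tr_frame linear_K[OF u] K_comp frame)
  show "tr (\<lambda>v. K u X (Sh u v)) = 0"
    by (subst tr_frame[OF linear_compose[OF linear_Sh[OF u] linear_K[OF u], unfolded o_def]]) (simp add: K_comp S_comp frame)
  have "tr (\<lambda>v. K u X (K u Y v)) = 2 * b\<^sup>2 * h u X Y" for X Y
    using h_expand[of X Y]
    by (subst tr_frame[OF linear_compose[OF linear_K[OF u] linear_K[OF u], unfolded o_def]])
       (simp add: K_comp frame algebra_simps power2_eq_square)
  then show "tr (\<lambda>v. K u X (K u Y v)) = 2 * b\<^sup>2 * h u X Y" and "phi u = 2 * b\<^sup>2"
    using pos[of "axis 1 1"] by (simp_all add: phi_def axis_eq_0_iff)
qed

lemma tr_K: "u \<in> W \<Longrightarrow> tr (K u X) = 0"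
  and tr_KS: "u \<in> W \<Longrightarrow> tr (\<lambda>v. K u X (Sh u v)) = 0"
  and tr_KK: "u \<in> W \<Longrightarrow> tr (\<lambda>v. K u X (K u Y v)) = phi u * h u X Y"
  and phi_nonneg: "u \<in> W \<Longrightarrow> phi u \<ge> 0"
proof -
  assume u: "u \<in> W"
  obtain e1 e2 e3 b l1 l2 l3 where "adapted (h u) (K u) (Sh u) e1 e2 e3 b l1 l2 l3"
    using adapted_ex[OF u] by blast
  from adapted_traces[OF u this]
  show "tr (K u X) = 0" "tr (\<lambda>v. K u X (Sh u v)) = 0" "tr (\<lambda>v. K u X (K u Y v)) = phi u * h u X Y" "phi u \<ge> 0"
    by simp_all
qed

lemma smooth_phi: "smooth_on W phi"
proof -
  have "h u (axis 1 1) (axis 1 1) \<noteq> 0" if "u \<in> W" for u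
    using convex[OF that, of "axis 1 1"] by (simp add: axis_eq_0_iff)
  then show ?thesis
    unfolding phi_def
    by (intro smooth_on_divide open_W smooth_on_tr smooth_K_apply smooth_K smooth_on_const smooth_h) auto
qed

text \<open>Coordinate and covariant derivatives of an endomorphism differ by a commutator with
  \<open>LC\<close>, whose trace vanishes. The next two lemmas use the same cancellation for
  products.\<close>

lemma tr_dK:
  assumes u: "u \<in> W"
  shows "tr (dK u V X) = 0"
proof -
  have "DD (\<lambda>w. tr (K w X)) u V = DD (\<lambda>w. 0) u V"
    by (rule DD_eq_on[OF open_W u tr_K smooth_on_tr[OF open_W smooth_K]])
  moreover have "DD (\<lambda>w. tr (K w X)) u V = tr (\<lambda>v. DD (\<lambda>w. K w X v) u V)"
    by (rule DD_tr) (rule smooth_on_differentiable[OF smooth_K u])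
  ultimately have "tr (\<lambda>v. DD (\<lambda>w. K w X v) u V) = 0" by simp
  moreover have "tr (\<lambda>v. LC u V (K u X v)) = tr (\<lambda>v. K u X (LC u V v))"
    by (rule tr_comm[OF linear_LC[OF u] linear_K[OF u]])
  moreover have "dK u V X = (\<lambda>v. dK u V X v)" ..
  ultimately show ?thesis
    unfolding dK_def by (simp add: tr_add tr_diff tr_K[OF u])
qed

lemma tr_dKK:
  assumes u: "u \<in> W"
  shows "tr (\<lambda>v. dK u V X (K u Y v)) + tr (\<lambda>v. K u X (dK u V Y v)) = DD phi u V * h u X Y"
proof -
  have "DD (\<lambda>w. tr (\<lambda>v. K w X (K w Y v))) u V = DD (\<lambda>w. phi w * h w X Y) u V"
    by (rule DD_eq_on[OF open_W u tr_KK smooth_on_tr[OF open_W smooth_K_apply[OF smooth_on_const smooth_K]]])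
  moreover have "DD (\<lambda>w. phi w * h w X Y) u V = phi u * DD (\<lambda>w. h w X Y) u V + DD phi u V * h u X Y"
    by (rule DD_mult[OF smooth_on_differentiable[OF smooth_phi u] smooth_on_differentiable[OF smooth_h u]])
  moreover have "DD (\<lambda>w. tr (\<lambda>v. K w X (K w Y v))) u V = tr (\<lambda>v. DD (\<lambda>w. K w X (K w Y v)) u V)"
    by (rule DD_tr[OF smooth_on_differentiable[OF smooth_K_apply[OF smooth_on_const smooth_K] u]])
  moreover have "DD (\<lambda>w. K w X (K w Y v)) u V = DD (\<lambda>w. K w X (K u Y v)) u V + K u X (DD (\<lambda>w. K w Y v) u V)" for v
    by (rule DD_apply[OF open_W linear_K smooth_K smooth_K u])
  ultimately have D: "tr (\<lambda>v. DD (\<lambda>w. K w X (K u Y v)) u V) + tr (\<lambda>v. K u X (DD (\<lambda>w. K w Y v) u V))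
     = phi u * (h u (LC u V X) Y + h u X (LC u V Y)) + DD phi u V * h u X Y"
    by (simp add: tr_add Dh_LC[OF u])
  have "tr (\<lambda>v. LC u V (K u X (K u Y v))) = tr (\<lambda>v. K u X (K u Y (LC u V v)))"
    by (rule tr_comm[OF linear_LC[OF u] linear_compose[OF linear_K[OF u] linear_K[OF u], unfolded o_def]])
  with D show ?thesis
    unfolding dK_def
    by (simp add: tr_add tr_diff tr_KK[OF u] lins[OF linear_K[OF u]] algebra_simps)
qed

lemma tr_dKS:
  assumes u: "u \<in> W"
  shows "tr (\<lambda>v. dK u V X (Sh u v)) + tr (\<lambda>v. K u X (dS u V v)) = 0"
proof -
  have "DD (\<lambda>w. tr (\<lambda>v. K w X (Sh w v))) u V = DD (\<lambda>w. 0) u V"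
    by (rule DD_eq_on[OF open_W u tr_KS smooth_on_tr[OF open_W smooth_K_apply[OF smooth_on_const smooth_Sh]]])
  moreover have "DD (\<lambda>w. tr (\<lambda>v. K w X (Sh w v))) u V = tr (\<lambda>v. DD (\<lambda>w. K w X (Sh w v)) u V)"
    by (rule DD_tr[OF smooth_on_differentiable[OF smooth_K_apply[OF smooth_on_const smooth_Sh] u]])
  moreover have "DD (\<lambda>w. K w X (Sh w v)) u V = DD (\<lambda>w. K w X (Sh u v)) u V + K u X (DD (\<lambda>w. Sh w v) u V)" for v
    by (rule DD_apply[OF open_W linear_K smooth_K smooth_Sh u])
  ultimately have D: "tr (\<lambda>v. DD (\<lambda>w. K w X (Sh u v)) u V) + tr (\<lambda>v. K u X (DD (\<lambda>w. Sh w v) u V)) = 0"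
    by (simp add: tr_add)
  have "tr (\<lambda>v. LC u V (K u X (Sh u v))) = tr (\<lambda>v. K u X (Sh u (LC u V v)))"
    by (rule tr_comm[OF linear_LC[OF u] linear_compose[OF linear_Sh[OF u] linear_K[OF u], unfolded o_def]])
  with D show ?thesis
    unfolding dK_def dS_def
    by (simp add: tr_add tr_diff tr_KS[OF u] lins[OF linear_K[OF u]] algebra_simps)
qed

text \<open>This is linear algebra at one point. For each direction w the components of
  \<open>dK\<close> form a symmetric cubic tensor. The trace identities remove most of them, the
  Codazzi equation of K gives the rest in terms of the eigenvalues, tr (K_X S) = 0 then gives the
  off-diagonal part of \<open>dS\<close>, and the Codazzi equation of S finally restricts the
  eigenvalues.\<close>

lemma structure_table:
  assumes u: "u \<in> W" and ad: "adapted (h u) (K u) (Sh u) e1 e2 e3 b l1 l2 l3" and b: "b \<noteq> 0"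
  defines "k \<equiv> \<lambda>w x y z. h u (dK u w x y) z" and "s \<equiv> \<lambda>w x y. h u (dS u w x) y"
  shows table_phi: "DD phi u V = 0"
    and table_k: "k e1 e3 e3 e1 = (l2 - l3) / 2" "k e1 e3 e3 e2 = 0" "k e1 e3 e3 e3 = 0" "k e1 e3 e1 e1 = 0"
        "k e1 e3 e1 e2 = 0" "k e1 e3 e2 e2 = 0"
      "k e2 e3 e3 e2 = (l1 - l3) / 2" "k e2 e3 e3 e1 = 0" "k e2 e3 e3 e3 = 0" "k e2 e3 e1 e1 = 0" "k e2 e3 e1 e2 = 0"
          "k e2 e3 e2 e2 = 0"
      "k e3 e3 e3 e1 = 0" "k e3 e3 e3 e2 = 0" "k e3 e3 e3 e3 = 0" "k e3 e3 e1 e1 = (l2 - l1) / 2" "k e3 e3 e1 e2 = 0"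
          "k e3 e3 e2 e2 = (l1 - l2) / 2"
    and table_s: "4 * b * s e1 e2 e3 = (l2 - l3)\<^sup>2" "4 * b * s e2 e1 e3 = (l1 - l3)\<^sup>2" "4 * b * s e3 e1 e2 = (l1 - l2)\<^sup>2"
      "s e1 e1 e3 = 0" "s e2 e2 e3 = 0" "s e3 e1 e3 = 0" "s e3 e2 e3 = 0"
    and table_rel: "(l2 - l3)\<^sup>2 - (l1 - l3)\<^sup>2 = 4 * b\<^sup>2 * (l1 - l2)" "(l3 - l1)\<^sup>2 - (l2 - l1)\<^sup>2 = 4 * b\<^sup>2 * (l2 - l3)"
      "(l1 - l2)\<^sup>2 - (l3 - l2)\<^sup>2 = 4 * b\<^sup>2 * (l3 - l1)"
proof -
  interpret adapted_frame "h u" "K u" "Sh u" e1 e2 e3 b l1 l2 l3 by (rule adapted_frameI[OF u ad])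
  have sw: "k w x y z = k w y x z" "k w x y z = k w x z y" for w x y z
    unfolding k_def using dK_sym[OF u] dK_cubic_sym[OF u] by simp_all
  \<comment> \<open>Each component is rewritten to sorted indices; the laws in \<open>sw\<close>
    would loop as rewrite rules.\<close>
  have canon: "k w e1 e2 e1 = k w e1 e1 e2" "k w e1 e3 e1 = k w e1 e1 e3" "k w e1 e3 e2 = k w e1 e2 e3"
      "k w e2 e1 e1 = k w e1 e1 e2" "k w e2 e1 e2 = k w e1 e2 e2" "k w e2 e1 e3 = k w e1 e2 e3"
      "k w e2 e2 e1 = k w e1 e2 e2" "k w e2 e3 e1 = k w e1 e2 e3" "k w e2 e3 e2 = k w e2 e2 e3"
      "k w e3 e1 e1 = k w e1 e1 e3" "k w e3 e1 e2 = k w e1 e2 e3" "k w e3 e1 e3 = k w e1 e3 e3"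
      "k w e3 e2 e1 = k w e1 e2 e3" "k w e3 e2 e2 = k w e2 e2 e3" "k w e3 e2 e3 = k w e2 e3 e3"
      "k w e3 e3 e1 = k w e1 e3 e3" "k w e3 e3 e2 = k w e2 e3 e3" for w
    by (metis sw)+
  have ss: "s w x y = s w y x" for w x y
    unfolding s_def using dS_self_adjoint[OF u] sym by simp
  have scanon: "s w e2 e1 = s w e1 e2" "s w e3 e1 = s w e1 e3" "s w e3 e2 = s w e2 e3" for w
    by (rule ss)+
  note kl = lins[OF linear_dK[OF u]]
  have T1: "k w x e1 e1 + k w x e2 e2 + k w x e3 e3 = 0" for w x
    using tr_dK[OF u, of w x] by (simp add: tr_frame[OF linear_dK[OF u]] k_def)
  have hK: "h u (K u x z) y = h u z (K u x y)" for x y z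
    using cubic_sym[OF u, of x z y] sym by simp
  have T2: "k w x (K u y e1) e1 + k w x (K u y e2) e2 + k w x (K u y e3) e3
      + (k w y e1 (K u x e1) + k w y e2 (K u x e2) + k w y e3 (K u x e3)) = DD phi u w * h u x y" for w x y
    using tr_dKK[OF u, of w x y]
    unfolding tr_frame[OF linear_compose[OF linear_K[OF u] linear_dK[OF u], unfolded o_def]]
      tr_frame[OF linear_compose[OF linear_dK[OF u] linear_K[OF u], unfolded o_def]] k_def hK[of x] .
  have T3: "k w x (Sh u e1) e1 + k w x (Sh u e2) e2 + k w x (Sh u e3) e3
      + (s w e1 (K u x e1) + s w e2 (K u x e2) + s w e3 (K u x e3)) = 0" for w x
    using tr_dKS[OF u, of w x]
    unfolding tr_frame[OF linear_compose[OF linear_Sh[OF u] linear_dK[OF u], unfolded o_def]]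
      tr_frame[OF linear_compose[OF linear_dS[OF u] linear_K[OF u], unfolded o_def]] k_def s_def hK[of x] .
  have kS: "k w x (c *\<^sub>R y) z = c * k w x y z" "k w x y (c *\<^sub>R z) = c * k w x y z" "k w x 0 z = 0" "k w x y 0 = 0"
    "s w x (c *\<^sub>R y) = c * s w x y" "s w x 0 = 0" for w x y z c
    by (simp_all add: k_def s_def kl simps)
  \<comment> \<open>For two different axes, T2 says that the two trace terms belonging to the third
    axis and mixed with these axes add up to zero; T1 for the third axis then leaves only its pure
    component.\<close>
  have diag: "k w e1 e1 e1 = 0" "k w e2 e2 e2 = 0" "k w e3 e3 e3 = 0" for w
    using T1[of w e1] T1[of w e2] T1[of w e3] T2[of w e1 e2] T2[of w e2 e3] T2[of w e3 e1] b
    by (simp_all add: KS kS canon frame) (simp_all add: distrib_left[symmetric] mult.assoc[symmetric] del: distrib_left)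
  have cod: "2 * (k x y z v - k y x z v) = h u y z * h u (Sh u x) v + h u y v * h u (Sh u x) z
      - h u x z * h u (Sh u y) v - h u x v * h u (Sh u y) z" for x y z v
    unfolding k_def by (rule codazzi_dK[OF u])
  have t: "k w e1 e3 e3 = - k w e1 e2 e2" "k w e1 e1 e2 = - k w e2 e3 e3" "k w e2 e2 e3 = - k w e1 e1 e3" for w
    using T1[of w e1] T1[of w e2] T1[of w e3] by (simp_all add: canon diag)
  have c12_11: "k e1 e1 e1 e2 = 0"
    using cod[of e1 e2 e1 e1] by (simp add: KS simps frame canon diag)
  have c31_11: "k e1 e1 e1 e3 = 0"
    using cod[of e3 e1 e1 e1] by (simp add: KS simps frame canon diag)
  have c12_22: "k e2 e1 e2 e2 = 0"
    using cod[of e1 e2 e2 e2] by (simp add: KS simps frame canon diag)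
  have c23_22: "k e2 e2 e2 e3 = 0"
    using cod[of e2 e3 e2 e2] by (simp add: KS simps frame canon diag)
  have c31_33: "k e3 e1 e3 e3 = 0"
    using cod[of e3 e1 e3 e3] by (simp add: KS simps frame canon diag)
  have c23_33: "k e3 e2 e3 e3 = 0"
    using cod[of e2 e3 e3 e3] by (simp add: KS simps frame canon diag)
  have c12_13: "k e1 e1 e2 e3 - k e2 e1 e1 e3 = 0"
    using cod[of e1 e2 e1 e3] by (simp add: KS simps frame canon diag)
  have c23_12: "k e2 e1 e2 e3 - k e3 e1 e2 e2 = 0"
    using cod[of e2 e3 e1 e2] by (simp add: KS simps frame canon diag)
  have c31_23: "k e3 e1 e2 e3 - k e1 e2 e3 e3 = 0"
    using cod[of e3 e1 e2 e3] by (simp add: KS simps frame canon diag)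
  have c12_12: "2 * (k e1 e1 e2 e2 - k e2 e1 e1 e2) = l1 - l2"
    using cod[of e1 e2 e1 e2] by (simp add: KS simps frame canon diag)
  have c23_23: "2 * (k e2 e2 e3 e3 - k e3 e2 e2 e3) = l2 - l3"
    using cod[of e2 e3 e2 e3] by (simp add: KS simps frame canon diag)
  have c31_13: "2 * (k e3 e1 e1 e3 - k e1 e1 e3 e3) = l3 - l1"
    using cod[of e3 e1 e1 e3] by (simp add: KS simps frame canon diag)
  have z1: "k e1 e1 e1 e2 = 0" "k e1 e1 e1 e3 = 0" "k e1 e2 e3 e3 = 0" "k e1 e2 e2 e3 = 0"
    and z2: "k e2 e1 e2 e2 = 0" "k e2 e2 e2 e3 = 0" "k e2 e1 e3 e3 = 0" "k e2 e1 e1 e3 = 0"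
    and z3: "k e3 e1 e3 e3 = 0" "k e3 e2 e3 e3 = 0" "k e3 e1 e2 e2 = 0" "k e3 e1 e1 e2 = 0"
    using c12_11 c31_11 c12_22 c23_22 c31_33 c23_33 t[of e1] t[of e2] t[of e3] by simp_all
  have z123: "k e1 e1 e2 e3 = 0" "k e2 e1 e2 e3 = 0" "k e3 e1 e2 e3 = 0"
    using c12_13 c23_12 c31_23 z1 z2 z3 by simp_all
  have a: "k e1 e1 e2 e2 = (l3 - l2) / 2" "k e2 e2 e3 e3 = (l1 - l3) / 2" "k e3 e1 e1 e3 = (l2 - l1) / 2"
    using c12_12 c23_23 c31_13 t(1)[of e1] t(2)[of e2] t(3)[of e3] by (simp_all add: field_simps)
  have a': "k e1 e1 e3 e3 = (l2 - l3) / 2" "k e2 e1 e1 e2 = (l3 - l1) / 2" "k e3 e2 e2 e3 = (l1 - l2) / 2"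
    using a t(1)[of e1] t(2)[of e2] t(3)[of e3] by (simp_all add: field_simps)
  \<comment> \<open>For x = y = \<open>e1\<close> the identity T2 reads 4 b k(w; e1, e2, e3) = D
    phi(w), and this component has just been shown to vanish.\<close>
  have "DD phi u e1 = 0" "DD phi u e2 = 0" "DD phi u e3 = 0"
    using T2[of e1 e1 e1] T2[of e2 e1 e1] T2[of e3 e1 e1] by (simp_all add: KS kS canon frame z123)
  then show "DD phi u V = 0"
    using linear_expand[OF smooth_on_linear_DD[OF smooth_phi u], of V] by simp
  show "k e1 e3 e3 e1 = (l2 - l3) / 2" "k e1 e3 e3 e2 = 0" "k e1 e3 e3 e3 = 0" "k e1 e3 e1 e1 = 0" "k e1 e3 e1 e2 = 0"
      "k e1 e3 e2 e2 = 0"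
      "k e2 e3 e3 e2 = (l1 - l3) / 2" "k e2 e3 e3 e1 = 0" "k e2 e3 e3 e3 = 0" "k e2 e3 e1 e1 = 0" "k e2 e3 e1 e2 = 0"
          "k e2 e3 e2 e2 = 0"
      "k e3 e3 e3 e1 = 0" "k e3 e3 e3 e2 = 0" "k e3 e3 e3 e3 = 0" "k e3 e3 e1 e1 = (l2 - l1) / 2" "k e3 e3 e1 e2 = 0"
          "k e3 e3 e2 e2 = (l1 - l2) / 2"
    by (simp_all add: canon diag z1 z2 z3 z123 a a')
  \<comment> \<open>T3 for one axis isolates the off-diagonal entry of \<open>dS\<close> between the
    two others, since K exchanges those two up to the factor b.\<close>
  have r: "2 * b * s w e2 e3 = - (k w e1 e2 e2 * l2 + k w e1 e3 e3 * l3)"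
     "2 * b * s w e1 e3 = - (k w e1 e1 e2 * l1 + k w e2 e3 e3 * l3)"
     "2 * b * s w e1 e2 = - (k w e1 e1 e3 * l1 + k w e2 e2 e3 * l2)" for w
    using T3[of w e1] T3[of w e2] T3[of w e3] by (simp_all add: KS kS canon scanon diag algebra_simps)
  show sq: "4 * b * s e1 e2 e3 = (l2 - l3)\<^sup>2" "4 * b * s e2 e1 e3 = (l1 - l3)\<^sup>2" "4 * b * s e3 e1 e2 = (l1 - l2)\<^sup>2"
    using r(1)[of e1] r(2)[of e2] r(3)[of e3] by (simp_all add: a a' power2_eq_square field_simps)
  show "s e1 e1 e3 = 0" "s e2 e2 e3 = 0" "s e3 e1 e3 = 0" "s e3 e2 e3 = 0"
    using r(2)[of e1] r(1)[of e2] r(2)[of e3] r(1)[of e3] b by (simp_all add: z1 z2 z3)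
  \<comment> \<open>The three values in \<open>sq\<close> have pairwise differences prescribed by
    the Codazzi equation of S. Multiplied by 4 b, this becomes the quadratic system for the
    eigenvalues.\<close>
  have codS: "s x y z - s y x z = h u (K u y (Sh u x) - K u x (Sh u y)) z" for x y z
    using arg_cong[OF codazzi_dS[OF u, of x y], of "\<lambda>v. h u v z"] by (simp add: s_def simps)
  have "s e1 e2 e3 - s e2 e1 e3 = b * (l1 - l2)" "s e2 e1 e3 - s e3 e1 e2 = b * (l2 - l3)"
      "s e3 e1 e2 - s e1 e2 e3 = b * (l3 - l1)"
    using codS[of e1 e2 e3] codS[of e2 e3 e1] codS[of e3 e1 e2]
    by (simp_all add: KS simps frame linear_cmul[OF linear_K[OF u]] scanon algebra_simps)
  from this[THEN arg_cong, of "\<lambda>x. 4 * b * x"]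
  show "(l2 - l3)\<^sup>2 - (l1 - l3)\<^sup>2 = 4 * b\<^sup>2 * (l1 - l2)" "(l3 - l1)\<^sup>2 - (l2 - l1)\<^sup>2 = 4 * b\<^sup>2 * (l2 - l3)"
      "(l1 - l2)\<^sup>2 - (l3 - l2)\<^sup>2 = 4 * b\<^sup>2 * (l3 - l1)"
    unfolding right_diff_distrib sq by (simp_all add: power2_eq_square algebra_simps)
qed

end

section \<open>Constancy of b and the eigenvalues of S\<close>

lemma DD_zero_constant:
  fixes f :: "'a::real_normed_vector \<Rightarrow> 'b::real_normed_vector"
  assumes "convex W" "\<And>w. w \<in> W \<Longrightarrow> f differentiable (at w)" "\<And>w X. w \<in> W \<Longrightarrow> DD f w X = 0" "u \<in> W" "v \<in> W"
  shows "f u = f v"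
proof (rule has_derivative_zero_unique[OF assms(1) _ assms(4,5)])
  fix w assume w: "w \<in> W"
  have "(f has_derivative DD f w) (at w)" by (rule DD_has_derivative[OF assms(2)[OF w]])
  moreover have "DD f w = (\<lambda>X. 0)" using assms(3)[OF w] by auto
  ultimately show "(f has_derivative (\<lambda>X. 0)) (at w within W)" by (simp add: has_derivative_at_withinI)
qed

lemma adapted_rotate:
  assumes "pos_form h" "adapted h K S e1 e2 e3 b l1 l2 l3"
  shows "adapted h K S e2 e3 e1 b l2 l3 l1"
  using assms(2) pos_form.sym[OF assms(1), of e2 e1] pos_form.sym[OF assms(1), of e3 e1]
  unfolding adapted_def orthonormal3_def by simp

text \<open>Changing signs of axes multiplies b by the product of the signs. This is used to make b
  positive, and later to match the third axis with a given smooth direction.\<close>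

lemma adapted_flip:
  assumes "pos_form h" "\<And>X. linear (K X)" "\<And>Y. linear (\<lambda>X. K X Y)" "linear S" "adapted h K S e1 e2 e3 b l1 l2 l3"
    and "c1 * c1 = 1" "c2 * c2 = 1" "c3 * c3 = 1"
  shows "adapted h K S (c1 *\<^sub>R e1) (c2 *\<^sub>R e2) (c3 *\<^sub>R e3) (c1 * c2 * c3 * b) l1 l2 l3"
proof -
  have c: "c1 * (c1 * x) = x" "c2 * (c2 * x) = x" "c3 * (c3 * x) = x" for x
    using assms(6-8) by (simp_all add: mult.assoc[symmetric])
  have m: "c1 * c2 * c3 * b * c3 = c2 * (c1 * b)" "c1 * c2 * c3 * b * c1 = c3 * (c2 * b)"
      "c1 * c2 * c3 * b * c2 = c1 * (c3 * b)"
    using assms(6-8) by algebra+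
  show ?thesis
    using assms(5) unfolding adapted_def orthonormal3_def
    by (simp add: pos_form.simps[OF assms(1)] linear_cmul[OF assms(2)] linear_cmul[OF assms(3)] linear_cmul[OF assms(4)]
        c m mult.commute[of c1 l1] mult.commute[of c2 l2] mult.commute[of c3 l3])
qed

text \<open>For the cyclic differences x, y, z with sum zero each relation factors, as in z (x - y +
  4 b^2) = 0. If none of them vanished, the sum of the three second factors would give 12 b^2 = 0.
  So two eigenvalues coincide, and a remaining factor gives their distance to the third.\<close>

lemma eigenvalue_relations:
  fixes l1 l2 l3 b :: real
  assumes "(l2 - l3)\<^sup>2 - (l1 - l3)\<^sup>2 = 4 * b\<^sup>2 * (l1 - l2)" "(l3 - l1)\<^sup>2 - (l2 - l1)\<^sup>2 = 4 * b\<^sup>2 * (l2 - l3)"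
      "(l1 - l2)\<^sup>2 - (l3 - l2)\<^sup>2 = 4 * b\<^sup>2 * (l3 - l1)" and b: "b \<noteq> 0" and ne: "\<not> (l1 = l2 \<and> l2 = l3)"
  shows "l1 = l2 \<and> l3 = l1 - 4 * b\<^sup>2 \<or> l2 = l3 \<and> l1 = l2 - 4 * b\<^sup>2 \<or> l3 = l1 \<and> l2 = l3 - 4 * b\<^sup>2"
proof -
  define x y z where "x = l2 - l3" and "y = l3 - l1" and "z = l1 - l2"
  have s: "x + y + z = 0" by (simp add: x_def y_def z_def)
  have 1: "z * (x - y + 4 * b\<^sup>2) = 0" "x * (y - z + 4 * b\<^sup>2) = 0" "y * (z - x + 4 * b\<^sup>2) = 0"
    using assms(1-3) unfolding x_def y_def z_def by (simp_all add: power2_eq_square algebra_simps)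
  have "\<not> (x \<noteq> 0 \<and> y \<noteq> 0 \<and> z \<noteq> 0)"
  proof
    assume "x \<noteq> 0 \<and> y \<noteq> 0 \<and> z \<noteq> 0"
    then have "x - y + 4 * b\<^sup>2 = 0" "y - z + 4 * b\<^sup>2 = 0" "z - x + 4 * b\<^sup>2 = 0" using 1 by simp_all
    then have "12 * b\<^sup>2 = 0" by linarith
    then show False using b by simp
  qed
  moreover have "x = 4 * b\<^sup>2" if "z = 0" using 1(2) that s ne by (auto simp: x_def y_def z_def)
  moreover have "y = 4 * b\<^sup>2" if "x = 0" using 1(3) that s ne by (auto simp: x_def y_def z_def)
  moreover have "z = 4 * b\<^sup>2" if "y = 0" using 1(1) that s ne by (auto simp: x_def y_def z_def)
  ultimately show ?thesis using s unfolding x_def y_def z_def by auto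
qed

context adapted_hypersurface
begin

text \<open>Where \<open>phi\<close> is zero it has a minimum, so its derivative vanishes there as
  well as where the table applies. The value zero is impossible: K and \<open>dK\<close> would
  vanish, and the Codazzi equation of K would make all eigenvalues of S equal.\<close>

lemma phi_constant:
  assumes u0: "u0 \<in> W"
  obtains b where "b > 0" "\<And>u. u \<in> W \<Longrightarrow> phi u = 2 * b\<^sup>2"
proof -
  have "DD phi u V = 0" if u: "u \<in> W" for u V
  proof (cases "phi u = 0")
    case True
    have "DD phi u = (\<lambda>v. 0)"
      using phi_nonneg True
      by (intro differential_zero_maxmin[OF u open_W smooth_on_has_derivative[OF smooth_phi u]]) auto
    then show ?thesis by simp
  next
    case False
    obtain e1 e2 e3 b l1 l2 l3 where ad: "adapted (h u) (K u) (Sh u) e1 e2 e3 b l1 l2 l3"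
      using adapted_ex[OF u] by blast
    have "b \<noteq> 0" using phi_eq[OF u ad] False by auto
    then show ?thesis by (rule table_phi[OF u ad])
  qed
  then have const: "phi u = phi u0" if "u \<in> W" for u
    using DD_zero_constant[OF convex_W, of phi u u0] smooth_on_differentiable[OF smooth_phi] u0 that by blast
  have "phi u0 \<noteq> 0"
  proof
    assume z: "phi u0 = 0"
    have K0: "K u X Y = 0" if u: "u \<in> W" for u X Y
    proof -
      obtain e1 e2 e3 b l1 l2 l3 where ad: "adapted (h u) (K u) (Sh u) e1 e2 e3 b l1 l2 l3"
        using adapted_ex[OF u] by blast
      interpret adapted_frame "h u" "K u" "Sh u" e1 e2 e3 b l1 l2 l3 by (rule adapted_frameI[OF u ad])
      have "b = 0" using phi_eq[OF u ad] const[OF u] z by simp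
      then show ?thesis by (intro eq_frameI) (simp_all add: K_comp simps)
    qed
    have dK0: "dK u0 V X Y = 0" for V X Y
    proof -
      have "DD (\<lambda>w. K w X Y) u0 V = DD (\<lambda>w. 0 :: real^3) u0 V"
        by (rule DD_eq_on[OF open_W u0 K0 smooth_K])
      then show ?thesis by (simp add: dK_def K0[OF u0] linear_0[OF linear_LC[OF u0]])
    qed
    obtain e1 e2 e3 b l1 l2 l3 where ad: "adapted (h u0) (K u0) (Sh u0) e1 e2 e3 b l1 l2 l3" "\<not> (l1 = l2 \<and> l2 = l3)"
      using adapted_ex[OF u0] by blast
    interpret adapted_frame "h u0" "K u0" "Sh u0" e1 e2 e3 b l1 l2 l3 by (rule adapted_frameI[OF u0 ad(1)])
    show False
      using codazzi_dK[OF u0, of e1 e2 e1 e2] codazzi_dK[OF u0, of e2 e3 e2 e3] ad(2)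
      by (simp add: dK0 simps KS frame)
  qed
  then have pos: "phi u0 > 0" using phi_nonneg[OF u0] by simp
  show ?thesis
  proof (rule that[of "sqrt (phi u0 / 2)"])
    show "phi u = 2 * (sqrt (phi u0 / 2))\<^sup>2" if "u \<in> W" for u using const[OF that] pos by simp
  qed (use pos in simp)
qed

lemma normal_form:
  assumes u: "u \<in> W" and b: "b > 0" "phi u = 2 * b\<^sup>2"
  obtains e1 e2 e3 l where "adapted (h u) (K u) (Sh u) e1 e2 e3 b l l (l - 4 * b\<^sup>2)"
proof -
  obtain e1 e2 e3 b' l1 l2 l3 where ad': "adapted (h u) (K u) (Sh u) e1 e2 e3 b' l1 l2 l3" and ne: "\<not> (l1 = l2 \<and> l2 = l3)"
    using adapted_ex[OF u] by blast
  have "b'\<^sup>2 = b\<^sup>2" using phi_eq[OF u ad'] b by simp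
  then have "b' = b \<or> b' = - b" by (simp add: power2_eq_iff)
  then obtain c :: real where c: "c * c = 1" "c * b' = b" by (metis minus_mult_minus mult_1 mult_minus_left minus_minus)
  have ad: "adapted (h u) (K u) (Sh u) (c *\<^sub>R e1) (c *\<^sub>R e2) (c *\<^sub>R e3) b l1 l2 l3"
    using adapted_flip[OF pos_form_h[OF u] linear_K[OF u] linear_K'[OF u] linear_Sh[OF u] ad' c(1) c(1) c(1)] c by simp
  have "b \<noteq> 0" using b by simp
  note rot = adapted_rotate[OF pos_form_h[OF u]]
  from eigenvalue_relations[OF table_rel[OF u ad \<open>b \<noteq> 0\<close>] \<open>b \<noteq> 0\<close> ne] show ?thesis
  proof (elim disjE conjE)
    assume "l1 = l2" "l3 = l1 - 4 * b\<^sup>2"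
    then show ?thesis using that ad by simp
  next
    assume "l2 = l3" "l1 = l2 - 4 * b\<^sup>2"
    then show ?thesis using that rot[OF ad] by simp
  next
    assume "l3 = l1" "l2 = l3 - 4 * b\<^sup>2"
    then show ?thesis using that rot[OF rot[OF ad]] by simp
  qed
qed

end

section \<open>A smooth field of simple eigenvectors\<close>

lemma convex_hypersurface_subset:
  assumes "convex_hypersurface W f \<eta>" "open W'" "W' \<subseteq> W"
  shows "convex_hypersurface W' f \<eta>"
proof -
  interpret convex_hypersurface W f \<eta> by fact
  show ?thesis
  proof (rule convex_hypersurface.intro)
    show "open W'" by fact
    show "smooth_on W' f" "smooth_on W' \<eta>"
      by (rule smooth_on_subset[OF smooth_f assms(3)], rule smooth_on_subset[OF smooth_eta assms(3)])
    fix u assume "u \<in> W'"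
    then have u: "u \<in> W" using assms(3) by blast
    show "inj (DD f u)" "\<eta> u \<notin> range (DD f u)" "DD \<eta> u X \<in> range (DD f u)" "X \<noteq> 0 \<Longrightarrow> 0 < h u X X" for X
      by (rule inj_df[OF u], rule transversal[OF u], rule tangential[OF u], rule convex[OF u])
  qed
qed

text \<open>\<open>n\<close> is a smooth unit eigenvector field for the simple eigenvalue of \<open>S\<close>.\<close>
locale special_hypersurface = adapted_hypersurface +
  fixes n :: "real^3 \<Rightarrow> real^3" and b :: real and lam :: "real^3 \<Rightarrow> real"
  assumes b_pos: "b > 0" and smooth_n: "smooth_on W n" and smooth_lam: "smooth_on W lam"
    and special: "u \<in> W \<Longrightarrow> \<exists>e1 e2. adapted (h u) (K u) (Sh u) e1 e2 (n u) b (lam u) (lam u) (lam u - 4 * b\<^sup>2)"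

text \<open>By the normal form S has trace 3 lam - 4 b^2, so lam is smooth, and (lam - S) / (4 b^2)
  is the orthogonal projection Q onto the simple eigenline. Applied to a fixed vector that is an
  eigenvector at the centre, Q stays nonzero nearby and can be normalised.\<close>

lemma (in adapted_hypersurface) special_ball:
  assumes u0: "u0 \<in> W"
  obtains r n b lam where "r > 0" "ball u0 r \<subseteq> W" "special_hypersurface (ball u0 r) f \<eta> n b lam"
proof -
  obtain b where b: "b > 0" "\<And>u. u \<in> W \<Longrightarrow> phi u = 2 * b\<^sup>2" by (rule phi_constant[OF u0]) blast
  define lam where "lam u = (tr (Sh u) + 4 * b\<^sup>2) / 3" for u
  define Q where "Q u v = (1 / (4 * b\<^sup>2)) *\<^sub>R (lam u *\<^sub>R v - Sh u v)" for u v
  have smooth_lam: "smooth_on W lam"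
    unfolding lam_def by (intro smooth_on_divide smooth_on_add open_W smooth_on_tr smooth_Sh smooth_on_const) simp
  have smooth_Q: "smooth_on W (\<lambda>u. Q u v)" for v
    unfolding Q_def by (intro smooth_on_scaleR smooth_on_diff open_W smooth_Sh smooth_on_const smooth_lam)
  have form: "\<exists>e1 e2 e3. adapted (h u) (K u) (Sh u) e1 e2 e3 b (lam u) (lam u) (lam u - 4 * b\<^sup>2) \<and> (\<forall>v. Q u v = h u v e3
      *\<^sub>R e3)"
    if u: "u \<in> W" for u
  proof -
    obtain e1 e2 e3 l where ad: "adapted (h u) (K u) (Sh u) e1 e2 e3 b l l (l - 4 * b\<^sup>2)"
      using normal_form[OF u b(1) b(2)[OF u]] by blast
    interpret adapted_frame "h u" "K u" "Sh u" e1 e2 e3 b l l "l - 4 * b\<^sup>2" by (rule adapted_frameI[OF u ad])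
    have l: "lam u = l" by (simp add: lam_def tr_frame[OF linear_Sh[OF u]] KS simps frame)
    have "Q u v = h u v e3 *\<^sub>R e3" for v
      using b(1) by (intro eq_frameI) (simp_all add: Q_def l simps frame S_comp algebra_simps)
    then show ?thesis using ad l by blast
  qed
  obtain a1 a2 a3 where a: "adapted (h u0) (K u0) (Sh u0) a1 a2 a3 b (lam u0) (lam u0) (lam u0 - 4 * b\<^sup>2)"
     "\<And>v. Q u0 v = h u0 v a3 *\<^sub>R a3" using form[OF u0] by blast
  interpret u0: adapted_frame "h u0" "K u0" "Sh u0" a1 a2 a3 b "lam u0" "lam u0" "lam u0 - 4 * b\<^sup>2"
    by (rule adapted_frameI[OF u0 a(1)])
  define q where "q u = h u (Q u a3) a3" for u
  have smooth_q: "smooth_on W q"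
    unfolding q_def by (intro smooth_h_apply smooth_Q smooth_on_const)
  have "q u0 = 1" by (simp add: q_def a(2) u0.simps u0.frame)
  then have "u0 \<in> W \<inter> q -` {0<..}" using u0 by simp
  moreover have "open (W \<inter> q -` {0<..})"
    by (rule continuous_open_preimage[OF smooth_on_continuous_on[OF smooth_q] open_W]) simp
  ultimately obtain r where r: "r > 0" "ball u0 r \<subseteq> W \<inter> q -` {0<..}" by (metis openE)
  define n where "n u = (1 / sqrt (q u)) *\<^sub>R Q u a3" for u
  have sub: "ball u0 r \<subseteq> W" using r by blast
  have adB: "\<exists>e1 e2. adapted (h u) (K u) (Sh u) e1 e2 (n u) b (lam u) (lam u) (lam u - 4 * b\<^sup>2)" if uB: "u \<in> ball u0 r" for u
  proof -
    have u: "u \<in> W" and qpos: "q u > 0" using uB r by auto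
    obtain e1 e2 e3 where e: "adapted (h u) (K u) (Sh u) e1 e2 e3 b (lam u) (lam u) (lam u - 4 * b\<^sup>2)"
       "\<And>v. Q u v = h u v e3 *\<^sub>R e3" using form[OF u] by blast
    interpret pos_form "h u" by (rule pos_form_h[OF u])
    define t where "t = h u a3 e3"
    have q: "q u = t * t" by (simp add: q_def e(2) simps sym[of e3 a3] t_def)
    then have "sqrt (q u) = \<bar>t\<bar>" "t \<noteq> 0" using qpos by auto
    \<comment> \<open>The sign of t need not agree with the arbitrary choice of e3; flipping e1
      together with e3 keeps b.\<close>
    then have n: "n u = sgn t *\<^sub>R e3" by (simp add: n_def e(2) t_def[symmetric] sgn_if abs_if)
    have "sgn t * sgn t = 1" using \<open>t \<noteq> 0\<close> by (simp add: sgn_if)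
    from adapted_flip[OF pos_form_h[OF u] linear_K[OF u] linear_K'[OF u] linear_Sh[OF u] e(1) this _ this, of 1]
    have "adapted (h u) (K u) (Sh u) (sgn t *\<^sub>R e1) (1 *\<^sub>R e2) (n u) b (lam u) (lam u) (lam u - 4 * b\<^sup>2)"
      using \<open>sgn t * sgn t = 1\<close> by (simp add: n)
    then show ?thesis by blast
  qed
  have qpos: "q u > 0" if "u \<in> ball u0 r" for u using r that by auto
  have "special_hypersurface (ball u0 r) f \<eta> n b lam"
  proof (rule special_hypersurface.intro)
    show "adapted_hypersurface (ball u0 r) f \<eta>"
    proof (rule adapted_hypersurface.intro[OF _ adapted_hypersurface_axioms.intro])
      show "convex_hypersurface (ball u0 r) f \<eta>"
        by (rule convex_hypersurface_subset[OF convex_hypersurface_axioms open_ball sub])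
      show "\<exists>e1 e2 e3 b l1 l2 l3. adapted (h u) (K u) (Sh u) e1 e2 e3 b l1 l2 l3 \<and> \<not> (l1 = l2 \<and> l2 = l3)" if
          "u \<in> ball u0 r" for u
        by (rule adapted_ex[OF subsetD[OF sub that]])
    qed (rule convex_ball)
    show "special_hypersurface_axioms (ball u0 r) f \<eta> n b lam"
    proof (rule special_hypersurface_axioms.intro)
      have "smooth_on (ball u0 r) (\<lambda>u. 1 / sqrt (q u))"
      proof (rule smooth_on_divide[OF open_ball smooth_on_const])
        show "smooth_on (ball u0 r) (\<lambda>u. sqrt (q u))"
          by (rule smooth_on_sqrt[OF open_ball smooth_on_subset[OF smooth_q sub] qpos])
        show "sqrt (q u) \<noteq> 0" if "u \<in> ball u0 r" for u using qpos[OF that] by simp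
      qed
      then show "smooth_on (ball u0 r) n"
        unfolding n_def by (rule smooth_on_scaleR[OF open_ball _ smooth_on_subset[OF smooth_Q sub]])
    qed (rule b(1), rule smooth_on_subset[OF smooth_lam sub], rule adB)
  qed
  then show ?thesis by (rule that[OF r(1) sub])
qed

section \<open>Integration\<close>

text \<open>Gronwall along the segment from \<open>u0\<close> to \<open>u\<close>.\<close>
lemma linear_system_unique:
  fixes g :: "'n::finite \<Rightarrow> 'a::real_normed_vector \<Rightarrow> real" and a :: "'n \<Rightarrow> 'n \<Rightarrow> 'a \<Rightarrow> 'a \<Rightarrow> real"
  assumes W: "convex W" "u0 \<in> W" "u \<in> W" and init: "\<And>i. g i u0 = 0"
    and diff: "\<And>i w. w \<in> W \<Longrightarrow> g i differentiable (at w)"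
    and sys: "\<And>i w V. w \<in> W \<Longrightarrow> DD (g i) w V = (\<Sum>j\<in>UNIV. a i j w V * g j w)"
    and cont: "\<And>i j V. continuous_on W (\<lambda>w. a i j w V)"
  shows "g i u = 0"
proof -
  define V where "V = u - u0"
  define \<gamma> where "\<gamma> t = u0 + t *\<^sub>R V" for t :: real
  have \<gamma>W: "\<gamma> t \<in> W" if "0 \<le> t" "t \<le> 1" for t
  proof -
    have "\<gamma> t = (1 - t) *\<^sub>R u0 + t *\<^sub>R u" by (simp add: \<gamma>_def V_def algebra_simps)
    then show ?thesis using convexD[OF W(1,2,3), of "1 - t" t] that by simp
  qed
  define A where "A w = (\<Sum>i\<in>UNIV. \<Sum>j\<in>UNIV. \<bar>a i j w V\<bar>)" for w
  have "continuous_on {0..1} \<gamma>" unfolding \<gamma>_def by (intro continuous_intros)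
  then have cp: "compact (\<gamma> ` {0..1})" by (rule compact_continuous_image) simp
  have "continuous_on (\<gamma> ` {0..1}) A"
    unfolding A_def using \<gamma>W by (intro continuous_intros continuous_on_subset[OF cont]) auto
  from compact_imp_bounded[OF compact_continuous_image[OF this cp]] have "bounded (A ` (\<gamma> ` {0..1}))" .
  then obtain C where C': "\<forall>x\<in>A ` (\<gamma> ` {0..1}). norm x \<le> C"
    unfolding bounded_iff by blast
  have C: "\<bar>A (\<gamma> t)\<bar> \<le> C" if "0 \<le> t" "t \<le> 1" for t
    using C' that by auto
  define q where "q t = (\<Sum>i\<in>UNIV. (g i (\<gamma> t))\<^sup>2)" for t
  define q' where "q' t = (\<Sum>i\<in>UNIV. 2 * g i (\<gamma> t) * (\<Sum>j\<in>UNIV. a i j (\<gamma> t) V * g j (\<gamma> t)))" for t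
  have dq: "(q has_real_derivative q' t) (at t)" if t: "0 \<le> t" "t \<le> 1" for t
  proof -
    have 1: "((\<lambda>t. g i (\<gamma> t)) has_real_derivative (\<Sum>j\<in>UNIV. a i j (\<gamma> t) V * g j (\<gamma> t))) (at t)" for i
    proof -
      have "(\<gamma> has_derivative (\<lambda>k. k *\<^sub>R V)) (at t)"
        unfolding \<gamma>_def by (auto intro!: derivative_eq_intros)
      from has_derivative_compose[OF this DD_has_derivative[OF diff[OF \<gamma>W[OF t]]]]
      have "((\<lambda>t. g i (\<gamma> t)) has_derivative (\<lambda>k. DD (g i) (\<gamma> t) (k *\<^sub>R V))) (at t)" .
      moreover have "DD (g i) (\<gamma> t) (k *\<^sub>R V) = (\<Sum>j\<in>UNIV. a i j (\<gamma> t) V * g j (\<gamma> t)) * k" for k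
        using linear_cmul[OF linear_frechet_derivative[OF diff[OF \<gamma>W[OF t]]], of i k V] sys[OF \<gamma>W[OF t], of i V] by simp
      ultimately show ?thesis unfolding has_field_derivative_def by simp
    qed
    have "((\<lambda>t. \<Sum>i\<in>UNIV. (g i (\<gamma> t))\<^sup>2) has_real_derivative (\<Sum>i\<in>UNIV. 2 * g i (\<gamma> t) * (\<Sum>j\<in>UNIV. a i j (\<gamma> t) V * g j (\<gamma>
        t)))) (at t)"
      by (rule DERIV_sum) (use DERIV_power[OF 1, where n = 2] in \<open>simp add: mult_ac\<close>)
    then show ?thesis by (simp add: q_def[abs_def] q'_def)
  qed
  have bound: "q' t \<le> 2 * C * q t" if t: "0 \<le> t" "t \<le> 1" for t
  proof -
    let ?x = "\<lambda>i. g i (\<gamma> t)"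
    have qi: "(?x i)\<^sup>2 \<le> q t" for i
      unfolding q_def by (rule member_le_sum) auto
    have summand: "2 * ?x i * (a i j (\<gamma> t) V * ?x j) \<le> 2 * (\<bar>a i j (\<gamma> t) V\<bar> * q t)" for i j
    proof -
      have "2 * \<bar>?x i\<bar> * \<bar>?x j\<bar> \<le> (?x i)\<^sup>2 + (?x j)\<^sup>2"
        using sum_squares_bound[of "\<bar>?x i\<bar>" "\<bar>?x j\<bar>"] by simp
      then have "\<bar>?x i\<bar> * \<bar>?x j\<bar> \<le> q t" using qi[of i] qi[of j] by linarith
      then have "\<bar>a i j (\<gamma> t) V\<bar> * (\<bar>?x i\<bar> * \<bar>?x j\<bar>) \<le> \<bar>a i j (\<gamma> t) V\<bar> * q t"
        by (rule mult_left_mono) simp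
      moreover have "?x i * (a i j (\<gamma> t) V * ?x j) \<le> \<bar>a i j (\<gamma> t) V\<bar> * (\<bar>?x i\<bar> * \<bar>?x j\<bar>)"
        using abs_ge_self[of "?x i * (a i j (\<gamma> t) V * ?x j)"] by (simp add: abs_mult mult_ac)
      ultimately show ?thesis by linarith
    qed
    have "q' t = (\<Sum>i\<in>UNIV. \<Sum>j\<in>UNIV. 2 * ?x i * (a i j (\<gamma> t) V * ?x j))"
      by (simp add: q'_def sum_distrib_left)
    also have "\<dots> \<le> (\<Sum>i\<in>UNIV. \<Sum>j\<in>UNIV. 2 * (\<bar>a i j (\<gamma> t) V\<bar> * q t))"
      by (intro sum_mono summand)
    also have "\<dots> = 2 * (A (\<gamma> t) * q t)"
      by (simp add: A_def sum_distrib_left sum_distrib_right)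
    also have "\<dots> \<le> 2 * (C * q t)"
    proof -
      have "A (\<gamma> t) \<le> C" using C[OF t] by linarith
      moreover have "q t \<ge> 0" unfolding q_def by (intro sum_nonneg) simp
      ultimately show ?thesis by (intro mult_left_mono mult_right_mono) auto
    qed
    finally show ?thesis by simp
  qed
  \<comment> \<open>The bound on q' makes q(t) exp(-2 C t) nonincreasing. It starts at 0, so the
    nonnegative q vanishes at 1.\<close>
  have "q 1 * exp (- (2 * C) * 1) \<le> q 0 * exp (- (2 * C) * 0)"
  proof (rule DERIV_nonpos_imp_nonincreasing[of 0 1 "\<lambda>t. q t * exp (- (2 * C) * t)"])
    fix t :: real assume t: "0 \<le> t" "t \<le> 1"
    have "((\<lambda>t. q t * exp (- (2 * C) * t)) has_real_derivative (q' t * exp (- (2 * C) * t) + (exp (- (2 * C) * t) * (-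
        (2 * C))) * q t)) (at t)"
      by (intro DERIV_mult dq t) (auto intro!: derivative_eq_intros)
    moreover have "q' t * exp (- (2 * C) * t) + (exp (- (2 * C) * t) * (- (2 * C))) * q t = (q' t - 2 * C * q t) * exp
        (- (2 * C) * t)"
      by (simp add: algebra_simps)
    moreover have "\<dots> \<le> 0" using bound[OF t] by (intro mult_nonpos_nonneg) auto
    ultimately show "\<exists>y. ((\<lambda>t. q t * exp (- (2 * C) * t)) has_real_derivative y) (at t) \<and> y \<le> 0" by metis
  qed simp
  moreover have "q 0 = 0" by (simp add: q_def \<gamma>_def init)
  ultimately have "q 1 \<le> 0" by (simp add: mult_le_0_iff)
  then have "q 1 = 0" using sum_nonneg[of UNIV "\<lambda>i. (g i (\<gamma> 1))\<^sup>2"] by (simp add: q_def)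
  then have "(g i (\<gamma> 1))\<^sup>2 = 0" unfolding q_def by (subst (asm) sum_nonneg_eq_0_iff) auto
  then show ?thesis by (simp add: \<gamma>_def V_def)
qed

section \<open>The parallel eigenvector field and the two constant directions\<close>

context special_hypersurface
begin

lemma special_frame:
  assumes "u \<in> W"
  obtains e1 e2 where "adapted_frame (h u) (K u) (Sh u) e1 e2 (n u) b (lam u) (lam u) (lam u - 4 * b\<^sup>2)"
    "adapted (h u) (K u) (Sh u) e1 e2 (n u) b (lam u) (lam u) (lam u - 4 * b\<^sup>2)"
  using special[OF assms] adapted_frameI[OF assms] by blast

lemma h_n_n: "u \<in> W \<Longrightarrow> h u (n u) (n u) = 1"
proof -
  assume u: "u \<in> W"
  obtain e1 e2 where "adapted_frame (h u) (K u) (Sh u) e1 e2 (n u) b (lam u) (lam u) (lam u - 4 * b\<^sup>2)"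
    using special_frame[OF u] by blast
  then interpret adapted_frame "h u" "K u" "Sh u" e1 e2 "n u" b "lam u" "lam u" "lam u - 4 * b\<^sup>2" .
  show ?thesis by (rule frame)
qed

lemma Sh_eq: "u \<in> W \<Longrightarrow> Sh u X = lam u *\<^sub>R X - (4 * b\<^sup>2 * h u (n u) X) *\<^sub>R n u"
proof -
  assume u: "u \<in> W"
  obtain e1 e2 where "adapted_frame (h u) (K u) (Sh u) e1 e2 (n u) b (lam u) (lam u) (lam u - 4 * b\<^sup>2)"
    using special_frame[OF u] by blast
  then interpret adapted_frame "h u" "K u" "Sh u" e1 e2 "n u" b "lam u" "lam u" "lam u - 4 * b\<^sup>2" .
  show ?thesis by (rule eq_frameI) (simp_all add: S_comp simps frame sym[of "n u" X] algebra_simps)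
qed

lemma DD_th: "u \<in> W \<Longrightarrow> DD (\<lambda>w. h w (n w) X) u V = h u (DD n u V + LC u V (n u)) X + h u (n u) (LC u V X)"
  using DD_h[OF smooth_n smooth_on_const, of u X V] by simp

lemma smooth_th: "smooth_on W (\<lambda>w. h w (n w) X)"
  by (rule smooth_h_apply[OF smooth_n smooth_on_const])

lemma dS_eq:
  assumes u: "u \<in> W"
  defines "N \<equiv> \<lambda>V. DD n u V + LC u V (n u)"
  shows "dS u V X = DD lam u V *\<^sub>R X - (4 * b\<^sup>2) *\<^sub>R (h u (N V) X *\<^sub>R n u + h u (n u) X *\<^sub>R N V)"
proof -
  interpret pos_form "h u" by (rule pos_form_h[OF u])
  note sm = smooth_lam smooth_n smooth_th smooth_on_const open_W smooth_on_scaleR smooth_on_mult smooth_on_diff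
  have "DD (\<lambda>w. Sh w X) u V = DD (\<lambda>w. lam w *\<^sub>R X - (4 * b\<^sup>2 * h w (n w) X) *\<^sub>R n w) u V"
    by (rule DD_eq_on[OF open_W u Sh_eq smooth_Sh])
  also have "\<dots> = DD (\<lambda>w. lam w *\<^sub>R X) u V - DD (\<lambda>w. (4 * b\<^sup>2 * h w (n w) X) *\<^sub>R n w) u V"
    by (rule DD_diff; rule smooth_on_differentiable[OF _ u]; intro sm)
  also have "DD (\<lambda>w. lam w *\<^sub>R X) u V = DD lam u V *\<^sub>R X"
    using DD_scaleR[OF smooth_on_differentiable[OF smooth_lam u] smooth_on_differentiable[OF smooth_on_const u], of X V]
        by simp
  also have "DD (\<lambda>w. (4 * b\<^sup>2 * h w (n w) X) *\<^sub>R n w) u V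
      = (4 * b\<^sup>2 * h u (n u) X) *\<^sub>R DD n u V + DD (\<lambda>w. 4 * b\<^sup>2 * h w (n w) X) u V *\<^sub>R n u"
    by (rule DD_scaleR; rule smooth_on_differentiable[OF _ u]; intro sm)
  also have "DD (\<lambda>w. 4 * b\<^sup>2 * h w (n w) X) u V = 4 * b\<^sup>2 * DD (\<lambda>w. h w (n w) X) u V"
    by (rule DD_linear[OF smooth_on_differentiable[OF smooth_th u] bounded_linear_mult_right])
  finally have D: "DD (\<lambda>w. Sh w X) u V = DD lam u V *\<^sub>R X
      - ((4 * b\<^sup>2 * h u (n u) X) *\<^sub>R DD n u V + (4 * b\<^sup>2 * (h u (N V) X + h u (n u) (LC u V X))) *\<^sub>R n u)"
    by (simp add: DD_th[OF u] N_def)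
  show ?thesis
    unfolding dS_def D Sh_eq[OF u]
    by (simp add: lins[OF linear_LC[OF u]] simps N_def algebra_simps)
qed

lemma linear_Dn: "u \<in> W \<Longrightarrow> linear (DD n u)"
  by (rule smooth_on_linear_DD[OF smooth_n])

text \<open>In other words, n is parallel for the induced connection. The table knows the
  off-diagonal part of \<open>dS\<close>, and \<open>dS_eq\<close> expresses that part by the
  covariant derivative of n; the component along n is zero because n has unit length.\<close>

lemma nabla_n:
  assumes u: "u \<in> W"
  shows "DD n u V + LC u V (n u) = - K u V (n u)"
proof -
  obtain e1 e2 where fr: "adapted_frame (h u) (K u) (Sh u) e1 e2 (n u) b (lam u) (lam u) (lam u - 4 * b\<^sup>2)"
    and ad: "adapted (h u) (K u) (Sh u) e1 e2 (n u) b (lam u) (lam u) (lam u - 4 * b\<^sup>2)"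
    using special_frame[OF u] by blast
  interpret adapted_frame "h u" "K u" "Sh u" e1 e2 "n u" b "lam u" "lam u" "lam u - 4 * b\<^sup>2" by (rule fr)
  define N where "N V = DD n u V + LC u V (n u)" for V
  have "DD (\<lambda>w. h w (n w) (n w)) u V = DD (\<lambda>w. 1) u V" for V
    by (rule DD_eq_on[OF open_W u h_n_n smooth_h_apply[OF smooth_n smooth_n]])
  then have Nn: "h u (N V) (n u) = 0" for V
    using DD_h[OF smooth_n smooth_n u, of V] sym[of "n u" "N V"] by (simp add: N_def)
  have b: "b \<noteq> 0" using b_pos by simp
  note ts = table_s[OF u ad b, unfolded dS_eq[OF u, folded N_def]]
  \<comment> \<open>The table gives (4 b^2)^2 for 4 b times an entry of \<open>dS\<close>, and that
    entry is -4 b^2 times the unknown component x.\<close>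
  have e: "4 * b * (- (4 * b\<^sup>2) * x) = (4 * b\<^sup>2)\<^sup>2 \<Longrightarrow> x = - b" for x
  proof -
    assume "4 * b * (- (4 * b\<^sup>2) * x) = (4 * b\<^sup>2)\<^sup>2"
    then have "(16 * b ^ 3) * x = (16 * b ^ 3) * (- b)" by (simp add: power2_eq_square power3_eq_cube algebra_simps)
    then show "x = - b" by (rule mult_left_cancel[THEN iffD1, rotated]) (use b in simp)
  qed
  have Ne: "h u (N e1) e2 = - b" "h u (N e2) e1 = - b" "h u (N e1) e1 = 0" "h u (N e2) e2 = 0" "h u (N (n u)) e1 = 0"
      "h u (N (n u)) e2 = 0"
    using ts b Nn by (auto simp: simps frame intro!: e)
  have linN: "linear (\<lambda>V. N V + K u V (n u))"
    unfolding N_def by (intro linear_compose_add linear_Dn linear_LC' linear_K' u)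
  have z: "N e1 + K u e1 (n u) = 0" "N e2 + K u e2 (n u) = 0" "N (n u) + K u (n u) (n u) = 0"
    by (rule eq_frameI; simp add: simps KS frame Ne Nn)+
  show "DD n u V + LC u V (n u) = - K u V (n u)"
    using linear_expand[OF linN, of V] by (simp add: z[unfolded N_def] N_def eq_neg_iff_add_eq_0)
qed

text \<open>When the first two eigenvalues agree, the entries of the table recombine into an
  expression in h and n, with no trace of the axes e1 and e2.\<close>

lemma dK_n:
  assumes u: "u \<in> W"
  shows "dK u V (n u) Y = (2 * b\<^sup>2) *\<^sub>R (h u (n u) Y *\<^sub>R V + (h u V Y - 2 * h u (n u) V * h u (n u) Y) *\<^sub>R n u)"
proof -
  obtain e1 e2 where fr: "adapted_frame (h u) (K u) (Sh u) e1 e2 (n u) b (lam u) (lam u) (lam u - 4 * b\<^sup>2)"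
    and ad: "adapted (h u) (K u) (Sh u) e1 e2 (n u) b (lam u) (lam u) (lam u - 4 * b\<^sup>2)"
    using special_frame[OF u] by blast
  interpret adapted_frame "h u" "K u" "Sh u" e1 e2 "n u" b "lam u" "lam u" "lam u - 4 * b\<^sup>2" by (rule fr)
  have b: "b \<noteq> 0" using b_pos by simp
  note tk = table_k[OF u ad b]
  have tk': "h u (dK u v (n u) e1) (n u) = h u (dK u v (n u) (n u)) e1"
      "h u (dK u v (n u) e2) (n u) = h u (dK u v (n u) (n u)) e2"
      "h u (dK u v (n u) e2) e1 = h u (dK u v (n u) e1) e2" for v
    by (rule dK_cubic_sym[OF u])+
  have 1: "dK u v (n u) Y = h u Y e1 *\<^sub>R dK u v (n u) e1 + h u Y e2 *\<^sub>R dK u v (n u) e2 + h u Y (n u) *\<^sub>R dK u v (n u)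
      (n u)" for v
    by (rule linear_expand[OF linear_dK[OF u]])
  have 2: "dK u V (n u) Y = h u V e1 *\<^sub>R dK u e1 (n u) Y + h u V e2 *\<^sub>R dK u e2 (n u) Y + h u V (n u) *\<^sub>R dK u (n u) (n u) Y"
    by (rule linear_expand[OF linear_dK_dir[OF u]])
  show ?thesis
    unfolding 2 unfolding 1[of e1] 1[of e2] 1[of "n u"]
    by (rule eq_frameI; simp add: simps tk tk' frame h_expand[of V Y] sym[of "n u" Y] sym[of "n u" V] algebra_simps)
qed

lemma DD_E: "u \<in> W \<Longrightarrow> DD (\<lambda>w. DD f w (n w)) u V = h u (n u) V *\<^sub>R \<eta> u"
proof -
  assume u: "u \<in> W"
  have "DD n u V + Gam u V (n u) = 0"
    using nabla_n[OF u, of V] by (simp add: LC_def algebra_simps)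
  then show ?thesis
    by (simp add: DD_tangent[OF smooth_n u] linear_0[OF linear_df[OF u]] sym_h[OF u, of V])
qed

lemma lam_zero: "u \<in> W \<Longrightarrow> lam u = 0"
proof -
  assume u: "u \<in> W"
  obtain e1 e2 where "adapted_frame (h u) (K u) (Sh u) e1 e2 (n u) b (lam u) (lam u) (lam u - 4 * b\<^sup>2)"
    using special_frame[OF u] by blast
  then interpret adapted_frame "h u" "K u" "Sh u" e1 e2 "n u" b "lam u" "lam u" "lam u - 4 * b\<^sup>2" .
  define E where "E w = DD f w (n w)" for w
  have DE: "DD E w Y = h w (n w) Y *\<^sub>R \<eta> w" if "w \<in> W" for w Y
    using DD_E[OF that, of Y] by (simp add: E_def[abs_def])
  have sE: "smooth_on W E" unfolding E_def by (rule smooth_tangent[OF smooth_n])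
  have e: "DD (\<lambda>w. DD E w Y) u X = DD f u (- (h u (n u) Y *\<^sub>R Sh u X)) + DD (\<lambda>w. h w (n w) Y) u X *\<^sub>R \<eta> u" for X Y
  proof -
    have "DD (\<lambda>w. DD E w Y) u X = DD (\<lambda>w. h w (n w) Y *\<^sub>R \<eta> w) u X"
      by (rule DD_eq_on[OF open_W u _ smooth_on_DD[OF sE]]) (rule DE)
    also have "\<dots> = h u (n u) Y *\<^sub>R DD \<eta> u X + DD (\<lambda>w. h w (n w) Y) u X *\<^sub>R \<eta> u"
      by (rule DD_scaleR; rule smooth_on_differentiable[OF _ u]; intro smooth_th smooth_eta)
    finally show ?thesis
      by (simp add: weingarten[OF u] lins[OF linear_df[OF u]])
  qed
  \<comment> \<open>The tangential parts of the mixed derivatives in the directions n and e1 give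
    h(n, n) S e1 = h(n, e1) S n, and the right hand side is zero by orthogonality.\<close>
  from decomp_unique(1)[OF u second_derivative_sym[OF open_W u sE, of "n u" e1, unfolded e]]
  have "h u (n u) (n u) *\<^sub>R Sh u e1 = h u (n u) e1 *\<^sub>R Sh u (n u)" by simp
  then have "lam u *\<^sub>R e1 = 0" by (simp add: frame KS)
  then have "lam u * h u e1 e1 = 0" using arg_cong[of "lam u *\<^sub>R e1" 0 "\<lambda>v. h u v e1"] by (simp add: simps)
  then show "lam u = 0" by (simp add: frame)
qed

text \<open>For \<open>s = 1\<close> and \<open>s = -1\<close>, \<open>A\<close> is the rank one part of \<open>h\<close> on which \<open>K\<^sub>n\<close> acts as \<open>s b\<close>.\<close>
definition "A s u X Y = (h u X Y - h u (n u) X * h u (n u) Y + s / b * h u (K u (n u) X) Y) / 2"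

text \<open>These are the eigenvectors, for 2 b s h(n, .), of the closed linear system formed by the
  derivatives of \<eta> and of the image of n; see \<open>DD_P\<close>.\<close>

definition "P s u = \<eta> u + (2 * b * s) *\<^sub>R DD f u (n u)"

lemma DD_P:
  assumes u: "u \<in> W" and s: "s * s = 1"
  shows "DD (P s) u V = (2 * b * s * h u (n u) V) *\<^sub>R P s u"
proof -
  have "DD (P s) u V = DD \<eta> u V + DD (\<lambda>w. (2 * b * s) *\<^sub>R DD f w (n w)) u V"
    unfolding P_def
    by (rule DD_add; rule smooth_on_differentiable[OF _ u]; intro smooth_eta smooth_on_scaleR open_W smooth_on_const
        smooth_tangent smooth_n)
  also have "DD (\<lambda>w. (2 * b * s) *\<^sub>R DD f w (n w)) u V = (2 * b * s) *\<^sub>R (h u (n u) V *\<^sub>R \<eta> u)"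
    using DD_linear[OF smooth_on_differentiable[OF smooth_tangent[OF smooth_n] u] bounded_linear_scaleR_right, of
        "2 * b * s" V]
    by (simp add: DD_E[OF u])
  also have "DD \<eta> u V = (2 * b * s * h u (n u) V) *\<^sub>R ((2 * b * s) *\<^sub>R DD f u (n u))"
  proof -
    have "(2 * b * s * h u (n u) V) * (2 * b * s) = 4 * b\<^sup>2 * h u (n u) V * (s * s)" by (simp add: power2_eq_square)
    then have "(2 * b * s * h u (n u) V) * (2 * b * s) = 4 * b\<^sup>2 * h u (n u) V" by (simp only: s mult_1_right)
    moreover have "DD \<eta> u V = (4 * b\<^sup>2 * h u (n u) V) *\<^sub>R DD f u (n u)"
      by (simp add: weingarten[OF u] Sh_eq[OF u] lam_zero[OF u] lins[OF linear_df[OF u]])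
    ultimately show ?thesis by (simp only: scaleR_scaleR)
  qed
  finally show ?thesis by (simp add: P_def[of s u] algebra_simps)
qed

lemma smooth_P: "smooth_on W (P s)"
  unfolding P_def by (intro smooth_on_add open_W smooth_eta smooth_on_scaleR smooth_on_const smooth_tangent smooth_n)

lemma smooth_G: "smooth_on W (\<lambda>w. h w (K w (n w) X) Y)"
  by (intro smooth_h_apply smooth_K_apply smooth_n smooth_on_const)

lemma smooth_A: "smooth_on W (\<lambda>w. A s w X Y)"
  unfolding A_def
  by (intro smooth_on_divide smooth_on_add smooth_on_diff smooth_on_mult smooth_G smooth_h smooth_th smooth_on_const
      open_W) simp

lemma linear_A: "u \<in> W \<Longrightarrow> linear (A s u X)"
proof -
  assume u: "u \<in> W"
  interpret pos_form "h u" by (rule pos_form_h[OF u])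
  show ?thesis unfolding A_def by (rule linearI) (simp_all add: simps algebra_simps add_divide_distrib diff_divide_distrib)
qed

lemma A_sym: "u \<in> W \<Longrightarrow> A s u X Y = A s u Y X"
  using cubic_sym[of u "n u" X Y] sym_h[of u X Y] by (simp add: A_def)

text \<open>The covariant derivative of A for the induced connection is the multiple -2 b s h(n, .)
  of A. This cancels the logarithmic derivative of \<open>m\<close> below, so that m A becomes
  parallel.\<close>

lemma DD_A:
  assumes u: "u \<in> W" and s: "s * s = 1"
  shows "DD (\<lambda>w. A s w X Y) u V = A s u (Gam u V X) Y + A s u X (Gam u V Y) - 2 * b * s * h u (n u) V * A s u X Y"
proof -
  obtain e1 e2 where fr: "adapted_frame (h u) (K u) (Sh u) e1 e2 (n u) b (lam u) (lam u) (lam u - 4 * b\<^sup>2)"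
    using special_frame[OF u] by blast
  interpret adapted_frame "h u" "K u" "Sh u" e1 e2 "n u" b "lam u" "lam u" "lam u - 4 * b\<^sup>2" by (rule fr)
  have b: "b \<noteq> 0" using b_pos by simp
  have th: "DD (\<lambda>w. h w (n w) X) u V = - h u (K u V (n u)) X + h u (n u) (LC u V X)" for X
    using DD_th[OF u, of X V] nabla_n[OF u, of V] by (simp add: simps)
  have G: "DD (\<lambda>w. h w (K w (n w) X) Y) u V
     = h u (dK u V (n u) X) Y - h u (K u (K u V (n u)) X) Y + h u (K u (n u) (LC u V X)) Y + h u (K u (n u) X) (LC u V Y)"
  proof -
    have 1: "DD (\<lambda>w. h w (K w (n w) X) Y) u V = h u (DD (\<lambda>w. K w (n w) X) u V + LC u V (K u (n u) X)) Y + h u (K u (n u)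
        X) (LC u V Y)"
      using DD_h[OF smooth_K_apply[OF smooth_n smooth_on_const] smooth_on_const u, of X Y V] by simp
    have 2: "DD (\<lambda>w. K w (n w) X) u V = DD (\<lambda>w. K w (n u) X) u V + K u (DD n u V) X"
      using DD_apply[OF open_W linear_K' smooth_K smooth_n u, of X V] .
    have 3: "K u (DD n u V) X = - K u (K u V (n u)) X - K u (LC u V (n u)) X"
      using arg_cong[OF nabla_n[OF u, of V], of "\<lambda>v. K u v X"]
      by (simp add: lins[OF linear_K'[OF u]] algebra_simps)
    show ?thesis unfolding 1 2 3 by (simp add: dK_def simps)
  qed
  have "DD (\<lambda>w. A s w X Y) u V = (DD (\<lambda>w. h w X Y) u V - (h u (n u) X * DD (\<lambda>w. h w (n w) Y) u V + DD (\<lambda>w. h w (n w) X)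
      u V * h u (n u) Y)
      + s / b * DD (\<lambda>w. h w (K w (n w) X) Y) u V) / 2"
  proof -
    note d = smooth_on_has_derivative[OF _ u]
    have "((\<lambda>w. A s w X Y) has_derivative (\<lambda>V. (DD (\<lambda>w. h w X Y) u V - (h u (n u) X * DD (\<lambda>w. h w (n w) Y) u V + DD (\<lambda>w.
        h w (n w) X) u V * h u (n u) Y)
      + s / b * DD (\<lambda>w. h w (K w (n w) X) Y) u V) / 2)) (at u)"
      unfolding A_def
      by (rule bounded_linear.has_derivative[OF bounded_linear_divide],
          intro has_derivative_add has_derivative_diff has_derivative_mult_right[OF d[OF smooth_G]] has_derivative_mult
          d[OF smooth_h] d[OF smooth_th])
    then show ?thesis by (rule DD_eqI)
  qed
  also have "\<dots> = A s u (LC u V X + K u V X) Y + A s u X (LC u V Y + K u V Y) - 2 * b * s * h u (n u) V * A s u X Y"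
  proof -
    \<comment> \<open>Once \<open>dK_n\<close> and \<open>nabla_n\<close> are inserted, both sides
      are polynomials in frame components, and they agree modulo s * s = 1.\<close>
    have cub: "h u (K u P Q) R = b * ((h u P e2 * h u Q (n u) + h u P (n u) * h u Q e2) * h u R e1
        + (h u P e1 * h u Q (n u) + h u P (n u) * h u Q e1) * h u R e2 + (h u P e1 * h u Q e2 + h u P e2 * h u Q e1) * h
            u R (n u))" for P Q R
      using h_expand[of "K u P Q" R] by (simp add: K_comp algebra_simps)
    have ss: "s * (s * x) = x" for x using s by (simp add: mult.assoc[symmetric])
    have nx: "h u (n u) Z = h u Z (n u)" for Z by (rule sym)
    note exp = h_expand[of "LC u V X" Y] h_expand[of X "LC u V Y"] h_expand[of X Y] h_expand[of V X] h_expand[of V Y]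
        h_expand[of X "K u V Y"]
    show ?thesis
      unfolding Dh_LC[OF u] th G A_def dK_n[OF u] simps nx[of X] nx[of Y] nx[of V] nx[of "LC u V X"] nx[of "LC u V Y"]
          nx[of "K u V X"] nx[of "K u V Y"]
        linear_add[OF linear_K[OF u]] exp
      using b by (simp add: cub K_comp frame field_simps ss power2_eq_square)
  qed
  finally show ?thesis by (simp add: LC_def)
qed

end

section \<open>Paraboloid coordinates\<close>

context special_hypersurface
begin

text \<open>The direction of \<open>P s\<close> is constant, and \<open>m s\<close> is its length relative to the base point.\<close>
definition "m u0 s u = (P s u \<bullet> P s u0) / (P s u0 \<bullet> P s u0)"

lemma P_nonzero: "u \<in> W \<Longrightarrow> P s u \<noteq> 0"
proof
  assume u: "u \<in> W" and "P s u = 0"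
  then have "DD f u ((2 * b * s) *\<^sub>R n u) + 1 *\<^sub>R \<eta> u = DD f u 0 + 0 *\<^sub>R \<eta> u"
    by (simp add: P_def[of s u] lins[OF linear_df[OF u]] add.commute)
  from decomp_unique(2)[OF u this] show False by simp
qed

lemma smooth_m: "smooth_on W (m u0 s)"
  unfolding m_def by (intro smooth_on_bounded_linear[OF open_W smooth_P] bounded_linear_intros)
     (auto intro!: bounded_linear_compose[OF bounded_linear_divide bounded_linear_inner_left, unfolded o_def])

lemma DD_m:
  assumes u: "u \<in> W" and s: "s * s = 1"
  shows "DD (m u0 s) u V = 2 * b * s * h u (n u) V * m u0 s u"
proof -
  have "bounded_linear (\<lambda>x. (x \<bullet> P s u0) / (P s u0 \<bullet> P s u0))"
    by (rule bounded_linear_compose[OF bounded_linear_divide bounded_linear_inner_left])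
  from DD_linear[OF smooth_on_differentiable[OF smooth_P u] this]
  show ?thesis unfolding m_def by (simp add: DD_P[OF u s])
qed

text \<open>Both sides satisfy the same linear equation and agree at \<open>u0\<close>;
  \<open>m\<close> inherits the equation because it is a fixed linear functional of P.\<close>

lemma P_eq:
  assumes u0: "u0 \<in> W" and s: "s * s = 1" and u: "u \<in> W"
  shows "P s u = m u0 s u *\<^sub>R P s u0"
proof -
  define g where "g i w = (P s w - m u0 s w *\<^sub>R P s u0) $ i" for i w
  have m0: "m u0 s u0 = 1" using P_nonzero[OF u0] by (simp add: m_def)
  have d: "(\<lambda>w. P s w - m u0 s w *\<^sub>R P s u0) differentiable (at w)" if "w \<in> W" for w
    by (rule smooth_on_differentiable[OF _ that]) (intro smooth_on_diff smooth_on_scaleR open_W smooth_P smooth_m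
        smooth_on_const)
  have "g i u = 0" for i
  proof (rule linear_system_unique[OF convex_W u0 u, where a = "\<lambda>i j w V. if j = i then 2 * b * s * h w (n w) V else 0"])
    show "g i u0 = 0" for i by (simp add: g_def m0)
    show "g i differentiable (at w)" if "w \<in> W" for i w
      unfolding g_def differentiable_def
      using bounded_linear.has_derivative[OF bounded_linear_vec_nth DD_has_derivative[OF d[OF that]]] by blast
    show "DD (g i) w V = (\<Sum>j\<in>UNIV. (if j = i then 2 * b * s * h w (n w) V else 0) * g j w)" if w: "w \<in> W" for i w V
    proof -
      have "DD (g i) w V = DD (\<lambda>w. P s w - m u0 s w *\<^sub>R P s u0) w V $ i"
        unfolding g_def by (rule DD_linear[OF d[OF w] bounded_linear_vec_nth])
      also have "DD (\<lambda>w. P s w - m u0 s w *\<^sub>R P s u0) w V = DD (P s) w V - DD (\<lambda>w. m u0 s w *\<^sub>R P s u0) w V"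
        by (rule DD_diff; rule smooth_on_differentiable[OF _ w]; intro smooth_on_scaleR open_W smooth_P smooth_m
            smooth_on_const)
      also have "DD (\<lambda>w. m u0 s w *\<^sub>R P s u0) w V = DD (m u0 s) w V *\<^sub>R P s u0"
        using DD_scaleR[OF smooth_on_differentiable[OF smooth_m w] smooth_on_differentiable[OF smooth_on_const w], of u0
            s "P s u0" V] by simp
      finally have "DD (g i) w V = 2 * b * s * h w (n w) V * g i w"
        by (simp add: DD_P[OF w s] DD_m[OF w s] g_def[of i w] algebra_simps)
      then show ?thesis by (simp add: if_distrib[of "\<lambda>x. x * _"] cong: if_cong)
    qed
    show "continuous_on W (\<lambda>w. if j = i then 2 * b * s * h w (n w) V else 0)" for i j V
      by (cases "j = i") (auto intro!: continuous_intros smooth_on_continuous_on[OF smooth_th])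
  qed
  then show ?thesis by (simp add: g_def vec_eq_iff)
qed

lemma m_base: "u0 \<in> W \<Longrightarrow> m u0 s u0 = 1"
  using P_nonzero[of u0 s] by (simp add: m_def)

text \<open>The logarithmic derivatives for s = 1 and s = -1 are opposite. This relation becomes the
  equation of the model.\<close>

lemma m_mult:
  assumes u0: "u0 \<in> W" and u: "u \<in> W"
  shows "m u0 1 u * m u0 (-1) u = 1"
proof -
  have "m u0 1 u * m u0 (-1) u = m u0 1 u0 * m u0 (-1) u0"
  proof (rule DD_zero_constant[OF convex_W _ _ u u0])
    fix w X assume w: "w \<in> W"
    show "(\<lambda>w. m u0 1 w * m u0 (-1) w) differentiable (at w)"
      by (rule smooth_on_differentiable[OF _ w]) (intro smooth_on_mult open_W smooth_m)
    show "DD (\<lambda>w. m u0 1 w * m u0 (-1) w) w X = 0"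
      using DD_mult[OF smooth_on_differentiable[OF smooth_m w] smooth_on_differentiable[OF smooth_m w], of u0 1 u0 "-1" X]
        DD_m[OF w, of 1 u0 X] DD_m[OF w, of "-1" u0 X] by simp
  qed
  then show ?thesis by (simp add: m_base[OF u0])
qed

text \<open>\<open>x\<close> and \<open>y\<close> are two of the four affine coordinates, chosen at the base point. The form \<open>dx\<close> is
  parallel for the affine connection, and so is \<open>m A - dx dx\<close>, which vanishes at the base point.\<close>
lemma paraboloid_coordinate:
  assumes u0: "u0 \<in> W" and s: "s * s = 1"
    and lin: "linear x" "linear y"
    and xP: "x (P s u0) = 0" "x (P (- s) u0) = 0" and yP: "y (P s u0) = 1" "y (P (- s) u0) = 0"
    and fr: "adapted (h u0) (K u0) (Sh u0) e1 e2 (n u0) b (lam u0) (lam u0) (lam u0 - 4 * b\<^sup>2)"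
    and xe: "x (DD f u0 e1) = 1 / sqrt 2" "x (DD f u0 e2) = s / sqrt 2"
    and ye: "y (DD f u0 e1) = 0" "y (DD f u0 e2) = 0"
  shows "\<exists>c. \<forall>u\<in>W. y (f u - f u0) - (x (f u - f u0))\<^sup>2 / 2 = m u0 s u / (8 * b\<^sup>2) + c"
proof -
  have b: "b \<noteq> 0" using b_pos by simp
  have bl: "bounded_linear x" "bounded_linear y" using lin linear_conv_bounded_linear by blast+
  have s': "- s * - s = 1" using s by simp
  have s0: "s \<noteq> 0" using s by auto
  let ?m = "m u0 s"
  have Ps: "P s u = ?m u *\<^sub>R P s u0" "P (- s) u = m u0 (- s) u *\<^sub>R P (- s) u0" if "u \<in> W" for u
    using P_eq[OF u0 s that] P_eq[OF u0 s' that] by simp_all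
  have eta: "\<eta> u = (1/2) *\<^sub>R (P s u + P (- s) u)" for u
  proof -
    have "P s u + P (- s) u = \<eta> u + \<eta> u" by (simp add: P_def[of s u] P_def[of "- s" u])
    then show ?thesis by (simp only: scaleR_half_double)
  qed
  have E: "DD f u (n u) = (s / (4 * b)) *\<^sub>R (P s u - P (- s) u)" for u
  proof -
    have "P s u - P (- s) u = (4 * b * s) *\<^sub>R DD f u (n u)"
    proof -
      have "P s u - P (- s) u = (2 * b * s) *\<^sub>R DD f u (n u) + (2 * b * s) *\<^sub>R DD f u (n u)"
        by (simp add: P_def[of s u] P_def[of "- s" u])
      then show ?thesis by (simp add: scaleR_add_left[symmetric])
    qed
    moreover have "s / (4 * b) * (4 * b * s) = 1" using s b by simp
    ultimately show ?thesis by (simp only: scaleR_scaleR scaleR_one)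
  qed
  have x_eta: "x (\<eta> u) = 0" "y (\<eta> u) = ?m u / 2" "x (DD f u (n u)) = 0" "y (DD f u (n u)) = s * ?m u / (4 * b)" if u:
      "u \<in> W" for u
  proof -
    have xy: "x (P s u) = 0" "x (P (- s) u) = 0" "y (P s u) = ?m u" "y (P (- s) u) = 0"
      by (subst Ps(1)[OF u] Ps(2)[OF u], simp only: linear_cmul[OF lin(1)] linear_cmul[OF lin(2)] xP yP, simp)+
    show "x (\<eta> u) = 0" "y (\<eta> u) = ?m u / 2"
      by (subst eta, simp only: lins[OF lin(1)] lins[OF lin(2)] xy, simp)+
    show "x (DD f u (n u)) = 0" "y (DD f u (n u)) = s * ?m u / (4 * b)"
      by (subst E, simp only: lins[OF lin(1)] lins[OF lin(2)] xy, simp)+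
  qed
  define \<omega> where "\<omega> u Y = x (DD f u Y)" for u Y
  define \<upsilon> where "\<upsilon> u Y = y (DD f u Y)" for u Y
  have smo: "smooth_on W (\<lambda>u. \<omega> u Y)" "smooth_on W (\<lambda>u. \<upsilon> u Y)" for Y
    unfolding \<omega>_def \<upsilon>_def
    by (rule smooth_on_bounded_linear[OF open_W smooth_on_DD[OF smooth_f] bl(1)],
        rule smooth_on_bounded_linear[OF open_W smooth_on_DD[OF smooth_f] bl(2)])
  \<comment> \<open>x kills both constant directions, hence \<eta>, so dx is parallel. For y only
    the transversal term h m / 2 remains.\<close>
  have D\<omega>: "DD (\<lambda>w. \<omega> w Y) u V = \<omega> u (Gam u V Y)" if u: "u \<in> W" for u V Y
    using DD_linear[OF smooth_on_differentiable[OF smooth_on_DD[OF smooth_f] u] bl(1), of Y V] gauss[OF u, of V Y]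
    by (simp add: second_derivative_def \<omega>_def lins[OF lin(1)] x_eta[OF u])
  have D\<upsilon>: "DD (\<lambda>w. \<upsilon> w Y) u V = \<upsilon> u (Gam u V Y) + h u V Y * ?m u / 2" if u: "u \<in> W" for u V Y
    using DD_linear[OF smooth_on_differentiable[OF smooth_on_DD[OF smooth_f] u] bl(2), of Y V] gauss[OF u, of V Y]
    by (simp add: second_derivative_def \<upsilon>_def lins[OF lin(2)] x_eta[OF u])
  have lin\<omega>: "linear (\<omega> u)" "linear (\<upsilon> u)" if u: "u \<in> W" for u
    unfolding \<omega>_def \<upsilon>_def using linear_compose[OF linear_df[OF u] lin(1)] linear_compose[OF linear_df[OF u] lin(2)]
    by (simp_all add: o_def)
  interpret u0: adapted_frame "h u0" "K u0" "Sh u0" e1 e2 "n u0" b "lam u0" "lam u0" "lam u0 - 4 * b\<^sup>2"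
    by (rule adapted_frameI[OF u0 fr])
  have \<omega>0: "\<omega> u0 X = (h u0 X e1 + s * h u0 X e2) / sqrt 2" for X
    using u0.linear_expand[OF lin\<omega>(1)[OF u0], of X] x_eta(3)[OF u0] xe
    by (simp add: \<omega>_def add_divide_distrib)
  have \<upsilon>0: "\<upsilon> u0 X = s * h u0 X (n u0) / (4 * b)" for X
    using u0.linear_expand[OF lin\<omega>(2)[OF u0], of X] x_eta(4)[OF u0] ye
    by (simp add: \<upsilon>_def m_base[OF u0])
  define T where "T u X Y = ?m u * A s u X Y - \<omega> u X * \<omega> u Y" for u X Y
  \<comment> \<open>The values 1 / sqrt 2 and s / sqrt 2 of x are chosen for this: in the frame, A
    at \<open>u0\<close> is (x1 + s x2)^2 / 2.\<close>
  have T0: "T u0 X Y = 0" for X Y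
  proof -
    have 1: "h u0 (K u0 (n u0) X) Y = b * (h u0 X e1 * h u0 Y e2 + h u0 X e2 * h u0 Y e1)"
      using u0.h_expand[of "K u0 (n u0) X" Y] by (simp add: u0.K_comp u0.frame algebra_simps)
    have "s / b * (b * t) = s * t" for t using b by simp
    note 2 = this
    have 3: "\<omega> u0 X * \<omega> u0 Y = (h u0 X e1 + s * h u0 X e2) * (h u0 Y e1 + s * h u0 Y e2) / 2"
      by (simp add: \<omega>0)
    have ss: "s * (s * t) = t" for t using s by (simp add: mult.assoc[symmetric])
    show ?thesis
      unfolding T_def A_def 1 2 3 m_base[OF u0] u0.h_expand[of X Y] u0.sym[of "n u0" X] u0.sym[of "n u0" Y]
      by (simp add: algebra_simps ss)
  qed
  have smT: "smooth_on W (\<lambda>u. T u X Y)" for X Y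
    unfolding T_def by (intro smooth_on_diff smooth_on_mult open_W smooth_m smooth_A smo)
  have linT: "linear (T u X)" "T u X Y = T u Y X" if u: "u \<in> W" for u X Y
  proof -
    show "linear (T u X)"
      unfolding T_def
      by (rule linearI) (simp_all add: lins[OF linear_A[OF u]] lins[OF lin\<omega>(1)[OF u]] algebra_simps)
    show "T u X Y = T u Y X" by (simp add: T_def A_sym[OF u, of s X Y])
  qed
  have linT': "linear (\<lambda>X. T u X Y)" if u: "u \<in> W" for u Y
    using linT(1)[OF u, of Y] by (simp add: linT(2)[OF u, of _ Y])
  have DT: "DD (\<lambda>w. T w X Y) u V = T u (Gam u V X) Y + T u X (Gam u V Y)" if u: "u \<in> W" for u V X Y
  proof -
    note d = smooth_on_differentiable[OF _ u]
    have "DD (\<lambda>w. T w X Y) u V = DD (\<lambda>w. ?m w * A s w X Y) u V - DD (\<lambda>w. \<omega> w X * \<omega> w Y) u V"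
      unfolding T_def by (rule DD_diff; rule d; intro smooth_on_mult open_W smooth_m smooth_A smo)
    also have "DD (\<lambda>w. ?m w * A s w X Y) u V = ?m u * DD (\<lambda>w. A s w X Y) u V + DD ?m u V * A s u X Y"
      by (rule DD_mult; rule d; intro smooth_m smooth_A)
    also have "DD (\<lambda>w. \<omega> w X * \<omega> w Y) u V = \<omega> u X * DD (\<lambda>w. \<omega> w Y) u V + DD (\<lambda>w. \<omega> w X) u V * \<omega> u Y"
      by (rule DD_mult; rule d; intro smo)
    finally show ?thesis
      by (simp add: D\<omega>[OF u] DD_A[OF u s] DD_m[OF u s] T_def algebra_simps)
  qed
  have Gsm: "continuous_on W (\<lambda>w. Gam w V X $ k)" for V X k
    by (rule smooth_on_continuous_on[OF smooth_on_vec_nth[OF open_W smooth_Gam]])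
  have Tz: "T u X Y = 0" if u: "u \<in> W" for u X Y
  proof -
    define g where "g p w = T w (axis (fst p) 1) (axis (snd p) 1)" for p :: "3 \<times> 3" and w
    \<comment> \<open>The index set is the set of pairs (i, j), and the coefficients are those of
      the Leibniz rule in \<open>DT\<close>, one summand for each slot of T.\<close>
    define a where "a p q w V = (if snd q = snd p then Gam w V (axis (fst p) 1) $ fst q else 0)
       + (if fst q = fst p then Gam w V (axis (snd p) 1) $ snd q else 0)" for p q :: "3 \<times> 3" and w V
    have gz: "g p u = 0" for p
    proof (rule linear_system_unique[OF convex_W u0 u, where a = a])
      show "g p u0 = 0" for p by (simp add: g_def T0)
      show "g p differentiable (at w)" if "w \<in> W" for p w
        unfolding g_def by (rule smooth_on_differentiable[OF smT that])
      show "DD (g p) w V = (\<Sum>q\<in>UNIV. a p q w V * g q w)" if w: "w \<in> W" for p w V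
      proof -
        obtain i j where p: "p = (i, j)" by force
        have "(\<Sum>q\<in>UNIV. a p q w V * g q w) = (\<Sum>k\<in>UNIV. \<Sum>l\<in>UNIV. a p (k, l) w V * g (k, l) w)"
          by (simp add: sum.cartesian_product UNIV_Times_UNIV[symmetric] del: UNIV_Times_UNIV)
        also have "\<dots> = (\<Sum>k\<in>UNIV. Gam w V (axis i 1) $ k * T w (axis k 1) (axis j 1))
            + (\<Sum>l\<in>UNIV. Gam w V (axis j 1) $ l * T w (axis i 1) (axis l 1))"
          by (simp add: a_def g_def p distrib_right sum.distrib if_distrib[of "\<lambda>x. x * _"] sum.swap[of _ UNIV UNIV]
              cong: if_cong)
        also have "\<dots> = T w (Gam w V (axis i 1)) (axis j 1) + T w (axis i 1) (Gam w V (axis j 1))"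
          using linear_axis[OF linT'[OF w, of "axis j 1"], of "Gam w V (axis i 1)"] linear_axis[OF linT(1)[OF w], of
              "axis i 1" "Gam w V (axis j 1)"]
          by simp
        finally show ?thesis by (simp add: g_def[abs_def] p DT[OF w])
      qed
      show "continuous_on W (\<lambda>w. a p q w V)" for p q V
        unfolding a_def by (cases "snd q = snd p"; cases "fst q = fst p") (auto intro!: continuous_intros Gsm)
    qed
    have "T u (axis i 1) Y = 0" for i
      using linear_axis[OF linT(1)[OF u], of "axis i 1" Y] gz[of "(i, _)"] by (simp add: g_def)
    then show ?thesis
      using linear_axis[OF linT'[OF u, of Y], of X] by simp
  qed
  \<comment> \<open>This is the differential of the function \<open>z\<close> below, as d(m / (8
    b^2)) = s h(n, .) m / (4 b). Here the constant 8 b^2 originates.\<close>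
  define \<zeta> where "\<zeta> u Y = \<upsilon> u Y - s * h u (n u) Y * ?m u / (4 * b) - x (f u - f u0) * \<omega> u Y" for u Y
  have smx: "smooth_on W (\<lambda>u. x (f u - f u0))" and smy: "smooth_on W (\<lambda>u. y (f u - f u0))"
    by (rule smooth_on_bounded_linear[OF open_W smooth_on_diff[OF open_W smooth_f smooth_on_const] bl(1)],
        rule smooth_on_bounded_linear[OF open_W smooth_on_diff[OF open_W smooth_f smooth_on_const] bl(2)])
  have Dx: "DD (\<lambda>u. x (f u - f u0)) u V = \<omega> u V" "DD (\<lambda>u. y (f u - f u0)) u V = \<upsilon> u V" if u: "u \<in> W" for u V
  proof -
    have 1: "(\<lambda>u. f u - f u0) differentiable (at u)" "DD (\<lambda>u. f u - f u0) u V = DD f u V"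
      using DD_diff[OF smooth_on_differentiable[OF smooth_f u] smooth_on_differentiable[OF smooth_on_const u], of "f u0" V]
        smooth_on_differentiable[OF smooth_on_diff[OF open_W smooth_f smooth_on_const] u] by simp_all
    show "DD (\<lambda>u. x (f u - f u0)) u V = \<omega> u V" "DD (\<lambda>u. y (f u - f u0)) u V = \<upsilon> u V"
      using DD_linear[OF 1(1) bl(1), of V] DD_linear[OF 1(1) bl(2), of V] by (simp_all add: 1(2) \<omega>_def \<upsilon>_def)
  qed
  have sm\<zeta>: "smooth_on W (\<lambda>u. \<zeta> u Y)" for Y
    unfolding \<zeta>_def
    by (intro smooth_on_diff smooth_on_mult smooth_on_divide open_W smo smx smooth_th smooth_m smooth_on_const) (use b
        in simp)
  have lin\<zeta>: "linear (\<zeta> u)" if u: "u \<in> W" for u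
  proof -
    interpret pos_form "h u" by (rule pos_form_h[OF u])
    show ?thesis
      unfolding \<zeta>_def
      by (rule linearI) (simp_all add: simps lins[OF lin\<omega>(1)[OF u]] lins[OF lin\<omega>(2)[OF u]] algebra_simps add_divide_distrib)
  qed
  have D\<zeta>: "DD (\<lambda>w. \<zeta> w Y) u V = \<zeta> u (Gam u V Y)" if u: "u \<in> W" for u V Y
  proof -
    interpret pos_form "h u" by (rule pos_form_h[OF u])
    have th: "DD (\<lambda>w. h w (n w) Y) u V = h u (n u) (Gam u V Y) - 2 * h u (K u (n u) V) Y"
    proof -
      have "h u (K u V (n u)) Y = h u (K u (n u) V) Y" using sym_K[OF u] by simp
      moreover have "h u (n u) (K u V Y) = h u (K u (n u) V) Y"
        using cubic_sym[OF u, of V "n u" Y] sym_K[OF u, of V "n u"] sym[of "n u" "K u V Y"] by simp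
      ultimately show ?thesis
        using DD_th[OF u, of Y V, unfolded nabla_n[OF u]] by (simp add: simps LC_def)
    qed
    have hd: "((\<lambda>w. \<zeta> w Y) has_derivative (\<lambda>V. DD (\<lambda>w. \<upsilon> w Y) u V
        - (s * h u (n u) Y * DD ?m u V + s * DD (\<lambda>w. h w (n w) Y) u V * ?m u) / (4 * b)
        - (x (f u - f u0) * DD (\<lambda>w. \<omega> w Y) u V + DD (\<lambda>u. x (f u - f u0)) u V * \<omega> u Y))) (at u)"
      unfolding \<zeta>_def
      by (rule has_derivative_diff[OF has_derivative_diff[OF _ bounded_linear.has_derivative[OF bounded_linear_divide
          has_derivative_mult[OF has_derivative_mult_right]]] has_derivative_mult])
         (rule smooth_on_has_derivative[OF _ u], intro smo smx smooth_th smooth_m)+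
    \<comment> \<open>Replacing dx dx by m A is what closes the system: h m / 2 from the derivative
      of dy, the derivative of the term with n, and m A cancel. The three summands of A are made for
      this.\<close>
    have "T u V Y = 0" by (rule Tz[OF u])
    then have \<omega>\<omega>: "\<omega> u V * \<omega> u Y = ?m u * A s u V Y" by (simp add: T_def)
    have ss: "s * (s * t) = t" for t using s by (simp add: mult.assoc[symmetric])
    show ?thesis
      unfolding DD_eqI[OF hd] D\<upsilon>[OF u] D\<omega>[OF u] Dx[OF u] th DD_m[OF u s] \<omega>\<omega> \<zeta>_def[of u] A_def
      using b by (simp add: field_simps ss)
  qed
  have \<zeta>z: "\<zeta> u Y = 0" if u: "u \<in> W" for u Y
  proof -
    have "\<zeta> u (axis i 1) = 0" for i
    proof (rule linear_system_unique[OF convex_W u0 u, where a = "\<lambda>i j w V. Gam w V (axis i 1) $ j" and g =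
        "\<lambda>i w. \<zeta> w (axis i 1)"])
      show "\<zeta> u0 (axis i 1) = 0" for i
        by (simp add: \<zeta>_def \<upsilon>0 linear_0[OF lin(1)] m_base[OF u0] u0.sym[of "n u0"])
      show "(\<lambda>w. \<zeta> w (axis i 1)) differentiable (at w)" if "w \<in> W" for i w
        by (rule smooth_on_differentiable[OF sm\<zeta> that])
      show "DD (\<lambda>w. \<zeta> w (axis i 1)) w V = (\<Sum>j\<in>UNIV. Gam w V (axis i 1) $ j * \<zeta> w (axis j 1))" if w: "w \<in> W" for i w V
        using linear_axis[OF lin\<zeta>[OF w], of "Gam w V (axis i 1)"] by (simp add: D\<zeta>[OF w])
    qed (rule Gsm)
    then show ?thesis using linear_axis[OF lin\<zeta>[OF u], of Y] by simp
  qed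
  define z where "z u = y (f u - f u0) - (x (f u - f u0))\<^sup>2 / 2 - ?m u / (8 * b\<^sup>2)" for u
  have zc: "z u = z u0" if u: "u \<in> W" for u
  proof (rule DD_zero_constant[OF convex_W _ _ u u0])
    fix w V assume w: "w \<in> W"
    have hd: "(z has_derivative (\<lambda>V. DD (\<lambda>u. y (f u - f u0)) w V
        - (x (f w - f u0) * DD (\<lambda>u. x (f u - f u0)) w V + DD (\<lambda>u. x (f u - f u0)) w V * x (f w - f u0)) / 2 - DD ?m w V
            / (8 * b\<^sup>2))) (at w)"
      unfolding z_def power2_eq_square[of "x _"]
      by (rule has_derivative_diff[OF has_derivative_diff[OF _ bounded_linear.has_derivative[OF bounded_linear_divide
          has_derivative_mult]]
            bounded_linear.has_derivative[OF bounded_linear_divide]])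
         (rule smooth_on_has_derivative[OF _ w], intro smx smy smooth_m)+
    then show "z differentiable (at w)" unfolding differentiable_def by blast
    have "\<zeta> w V = 0" by (rule \<zeta>z[OF w])
    then show "DD z w V = 0"
      unfolding DD_eqI[OF hd] Dx[OF w] DD_m[OF w s] \<zeta>_def using b by (simp add: field_simps power2_eq_square)
  qed
  have "y (f u - f u0) - (x (f u - f u0))\<^sup>2 / 2 = m u0 s u / (8 * b\<^sup>2) + z u0" if "u \<in> W" for u
    using zc[OF that] by (simp add: z_def[of u])
  then show ?thesis by blast
qed

end

text \<open>The affine axes are the two constant directions at \<open>u0\<close> and the images of
  (e1 + e2) / sqrt 2 and (e1 - e2) / sqrt 2. In the inverse coordinates L both cases of
  \<open>paraboloid_coordinate\<close> apply, and \<open>m_mult\<close> gives the product.\<close>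

lemma (in special_hypersurface) special_in_model:
  assumes u0: "u0 \<in> W"
  shows "\<exists>T. affine_transformation T \<and> T ` f ` W \<subseteq> model_hypersurface"
proof -
  obtain e1 e2 where fr: "adapted_frame (h u0) (K u0) (Sh u0) e1 e2 (n u0) b (lam u0) (lam u0) (lam u0 - 4 * b\<^sup>2)"
    and ad: "adapted (h u0) (K u0) (Sh u0) e1 e2 (n u0) b (lam u0) (lam u0) (lam u0 - 4 * b\<^sup>2)"
    using special_frame[OF u0] by blast
  interpret adapted_frame "h u0" "K u0" "Sh u0" e1 e2 "n u0" b "lam u0" "lam u0" "lam u0 - 4 * b\<^sup>2" by (rule fr)
  note df = lins[OF linear_df[OF u0]]
  define r where "r = 1 / sqrt (2::real)"
  have r: "r \<noteq> 0" "r * r = 1 / 2" by (simp_all add: r_def)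
  define \<Phi> where "\<Phi> v = v$1 *\<^sub>R P 1 u0 + v$2 *\<^sub>R P (-1) u0 + v$3 *\<^sub>R DD f u0 (r *\<^sub>R (e1 + e2)) + v$4 *\<^sub>R DD f u0 (r *\<^sub>R
      (e1 - e2))" for v :: "real^4"
  have lin: "linear \<Phi>" unfolding \<Phi>_def by (rule linearI) (simp_all add: scaleR_add_left scaleR_add_right)
  have "v = 0" if "\<Phi> v = 0" for v
  proof -
    let ?Z = "(2 * b * (v$1 - v$2)) *\<^sub>R n u0 + (r * (v$3 + v$4)) *\<^sub>R e1 + (r * (v$3 - v$4)) *\<^sub>R e2"
    have "\<Phi> v = DD f u0 ?Z + (v$1 + v$2) *\<^sub>R \<eta> u0"
      by (simp add: \<Phi>_def P_def df scaleR_add_left scaleR_add_right scaleR_diff_left scaleR_diff_right algebra_simps)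
    then have e: "DD f u0 ?Z + (v$1 + v$2) *\<^sub>R \<eta> u0 = DD f u0 0 + 0 *\<^sub>R \<eta> u0" using that by (simp add: df)
    have Z: "?Z = 0" and s: "v$1 + v$2 = 0" using decomp_unique[OF u0 e] by blast+
    have "h u0 ?Z e1 = 0" "h u0 ?Z e2 = 0" "h u0 ?Z (n u0) = 0" unfolding Z by (simp_all add: simps)
    then have "r * (v$3 + v$4) = 0" "r * (v$3 - v$4) = 0" "2 * b * (v$1 - v$2) = 0"
      by (simp_all only: simps frame) (simp_all add: simps frame)
    then have "v$1 = 0 \<and> v$2 = 0 \<and> v$3 = 0 \<and> v$4 = 0" using s r b_pos by auto
    then show ?thesis by (simp add: vec_eq_iff forall_4)
  qed
  then have "inj \<Phi>" using linear_injective_0[OF lin] by blast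
  then obtain L where L: "linear L" "\<And>v. L (\<Phi> v) = v" "\<And>v. \<Phi> (L v) = v"
    using linear_injective_isomorphism[OF lin] by blast
  have "P 1 u0 = \<Phi> (axis 1 1)" "P (-1) u0 = \<Phi> (axis 2 1)" by (simp_all add: \<Phi>_def axis_def)
  then have LP: "L (P 1 u0) = axis 1 1" "L (P (-1) u0) = axis 2 1" using L(2) by metis+
  have "DD f u0 e1 = \<Phi> (r *\<^sub>R (axis 3 1 + axis 4 1))"
    by (simp add: \<Phi>_def axis_def df scaleR_add_right scaleR_diff_right scaleR_add_left[symmetric] r)
  then have Le1: "L (DD f u0 e1) = r *\<^sub>R (axis 3 1 + axis 4 1)" using L(2) by metis
  have "DD f u0 e2 = \<Phi> (r *\<^sub>R (axis 3 1 - axis 4 1))"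
    by (simp add: \<Phi>_def axis_def df scaleR_add_right scaleR_diff_right scaleR_add_left[symmetric] r)
  then have Le2: "L (DD f u0 e2) = r *\<^sub>R (axis 3 1 - axis 4 1)" using L(2) by metis
  have Llin: "linear (\<lambda>v. L v $ i)" for i
    by (rule linearI) (simp_all add: lins[OF L(1)])
  obtain c1 where c1: "\<And>u. u \<in> W \<Longrightarrow> L (f u - f u0) $ 1 - (L (f u - f u0) $ 3)\<^sup>2 / 2 = m u0 1 u / (8 * b\<^sup>2) + c1"
    using paraboloid_coordinate[OF u0 _ Llin[of 3] Llin[of 1] _ _ _ _ ad, of 1] by (auto simp: LP Le1 Le2 axis_def r_def)
  obtain c2 where c2: "\<And>u. u \<in> W \<Longrightarrow> L (f u - f u0) $ 2 - (L (f u - f u0) $ 4)\<^sup>2 / 2 = m u0 (-1) u / (8 * b\<^sup>2) + c2"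
    using paraboloid_coordinate[OF u0 _ Llin[of 4] Llin[of 2] _ _ _ _ ad, of "-1"] by (auto simp: LP Le1 Le2 axis_def r_def)
  \<comment> \<open>Scaling y by 8 b^2 and x by the square root of 8 b^2 multiplies y - x^2 / 2 by 8
    b^2, which clears the denominator of m.\<close>
  define d where "d i = (if i = 1 \<or> i = 2 then 8 * b\<^sup>2 else sqrt 8 * b)" for i :: 4
  have d0: "d i \<noteq> 0" for i using b_pos by (simp add: d_def)
  define D where "D v = (\<chi> i. d i * v $ i)" for v :: "real^4"
  define c :: "real^4" where "c = (\<chi> i. if i = 1 then 8 * b\<^sup>2 * c1 else if i = 2 then 8 * b\<^sup>2 * c2 else 0)"
  define T where "T x = D (L x) + (- D (L (f u0)) - c)" for x
  have linD: "linear D" unfolding D_def by (rule linearI) (simp_all add: vec_eq_iff algebra_simps)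
  have "bij (\<lambda>x. D (L x))"
  proof (rule bijI)
    show "inj (\<lambda>x. D (L x))"
    proof (rule injI)
      fix x y assume "D (L x) = D (L y)"
      then have "L x = L y" using d0 by (simp add: D_def vec_eq_iff)
      then show "x = y" using L(3) by metis
    qed
    have "D (L (\<Phi> (\<chi> i. y $ i / d i))) = y" for y using d0 by (simp add: L(2) D_def vec_eq_iff)
    then show "surj (\<lambda>x. D (L x))" by (rule surjI)
  qed
  moreover have "linear (\<lambda>x. D (L x))" using linear_compose[OF L(1) linD] by (simp add: o_def)
  ultimately have "affine_transformation T"
    unfolding affine_transformation_def T_def by blast
  moreover have "T (f u) \<in> model_hypersurface" if u: "u \<in> W" for u
  proof -
    have T: "T (f u) = D (L (f u - f u0)) - c"
      by (simp add: T_def linear_diff[OF L(1)] linear_diff[OF linD])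
    let ?y = "L (f u - f u0)"
    have "T (f u) $ 1 - 1/2 * (T (f u) $ 3)\<^sup>2 = 8 * b\<^sup>2 * (?y $ 1 - (?y $ 3)\<^sup>2 / 2 - c1)"
      by (simp add: T D_def d_def c_def power_mult_distrib algebra_simps)
    then have 1: "T (f u) $ 1 - 1/2 * (T (f u) $ 3)\<^sup>2 = m u0 1 u" using c1[OF u] b_pos by simp
    have "T (f u) $ 2 - 1/2 * (T (f u) $ 4)\<^sup>2 = 8 * b\<^sup>2 * (?y $ 2 - (?y $ 4)\<^sup>2 / 2 - c2)"
      by (simp add: T D_def d_def c_def power_mult_distrib algebra_simps)
    then have 2: "T (f u) $ 2 - 1/2 * (T (f u) $ 4)\<^sup>2 = m u0 (-1) u" using c2[OF u] b_pos by simp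
    show ?thesis unfolding model_hypersurface_def mem_Collect_eq 1 2 by (rule m_mult[OF u0 u])
  qed
  ultimately show ?thesis by blast
qed

section \<open>The model hypersurface\<close>

lemma det_4:
  "det (A :: 'a::comm_ring_1^4^4) =
     A$1$1 * (A$2$2 * (A$3$3 * A$4$4 - A$3$4 * A$4$3) - A$2$3 * (A$3$2 * A$4$4 - A$3$4 * A$4$2) + A$2$4 * (A$3$2 * A$4$3
         - A$3$3 * A$4$2))
   - A$1$2 * (A$2$1 * (A$3$3 * A$4$4 - A$3$4 * A$4$3) - A$2$3 * (A$3$1 * A$4$4 - A$3$4 * A$4$1) + A$2$4 * (A$3$1 * A$4$3
       - A$3$3 * A$4$1))
   + A$1$3 * (A$2$1 * (A$3$2 * A$4$4 - A$3$4 * A$4$2) - A$2$2 * (A$3$1 * A$4$4 - A$3$4 * A$4$1) + A$2$4 * (A$3$1 * A$4$2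
       - A$3$2 * A$4$1))
   - A$1$4 * (A$2$1 * (A$3$2 * A$4$3 - A$3$3 * A$4$2) - A$2$2 * (A$3$1 * A$4$3 - A$3$3 * A$4$1) + A$2$3 * (A$3$1 * A$4$2
       - A$3$2 * A$4$1))"
proof -
  have f1234: "finite {2::4, 3, 4}" "1 \<notin> {2::4, 3, 4}" by auto
  have f234: "finite {3::4, 4}" "2 \<notin> {3::4, 4}" by auto
  have f34: "finite {4::4}" "3 \<notin> {4::4}" by auto
  show ?thesis
    unfolding det_def UNIV_4
    unfolding sum_over_permutations_insert[OF f1234]
    unfolding sum_over_permutations_insert[OF f234]
    unfolding sum_over_permutations_insert[OF f34]
    unfolding permutes_sing
    by (simp add: sign_swap_id permutation_swap_id sign_compose sign_id permutation_compose algebra_simps)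
qed

lemma det_vector_linear:
  fixes L :: "real^4 \<Rightarrow> real^4"
  assumes "linear L"
  shows "det (vector [L a, L b, L c, L d] :: real^4^4) = det (vector [a, b, c, d] :: real^4^4) * det (matrix L)"
proof -
  have Lm: "L x $ i = (\<Sum>k\<in>UNIV. x $ k * matrix L $ i $ k)" for x i
    using linear_axis[OF assms, of x] by (simp add: matrix_def)
  have "(vector [L a, L b, L c, L d] :: real^4^4) = vector [a, b, c, d] ** transpose (matrix L)"
    by (simp add: vec_eq_iff forall_4 vector_4 matrix_matrix_mult_def transpose_def Lm)
  then show ?thesis by (simp add: det_mul det_transpose)
qed

section \<open>The affine structure of the model\<close>

locale model_patch = convex_hypersurface +
  fixes L :: "real^4 \<Rightarrow> real^4" and c :: "real^4"
  assumes lin_L: "linear L" and inj_L: "inj L"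
    and in_model: "u \<in> W \<Longrightarrow> L (f u) + c \<in> model_hypersurface"
    and volume: "u \<in> W \<Longrightarrow> orthonormal3 (h u) X1 X2 X3 \<Longrightarrow>
      \<bar>det (vector [DD f u X1, DD f u X2, DD f u X3, \<eta> u] :: real^4^4)\<bar> = 1"
begin

definition "y i u = (L (f u) + c) $ i"
definition "w i u X = L (DD f u X) $ i"
definition "e i u = L (\<eta> u) $ i"
definition "p u = y 1 u - (y 3 u)\<^sup>2 / 2"
definition "q u = y 2 u - (y 4 u)\<^sup>2 / 2"
definition "dp u X = w 1 u X - y 3 u * w 3 u X"
definition "dq u X = w 2 u X - y 4 u * w 4 u X"
text \<open>Since p q = 1, this is dp / p.\<close>

definition "\<tau> u X = q u * dp u X"
text \<open>\<open>2 \<alpha>\<close> is the differential of \<open>p q\<close> applied to the affine normal.\<close>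
definition "\<alpha> u = (q u * (e 1 u - y 3 u * e 3 u) + p u * (e 2 u - y 4 u * e 4 u)) / 2"

lemma bl: "bounded_linear (\<lambda>v. L v $ i)"
  using bounded_linear_compose[OF bounded_linear_vec_nth, of L i] lin_L by (simp add: linear_conv_bounded_linear)

lemma pq: "u \<in> W \<Longrightarrow> p u * q u = 1"
  using in_model[of u] by (simp add: model_hypersurface_def p_def q_def y_def)

lemma lin_w: "u \<in> W \<Longrightarrow> linear (w i u)"
  unfolding w_def using linear_compose[OF linear_df bounded_linear.linear[OF bl]] by (simp add: o_def)

lemmas w_simps = lins[OF lin_w]

lemma y_deriv: "u \<in> W \<Longrightarrow> (y i has_derivative w i u) (at u)"
proof -
  assume u: "u \<in> W"
  have "((\<lambda>u. L (f u) $ i + c $ i) has_derivative (\<lambda>X. L (DD f u X) $ i + 0)) (at u)"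
    by (rule has_derivative_add[OF bounded_linear.has_derivative[OF bl smooth_on_has_derivative[OF smooth_f u]]
        has_derivative_const])
  then show ?thesis by (simp add: y_def[abs_def] w_def[abs_def])
qed

lemma w_deriv: "u \<in> W \<Longrightarrow> ((\<lambda>v. w i v Y) has_derivative (\<lambda>X. w i u (Gam u X Y) + h u X Y * e i u)) (at u)"
proof -
  assume u: "u \<in> W"
  have "((\<lambda>v. L (DD f v Y) $ i) has_derivative (\<lambda>X. L (DD (\<lambda>v. DD f v Y) u X) $ i)) (at u)"
    by (rule bounded_linear.has_derivative[OF bl smooth_on_has_derivative[OF smooth_on_DD[OF smooth_f] u]])
  moreover have "L (DD (\<lambda>v. DD f v Y) u X) $ i = w i u (Gam u X Y) + h u X Y * e i u" for X
    using gauss[OF u, of X Y] by (simp add: second_derivative_def w_def e_def lins[OF lin_L])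
  ultimately show ?thesis by (simp add: w_def[abs_def])
qed

lemma e_deriv: "u \<in> W \<Longrightarrow> (e i has_derivative (\<lambda>X. - w i u (Sh u X))) (at u)"
proof -
  assume u: "u \<in> W"
  have "((\<lambda>v. L (\<eta> v) $ i) has_derivative (\<lambda>X. L (DD \<eta> u X) $ i)) (at u)"
    by (rule bounded_linear.has_derivative[OF bl smooth_on_has_derivative[OF smooth_eta u]])
  then show ?thesis by (simp add: e_def[abs_def] w_def weingarten[OF u] linear_neg[OF lin_L])
qed

lemma p_deriv: "u \<in> W \<Longrightarrow> (p has_derivative dp u) (at u)"
  and q_deriv: "u \<in> W \<Longrightarrow> (q has_derivative dq u) (at u)"
proof -
  assume u: "u \<in> W"
  have "((\<lambda>v. y i v - (y j v * y j v) / 2) has_derivative (\<lambda>X. w i u X - (y j u * w j u X + w j u X * y j u) / 2)) (at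
      u)" for i j
    by (rule has_derivative_diff[OF y_deriv[OF u] bounded_linear.has_derivative[OF bounded_linear_divide
        has_derivative_mult[OF y_deriv[OF u] y_deriv[OF u]]]])
  note d = this[of 1 3] this[of 2 4]
  show "(p has_derivative dp u) (at u)" "(q has_derivative dq u) (at u)"
    using d by (simp_all add: p_def[abs_def] q_def[abs_def] dp_def[abs_def] dq_def[abs_def] power2_eq_square mult.commute)
qed

lemma dpq: "u \<in> W \<Longrightarrow> q u * dp u X + p u * dq u X = 0"
proof -
  assume u: "u \<in> W"
  have "((\<lambda>v. p v * q v) has_derivative (\<lambda>X. p u * dq u X + dp u X * q u)) (at u)"
    by (rule has_derivative_mult[OF p_deriv[OF u] q_deriv[OF u]])
  moreover have "((\<lambda>v. p v * q v) has_derivative (\<lambda>X. 0)) (at u)"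
    by (rule has_derivative_transform_within_open[OF has_derivative_const[of 1] open_W u]) (simp add: pq)
  ultimately have "(\<lambda>X. p u * dq u X + dp u X * q u) = (\<lambda>X. 0)" by (rule has_derivative_unique)
  from fun_cong[OF this, of X] show ?thesis by (simp add: algebra_simps)
qed

lemma dp_tau: "u \<in> W \<Longrightarrow> dp u X = p u * \<tau> u X" and dq_tau: "u \<in> W \<Longrightarrow> dq u X = - q u * \<tau> u X"
proof -
  assume u: "u \<in> W"
  show "dp u X = p u * \<tau> u X" using pq[OF u] by (simp add: \<tau>_def mult.assoc[symmetric])
  have "q u * (q u * dp u X + p u * dq u X) = q u * q u * dp u X + (p u * q u) * dq u X" by (simp add: algebra_simps)
  then have "q u * q u * dp u X + dq u X = 0" using dpq[OF u, of X] pq[OF u] by simp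
  then show "dq u X = - q u * \<tau> u X" by (simp add: \<tau>_def eq_neg_iff_add_eq_0 add.commute mult.assoc)
qed

lemma dp_deriv: "u \<in> W \<Longrightarrow> ((\<lambda>v. dp v Y) has_derivative
     (\<lambda>X. dp u (Gam u X Y) + h u X Y * (e 1 u - y 3 u * e 3 u) - w 3 u X * w 3 u Y)) (at u)"
  and dq_deriv: "u \<in> W \<Longrightarrow> ((\<lambda>v. dq v Y) has_derivative
     (\<lambda>X. dq u (Gam u X Y) + h u X Y * (e 2 u - y 4 u * e 4 u) - w 4 u X * w 4 u Y)) (at u)"
proof -
  assume u: "u \<in> W"
  have d: "((\<lambda>v. w i v Y - y j v * w j v Y) has_derivative (\<lambda>X. (w i u (Gam u X Y) + h u X Y * e i u)
      - (y j u * (w j u (Gam u X Y) + h u X Y * e j u) + w j u X * w j u Y))) (at u)" for i j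
    by (rule has_derivative_diff[OF w_deriv[OF u] has_derivative_mult[OF y_deriv[OF u] w_deriv[OF u]]])
  show "((\<lambda>v. dp v Y) has_derivative (\<lambda>X. dp u (Gam u X Y) + h u X Y * (e 1 u - y 3 u * e 3 u) - w 3 u X * w 3 u Y)) (at u)"
    unfolding dp_def by (rule has_derivative_eq_rhs[OF d[of 1 3]]) (simp add: algebra_simps)
  show "((\<lambda>v. dq v Y) has_derivative (\<lambda>X. dq u (Gam u X Y) + h u X Y * (e 2 u - y 4 u * e 4 u) - w 4 u X * w 4 u Y)) (at u)"
    unfolding dq_def by (rule has_derivative_eq_rhs[OF d[of 2 4]]) (simp add: algebra_simps)
qed

text \<open>Differentiating q dp + p dq = 0 once more relates the second derivatives of the
  immersion to the Hessian of p q; the terms with \<open>Gam\<close> drop out by the first order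
  relation.\<close>

lemma alpha_h:
  assumes u: "u \<in> W"
  shows "\<alpha> u * h u X Y = q u / 2 * w 3 u X * w 3 u Y + p u / 2 * w 4 u X * w 4 u Y + \<tau> u X * \<tau> u Y"
proof -
  have "((\<lambda>v. q v * dp v Y + p v * dq v Y) has_derivative (\<lambda>X.
     (q u * (dp u (Gam u X Y) + h u X Y * (e 1 u - y 3 u * e 3 u) - w 3 u X * w 3 u Y) + dq u X * dp u Y) +
     (p u * (dq u (Gam u X Y) + h u X Y * (e 2 u - y 4 u * e 4 u) - w 4 u X * w 4 u Y) + dp u X * dq u Y))) (at u)"
    (is "(_ has_derivative ?D) _")
    by (intro has_derivative_add has_derivative_mult p_deriv[OF u] q_deriv[OF u] dp_deriv[OF u] dq_deriv[OF u])
  moreover have "((\<lambda>v. q v * dp v Y + p v * dq v Y) has_derivative (\<lambda>X. 0)) (at u)"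
    by (rule has_derivative_transform_within_open[OF has_derivative_const[of 0] open_W u]) (simp add: dpq)
  ultimately have "?D = (\<lambda>X. 0)" by (rule has_derivative_unique)
  moreover have "2 * \<alpha> u * h u X Y = (q u * (e 1 u - y 3 u * e 3 u) + p u * (e 2 u - y 4 u * e 4 u)) * h u X Y"
    by (simp add: \<alpha>_def)
  ultimately have "(q u * dp u (Gam u X Y) + p u * dq u (Gam u X Y)) + 2 * \<alpha> u * h u X Y - q u * w 3 u X * w 3 u Y - p u
      * w 4 u X * w 4 u Y
      + (dq u X * dp u Y + dp u X * dq u Y) = 0"
    using fun_cong[of ?D "\<lambda>X. 0" X] by (simp add: algebra_simps)
  moreover have "dq u X * dp u Y + dp u X * dq u Y = - 2 * (p u * q u) * (\<tau> u X * \<tau> u Y)"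
    by (simp add: dp_tau[OF u] dq_tau[OF u])
  ultimately show ?thesis by (simp add: dpq[OF u] pq[OF u])
qed

lemma lin_tau: "u \<in> W \<Longrightarrow> linear (\<tau> u)"
  unfolding \<tau>_def dp_def by (rule linearI) (simp_all add: w_simps algebra_simps)

lemma coframe_zero:
  assumes u: "u \<in> W" and z: "w 3 u X = 0" "w 4 u X = 0" "\<tau> u X = 0"
  shows "X = 0"
proof -
  have "dp u X = 0" "dq u X = 0" using dp_tau[OF u] dq_tau[OF u] z by simp_all
  then have "w 1 u X = 0" "w 2 u X = 0" using z by (simp_all add: dp_def dq_def)
  then have "L (DD f u X) = L 0" using z by (simp add: w_def vec_eq_iff forall_4 linear_0[OF lin_L])
  then have "DD f u X = DD f u 0" using inj_L by (simp add: inj_eq linear_0[OF linear_df[OF u]])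
  then show ?thesis using inj_df[OF u] by (simp add: inj_eq)
qed

lemma coframe_eqI:
  assumes u: "u \<in> W" and z: "w 3 u X = w 3 u Y" "w 4 u X = w 4 u Y" "\<tau> u X = \<tau> u Y"
  shows "X = Y"
  using coframe_zero[OF u, of "X - Y"] z by (simp add: w_simps[OF u] linear_diff[OF lin_tau[OF u]])

lemma coframe_ex:
  assumes u: "u \<in> W"
  shows "\<exists>X. w 3 u X = a \<and> w 4 u X = b' \<and> \<tau> u X = t"
proof -
  define M where "M X = (vector [w 3 u X, w 4 u X, \<tau> u X] :: real^3)" for X
  have lin: "linear M"
    unfolding M_def by (rule linearI) (simp_all add: vec_eq_iff forall_3 vector_3 w_simps[OF u] lins[OF lin_tau[OF u]])
  have "X = 0" if "M X = 0" for X
    using coframe_zero[OF u, of X] that by (simp add: M_def vec_eq_iff forall_3 vector_3)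
  then have "inj M" using linear_injective_0[OF lin] by blast
  then have "surj M" by (rule linear_injective_imp_surjective[OF lin]) simp
  then obtain X where "M X = vector [a, b', t]" by (metis surjD)
  then show ?thesis by (intro exI[of _ X]) (simp add: M_def vec_eq_iff forall_3 vector_3)
qed

text \<open>Positivity of h is tested in \<open>alpha_h\<close> on the vectors dual to the coframe:
  the one dual to \<tau> gives the sign of \<alpha>, the one dual to \<open>w 3\<close> then the
  sign of q, and p q = 1 that of p.\<close>

lemma signs:
  assumes u: "u \<in> W"
  shows "\<alpha> u > 0" "q u > 0" "p u > 0"
proof -
  have pos: "\<alpha> u * h u X X > 0 \<longleftrightarrow> \<alpha> u > 0" if "X \<noteq> 0" for X
    using convex[OF u that] by (simp add: zero_less_mult_iff)
  obtain X where X: "w 3 u X = 0 \<and> w 4 u X = 0 \<and> \<tau> u X = 1" using coframe_ex[OF u] by blast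
  then have "X \<noteq> 0" using linear_0[OF lin_tau[OF u]] by auto
  then show a: "\<alpha> u > 0" using pos[of X] X by (simp add: alpha_h[OF u])
  obtain X where X: "w 3 u X = 1 \<and> w 4 u X = 0 \<and> \<tau> u X = 0" using coframe_ex[OF u] by blast
  then have "X \<noteq> 0" using linear_0[OF lin_w[OF u, of 3]] by auto
  then show q: "q u > 0" using pos[of X] X a by (simp add: alpha_h[OF u])
  show "p u > 0" using pq[OF u] q by (metis zero_less_mult_pos2 zero_less_one)
qed

lemma model_frame:
  assumes u: "u \<in> W"
  obtains a1 a2 a3 where "orthonormal3 (h u) a1 a2 a3"
    "w 3 u a1 = sqrt (2 * \<alpha> u / q u)" "w 4 u a1 = 0" "\<tau> u a1 = 0"
    "w 3 u a2 = 0" "w 4 u a2 = sqrt (2 * \<alpha> u / p u)" "\<tau> u a2 = 0"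
    "w 3 u a3 = 0" "w 4 u a3 = 0" "\<tau> u a3 = sqrt (\<alpha> u)"
proof -
  note sg = signs[OF u]
  obtain a1 where a1: "w 3 u a1 = sqrt (2 * \<alpha> u / q u)" "w 4 u a1 = 0" "\<tau> u a1 = 0" using coframe_ex[OF u] by blast
  obtain a2 where a2: "w 3 u a2 = 0" "w 4 u a2 = sqrt (2 * \<alpha> u / p u)" "\<tau> u a2 = 0" using coframe_ex[OF u] by blast
  obtain a3 where a3: "w 3 u a3 = 0" "w 4 u a3 = 0" "\<tau> u a3 = sqrt (\<alpha> u)" using coframe_ex[OF u] by blast
  have h: "h u X Y = (q u / 2 * w 3 u X * w 3 u Y + p u / 2 * w 4 u X * w 4 u Y + \<tau> u X * \<tau> u Y) / \<alpha> u" for X Y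
    using alpha_h[OF u, of X Y] sg by (simp add: field_simps)
  have s: "sqrt (2 * \<alpha> u / q u) * sqrt (2 * \<alpha> u / q u) = 2 * \<alpha> u / q u"
      "sqrt (2 * \<alpha> u / p u) * sqrt (2 * \<alpha> u / p u) = 2 * \<alpha> u / p u"
    "sqrt (\<alpha> u) * sqrt (\<alpha> u) = \<alpha> u"
    using sg by simp_all
  have "orthonormal3 (h u) a1 a2 a3"
    unfolding orthonormal3_def h a1 a2 a3 mult.assoc s using sg by simp
  then show ?thesis using that a1 a2 a3 by blast
qed

text \<open>In the orthonormal frame of \<open>model_frame\<close> the transformed determinant is r
  s t times 2 \<alpha>, with r^2 s^2 = 4 \<alpha>^2 and t^2 = \<alpha>. The volume condition makes
  its absolute value that of det L, which does not depend on the point.\<close>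

lemma alpha_power:
  assumes u: "u \<in> W"
  shows "16 * \<alpha> u ^ 5 = (det (matrix L))\<^sup>2"
proof -
  note sg = signs[OF u]
  obtain a1 a2 a3 where fr: "orthonormal3 (h u) a1 a2 a3"
    and a: "w 3 u a1 = sqrt (2 * \<alpha> u / q u)" "w 4 u a1 = 0" "\<tau> u a1 = 0"
    "w 3 u a2 = 0" "w 4 u a2 = sqrt (2 * \<alpha> u / p u)" "\<tau> u a2 = 0"
    "w 3 u a3 = 0" "w 4 u a3 = 0" "\<tau> u a3 = sqrt (\<alpha> u)"
    using model_frame[OF u] by blast
  define r s t where "r = sqrt (2 * \<alpha> u / q u)" and "s = sqrt (2 * \<alpha> u / p u)" and "t = sqrt (\<alpha> u)"
  note a = a[folded r_def s_def t_def]
  have w12: "w 1 u X = p u * \<tau> u X + y 3 u * w 3 u X" "w 2 u X = - q u * \<tau> u X + y 4 u * w 4 u X" for X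
    using dp_tau[OF u, of X] dq_tau[OF u, of X] by (simp_all add: dp_def dq_def)
  let ?D = "det (vector [L (DD f u a1), L (DD f u a2), L (DD f u a3), L (\<eta> u)] :: real^4^4)"
  have "?D = r * s * t * (2 * \<alpha> u)"
    unfolding det_4 vector_4 w_def[symmetric] e_def[symmetric] w12 a \<alpha>_def
    by (simp add: algebra_simps)
  moreover have "\<bar>?D\<bar> = \<bar>det (matrix L)\<bar>"
    using volume[OF u fr] by (simp add: det_vector_linear[OF lin_L] abs_mult)
  ultimately have "(r * s * t * (2 * \<alpha> u))\<^sup>2 = (det (matrix L))\<^sup>2" by (metis power2_abs)
  moreover have "(r * s * t * (2 * \<alpha> u))\<^sup>2 = r\<^sup>2 * s\<^sup>2 * t\<^sup>2 * (4 * (\<alpha> u)\<^sup>2)" by (simp add: power_mult_distrib)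
  moreover have rs: "r\<^sup>2 * s\<^sup>2 = 4 * \<alpha> u * \<alpha> u" and t2: "t\<^sup>2 = \<alpha> u"
  proof -
    have "r\<^sup>2 = 2 * \<alpha> u / q u" "s\<^sup>2 = 2 * \<alpha> u / p u" using sg by (simp_all add: r_def s_def)
    then have "r\<^sup>2 * s\<^sup>2 = 4 * \<alpha> u * \<alpha> u / (p u * q u)" by (simp add: mult_ac)
    then show "r\<^sup>2 * s\<^sup>2 = 4 * \<alpha> u * \<alpha> u" by (simp add: pq[OF u])
    show "t\<^sup>2 = \<alpha> u" using sg by (simp add: t_def)
  qed
  moreover have "16 * \<alpha> u ^ 5 = (4 * \<alpha> u * \<alpha> u) * \<alpha> u * (4 * (\<alpha> u)\<^sup>2)"
    by (simp add: eval_nat_numeral)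
  ultimately show ?thesis by simp
qed

lemma alpha_const: "u \<in> W \<Longrightarrow> v \<in> W \<Longrightarrow> \<alpha> u = \<alpha> v"
proof -
  assume u: "u \<in> W" and v: "v \<in> W"
  have "\<alpha> u ^ 5 = \<alpha> v ^ 5" using alpha_power[OF u] alpha_power[OF v] by simp
  then show ?thesis
    by (rule power_eq_imp_eq_base) (use signs(1)[OF u] signs(1)[OF v] in auto)
qed

text \<open>Since \<open>\<alpha>\<close> is constant and \<open>\<eta>\<close> has tangential derivatives, \<open>\<eta>\<close> is \<open>\<alpha>\<close> times the model normal.\<close>
lemma normal_eq:
  assumes u: "u \<in> W"
  shows "e 3 u = 0" "e 4 u = 0" "e 1 u = \<alpha> u * p u" "e 2 u = \<alpha> u * q u"
proof -
  note sg = signs[OF u]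
  define E1 E2 where "E1 = e 1 u - y 3 u * e 3 u" and "E2 = e 2 u - y 4 u * e 4 u"
  have dE: "((\<lambda>v. e i v - y j v * e j v) has_derivative (\<lambda>X. - w i u (Sh u X) - (y j u * - w j u (Sh u X) + w j u X * e
      j u))) (at u)" for i j
    by (rule has_derivative_diff[OF e_deriv[OF u] has_derivative_mult[OF y_deriv[OF u] e_deriv[OF u]]])
  have "(\<alpha> has_derivative (\<lambda>X. ((q u * (- w 1 u (Sh u X) - (y 3 u * - w 3 u (Sh u X) + w 3 u X * e 3 u)) + dq u X * E1) +
     (p u * (- w 2 u (Sh u X) - (y 4 u * - w 4 u (Sh u X) + w 4 u X * e 4 u)) + dp u X * E2)) / 2)) (at u)"
    (is "(_ has_derivative ?D) _")
    unfolding \<alpha>_def[abs_def] E1_def E2_def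
    by (rule bounded_linear.has_derivative[OF bounded_linear_divide has_derivative_add[OF
       has_derivative_mult[OF q_deriv[OF u] dE] has_derivative_mult[OF p_deriv[OF u] dE]]])
  moreover have "(\<alpha> has_derivative (\<lambda>X. 0)) (at u)"
    by (rule has_derivative_transform_within_open[OF has_derivative_const[of "\<alpha> u"] open_W u]) (rule alpha_const[OF u])
  ultimately have "?D = (\<lambda>X. 0)" by (rule has_derivative_unique)
  then have D: "?D X = 0" for X by (rule fun_cong)
  \<comment> \<open>In the derivative of the constant \<alpha> the terms with \<open>Sh u X\<close>
    combine to a multiple of d(p q), which vanishes. The rest is tested on the vectors dual to the
    coframe.\<close>
  have z: "q u * (\<tau> u X * E1) + q u * (w 3 u X * e 3 u) + p u * (w 4 u X * e 4 u) = p u * (\<tau> u X * E2)" for X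
  proof -
    have "q u * dp u (Sh u X) + p u * dq u (Sh u X) = 0" by (rule dpq[OF u])
    then show ?thesis using D[of X] by (simp add: dp_tau[OF u, of X] dq_tau[OF u, of X]) (simp add: dp_def dq_def
        algebra_simps)
  qed
  obtain X where X: "w 3 u X = 1 \<and> w 4 u X = 0 \<and> \<tau> u X = 0" using coframe_ex[OF u] by blast
  show e3: "e 3 u = 0" using z[of X] X sg by simp
  obtain X where X: "w 3 u X = 0 \<and> w 4 u X = 1 \<and> \<tau> u X = 0" using coframe_ex[OF u] by blast
  show e4: "e 4 u = 0" using z[of X] X sg by simp
  obtain X where X: "w 3 u X = 0 \<and> w 4 u X = 0 \<and> \<tau> u X = 1" using coframe_ex[OF u] by blast
  have eq: "q u * e 1 u = p u * e 2 u" using z[of X] X by (simp add: E1_def E2_def e3 e4)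
  then have 1: "\<alpha> u = q u * e 1 u" "\<alpha> u = p u * e 2 u" by (simp_all add: \<alpha>_def e3 e4)
  have "\<alpha> u * p u = (p u * q u) * e 1 u" unfolding 1(1) by (simp add: mult_ac)
  then show "e 1 u = \<alpha> u * p u" by (simp add: pq[OF u])
  have "\<alpha> u * q u = (p u * q u) * e 2 u" unfolding 1(2) by (simp add: mult_ac)
  then show "e 2 u = \<alpha> u * q u" by (simp add: pq[OF u])
qed

lemma shape_coframe:
  assumes u: "u \<in> W"
  shows "w 3 u (Sh u X) = 0" "w 4 u (Sh u X) = 0" "\<tau> u (Sh u X) = - \<alpha> u * \<tau> u X"
proof -
  have 0: "w i u (Sh u X) = 0" if z: "\<And>v. v \<in> W \<Longrightarrow> e i v = 0" for i X
  proof -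
    have "(e i has_derivative (\<lambda>X. 0)) (at u)"
      by (rule has_derivative_transform_within_open[OF has_derivative_const[of 0] open_W u]) (simp add: z)
    from has_derivative_unique[OF e_deriv[OF u] this] have "(\<lambda>X. - w i u (Sh u X)) = (\<lambda>X. 0)" .
    from fun_cong[OF this, of X] show ?thesis by simp
  qed
  show 3: "w 3 u (Sh u X) = 0" and 4: "w 4 u (Sh u X) = 0" using 0 normal_eq(1,2) by blast+
  have "(e 1 has_derivative (\<lambda>X. \<alpha> u * dp u X)) (at u)"
  proof (rule has_derivative_transform_within_open[OF has_derivative_mult_right[OF p_deriv[OF u]] open_W u])
    show "\<alpha> u * p v = e 1 v" if "v \<in> W" for v using normal_eq(3)[OF that] alpha_const[OF u that] by simp
  qed
  from has_derivative_unique[OF e_deriv[OF u] this] have "(\<lambda>X. - w 1 u (Sh u X)) = (\<lambda>X. \<alpha> u * dp u X)" .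
  from fun_cong[OF this, of X] have "w 1 u (Sh u X) = - \<alpha> u * dp u X" by simp
  then have "dp u (Sh u X) = - \<alpha> u * dp u X" by (simp add: dp_def[of u "Sh u X"] 3)
  then show "\<tau> u (Sh u X) = - \<alpha> u * \<tau> u X" by (simp add: \<tau>_def)
qed

text \<open>By \<open>difference_tensor_char\<close> the left hand side is minus \<alpha> times the
  covariant derivative of h, and \<open>alpha_h\<close> expresses \<alpha> h in the coframe. The
  forms \<open>w 3\<close> and \<open>w 4\<close> are parallel since \<open>e 3\<close> and
  \<open>e 4\<close> vanish, dp = p \<tau> and dq = -q \<tau>, and the derivative of \<tau> is found
  in \<open>dt'\<close>.\<close>

lemma cubic_form:
  assumes u: "u \<in> W"
  shows "2 * \<alpha> u * h u (K u X Y) Z =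
     q u / 2 * (\<tau> u X * w 3 u Y * w 3 u Z + \<tau> u Y * w 3 u X * w 3 u Z + \<tau> u Z * w 3 u X * w 3 u Y)
   - p u / 2 * (\<tau> u X * w 4 u Y * w 4 u Z + \<tau> u Y * w 4 u X * w 4 u Z + \<tau> u Z * w 4 u X * w 4 u Y)"
proof -
  note nm = normal_eq[OF u]
  have dw: "((\<lambda>v. w i v Y) has_derivative (\<lambda>X. w i u (Gam u X Y))) (at u)" if "i = 3 \<or> i = 4" for i Y
    using w_deriv[OF u, of i Y] that nm by auto
  have dt: "((\<lambda>v. \<tau> v Y) has_derivative (\<lambda>X. q u * (dp u (Gam u X Y) + h u X Y * (e 1 u - y 3 u * e 3 u) - w 3 u X * w 3
      u Y) + dq u X * dp u Y)) (at u)" for Y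
    unfolding \<tau>_def by (rule has_derivative_mult[OF q_deriv[OF u] dp_deriv[OF u]])
  have dt': "((\<lambda>v. \<tau> v Y) has_derivative (\<lambda>X. \<tau> u (Gam u X Y) + (p u / 2 * w 4 u X * w 4 u Y - q u / 2 * w 3 u X * w 3 u
      Y))) (at u)" for Y
  proof (rule has_derivative_eq_rhs[OF dt], rule ext)
    fix X
    have "q u * (dp u (Gam u X Y) + h u X Y * (e 1 u - y 3 u * e 3 u) - w 3 u X * w 3 u Y) + dq u X * dp u Y
      = \<tau> u (Gam u X Y) + (p u * q u) * (\<alpha> u * h u X Y) - q u * w 3 u X * w 3 u Y - (p u * q u) * (\<tau> u X * \<tau> u Y)"
      by (simp add: nm dp_tau[OF u, of Y] dq_tau[OF u, of X] \<tau>_def[of u "Gam u X Y"] algebra_simps)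
    also have "\<dots> = \<tau> u (Gam u X Y) + (p u / 2 * w 4 u X * w 4 u Y - q u / 2 * w 3 u X * w 3 u Y)"
      unfolding pq[OF u] alpha_h[OF u] by (simp add: algebra_simps)
    finally show "q u * (dp u (Gam u X Y) + h u X Y * (e 1 u - y 3 u * e 3 u) - w 3 u X * w 3 u Y) + dq u X * dp u Y
      = \<tau> u (Gam u X Y) + (p u / 2 * w 4 u X * w 4 u Y - q u / 2 * w 3 u X * w 3 u Y)" .
  qed
  note dh = has_derivative_add[OF has_derivative_add[OF
      has_derivative_mult[OF q_deriv[OF u] has_derivative_mult[OF dw[of 3 Y] dw[of 3 Z]]]
      has_derivative_mult[OF p_deriv[OF u] has_derivative_mult[OF dw[of 4 Y] dw[of 4 Z]]]]
      has_derivative_mult_right[OF has_derivative_mult[OF dt'[of Y] dt'[of Z]], of 2]]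
  have "((\<lambda>v. 2 * \<alpha> u * h v Y Z) has_derivative (\<lambda>X. 2 * \<alpha> u * DD (\<lambda>v. h v Y Z) u X)) (at u)"
    by (rule has_derivative_mult_right[OF smooth_on_has_derivative[OF smooth_h u]])
  moreover have "2 * \<alpha> u * h v Y Z = q v * (w 3 v Y * w 3 v Z) + p v * (w 4 v Y * w 4 v Z) + 2 * (\<tau> v Y * \<tau> v Z)" if v:
      "v \<in> W" for v
    using alpha_h[OF v, of Y Z] alpha_const[OF u v] by (simp add: algebra_simps)
  ultimately have "((\<lambda>v. q v * (w 3 v Y * w 3 v Z) + p v * (w 4 v Y * w 4 v Z) + 2 * (\<tau> v Y * \<tau> v Z)) has_derivative
      (\<lambda>X. 2 * \<alpha> u * DD (\<lambda>v. h v Y Z) u X)) (at u)"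
    by (rule has_derivative_transform_within_open[OF _ open_W u])
  from fun_cong[OF has_derivative_unique[OF this dh], of X]
  have Dh: "2 * \<alpha> u * DD (\<lambda>v. h v Y Z) u X =
     q u * (w 3 u Y * w 3 u (Gam u X Z) + w 3 u (Gam u X Y) * w 3 u Z) + dq u X * (w 3 u Y * w 3 u Z) +
     (p u * (w 4 u Y * w 4 u (Gam u X Z) + w 4 u (Gam u X Y) * w 4 u Z) + dp u X * (w 4 u Y * w 4 u Z)) +
     2 * (\<tau> u Y * (\<tau> u (Gam u X Z) + (p u / 2 * w 4 u X * w 4 u Z - q u / 2 * w 3 u X * w 3 u Z)) +
      (\<tau> u (Gam u X Y) + (p u / 2 * w 4 u X * w 4 u Y - q u / 2 * w 3 u X * w 3 u Y)) * \<tau> u Z)"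
    by simp
  have "2 * \<alpha> u * h u (K u X Y) Z = - 1/2 * (2 * \<alpha> u * DD (\<lambda>v. h v Y Z) u X) + \<alpha> u * h u (Gam u X Y) Z + \<alpha> u * h u Y
      (Gam u X Z)"
    unfolding difference_tensor_char[OF u] by (simp add: algebra_simps)
  then show ?thesis
    unfolding Dh alpha_h[OF u] dp_tau[OF u] dq_tau[OF u] by (simp add: algebra_simps)
qed

text \<open>In the frame of \<open>model_frame\<close> the cubic form is a multiple of x3 (x1^2 -
  x2^2). Passing to the diagonals of the first two axes turns it into the product form of an adapted
  frame, with b = sqrt \<alpha> / 2 and eigenvalues 0, 0, -4 b^2.\<close>

lemma model_symmetry:
  assumes u: "u \<in> W"
  shows "\<exists>e1 e2 e3. orthonormal3 (h u) e1 e2 e3 \<and>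
    symmetry_group (h u) (K u) (Sh u) = {id, half_turn (h u) e1, half_turn (h u) e2, half_turn (h u) e3}"
proof -
  note sg = signs[OF u]
  obtain a1 a2 a3 where fr: "orthonormal3 (h u) a1 a2 a3"
    and a: "w 3 u a1 = sqrt (2 * \<alpha> u / q u)" "w 4 u a1 = 0" "\<tau> u a1 = 0"
    "w 3 u a2 = 0" "w 4 u a2 = sqrt (2 * \<alpha> u / p u)" "\<tau> u a2 = 0"
    "w 3 u a3 = 0" "w 4 u a3 = 0" "\<tau> u a3 = sqrt (\<alpha> u)"
    using model_frame[OF u] by blast
  interpret A: pos_frame "h u" a1 a2 a3
    using pos_form_h[OF u] fr by (simp add: pos_frame_def pos_frame_axioms_def)
  define r where "r = 1 / sqrt (2::real)"
  have r: "r * r = 1 / 2" by (simp add: r_def)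
  have r2: "r * (2 * r) = 1" using r by simp
  have rx: "r * (r * x) = x / 2" for x by (simp add: mult.assoc[symmetric] r)
  define q1 q2 where "q1 = r *\<^sub>R (a1 + a2)" and "q2 = r *\<^sub>R (a1 - a2)"
  define s t where "s = sqrt (\<alpha> u / q u)" and "t = sqrt (\<alpha> u / p u)"
  have rs: "r * sqrt (2 * \<alpha> u / q u) = s" "r * sqrt (2 * \<alpha> u / p u) = t"
    by (simp_all add: r_def s_def t_def real_sqrt_mult real_sqrt_divide)
  have st: "q u * (s * s) = \<alpha> u" "p u * (t * t) = \<alpha> u" using sg by (simp_all add: s_def t_def)
  have ons: "orthonormal3 (h u) q1 q2 a3"
    by (simp add: orthonormal3_def q1_def q2_def A.simps A.frame rx r2)
  interpret Q: pos_frame "h u" q1 q2 a3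
    using pos_form_h[OF u] ons by (simp add: pos_frame_def pos_frame_axioms_def)
  have c: "w 3 u q1 = s" "w 4 u q1 = t" "\<tau> u q1 = 0" "w 3 u q2 = s" "w 4 u q2 = - t" "\<tau> u q2 = 0"
    by (simp_all add: q1_def q2_def w_simps[OF u] a lins[OF lin_tau[OF u]] rs)
  define b where "b = sqrt (\<alpha> u) / 2"
  have bne: "b \<noteq> 0" using sg by (simp add: b_def)
  have C: "h u (K u X Y) Z =
     (q u / 2 * (\<tau> u X * w 3 u Y * w 3 u Z + \<tau> u Y * w 3 u X * w 3 u Z + \<tau> u Z * w 3 u X * w 3 u Y)
   - p u / 2 * (\<tau> u X * w 4 u Y * w 4 u Z + \<tau> u Y * w 4 u X * w 4 u Z + \<tau> u Z * w 4 u X * w 4 u Y)) / (2 * \<alpha> u)" for X Y Z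
    using cubic_form[OF u, of X Y Z] sg by (simp add: field_simps)
  have st0: "s \<noteq> 0" "t \<noteq> 0" using sg by (simp_all add: s_def t_def)
  have qp: "q u = \<alpha> u / (s * s)" "p u = \<alpha> u / (t * t)" using st st0 by (simp_all add: field_simps)
  have Kq: "K u q1 q1 = 0" "K u q2 q2 = 0" "K u a3 a3 = 0" "K u q1 q2 = b *\<^sub>R a3" "K u q2 a3 = b *\<^sub>R q1"
      "K u a3 q1 = b *\<^sub>R q2"
    using sg by (intro Q.eq_frameI; simp add: C c a A.simps Q.frame b_def qp st0)+
  have Sq: "Sh u q1 = 0" "Sh u q2 = 0" "Sh u a3 = (- \<alpha> u) *\<^sub>R a3"
    by (rule coframe_eqI[OF u]; simp add: shape_coframe[OF u] c a w_simps[OF u] lins[OF lin_tau[OF u]])+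
  have "adapted (h u) (K u) (Sh u) q1 q2 a3 b 0 0 (- \<alpha> u)"
    unfolding adapted_def by (simp add: ons Kq Sq)
  then have "adapted_frame (h u) (K u) (Sh u) q1 q2 a3 b 0 0 (- \<alpha> u)"
    by (intro adapted_frame.intro pos_form_h u adapted_frame_axioms.intro sym_K linear_K linear_Sh)
  then have "symmetry_group (h u) (K u) (Sh u) = {id, half_turn (h u) q1, half_turn (h u) q2, half_turn (h u) a3}"
    by (rule adapted_frame.symmetry_group_eq) (use bne sg in auto)
  then show ?thesis using ons by blast
qed

end

section \<open>The classification\<close>

lemma chart_convex_hypersurface:
  assumes "smooth_atlas A" "affine_hypersurface A F \<xi>" "locally_strictly_convex A F \<xi>" "c \<in> A"
  shows "convex_hypersurface (chart_image c) (in_chart c F) (in_chart c \<xi>)"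
proof (rule convex_hypersurface.intro)
  have im: "immersion A F" and an: "affine_normal A F \<xi>" using assms(2) by (auto simp: affine_hypersurface_def)
  show "open (chart_image c)" using assms(1,4) by (auto simp: smooth_atlas_def)
  show "smooth_on (chart_image c) (in_chart c F)" using im assms(4) by (auto simp: immersion_def smooth_map_def)
  show "smooth_on (chart_image c) (in_chart c \<xi>)" using an assms(4) by (auto simp: affine_normal_def smooth_map_def)
  fix u assume u: "u \<in> chart_image c"
  show "inj (DD (in_chart c F) u)" using im assms(4) u by (auto simp: immersion_def)
  show "in_chart c \<xi> u \<notin> range (DD (in_chart c F) u)" "DD (in_chart c \<xi>) u X \<in> range (DD (in_chart c F) u)" for X
    using an assms(4) u by (auto simp: affine_normal_def Let_def)
  show "X \<noteq> 0 \<Longrightarrow> 0 < affine_metric (in_chart c F) (in_chart c \<xi>) u X X" for X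
    using assms(3,4) u by (auto simp: locally_strictly_convex_def)
qed

lemma chart_inverse:
  assumes "smooth_atlas A" "c \<in> A"
  shows "inj_on (snd c) (fst c)" "continuous_on (fst c) (snd c)" "open (fst c)"
    and open_chart_transfer: "open U \<Longrightarrow> open (snd c ` (U \<inter> fst c))"
proof -
  obtain \<psi> where \<psi>: "homeomorphism (fst c) (chart_image c) (snd c) \<psi>" and o: "open (fst c)" "open (chart_image c)"
    using assms by (auto simp: smooth_atlas_def)
  show "inj_on (snd c) (fst c)" using \<psi> by (metis homeomorphism_apply1 inj_on_inverseI)
  show "continuous_on (fst c) (snd c)" using \<psi> by (simp add: homeomorphism_def)
  show "open (fst c)" by (rule o)
  assume "open U"
  then have "openin (top_of_set (fst c)) (U \<inter> fst c)" by (metis openin_open Int_commute)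
  from homeomorphism_imp_open_map[OF \<psi> this] show "open (snd c ` (U \<inter> fst c))"
    using o(2) openin_open_trans by blast
qed

lemma in_chart_apply:
  assumes "smooth_atlas A" "c \<in> A" "x \<in> fst c"
  shows "in_chart c G (snd c x) = G x"
  using inv_into_f_f[OF chart_inverse(1)[OF assms(1,2)] assms(3)] by (simp add: in_chart_def)

lemma symmetry_imp_model:
  fixes A :: "'m::{t2_space, second_countable_topology} chart set"
  assumes at: "smooth_atlas A" and hyp: "affine_hypersurface A F \<xi>" "locally_strictly_convex A F \<xi>"
    and sym: "pointwise_Z2xZ2_symmetry A F \<xi>"
  shows "locally_affine_equivalent_to A F model_hypersurface"
  unfolding locally_affine_equivalent_to_def
proof
  fix p assume p: "p \<in> manifold_points A"
  then obtain c where c: "c \<in> A" "p \<in> fst c" by (auto simp: manifold_points_def)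
  let ?f = "in_chart c F" and ?\<eta> = "in_chart c \<xi>"
  interpret convex_hypersurface "chart_image c" ?f ?\<eta>
    by (rule chart_convex_hypersurface[OF at hyp c(1)])
  have u0: "snd c p \<in> chart_image c" using c(2) by (simp add: chart_image_def)
  then obtain r0 where r0: "r0 > 0" "ball (snd c p) r0 \<subseteq> chart_image c" using open_W openE by blast
  \<comment> \<open>A ball inside the chart image is convex, so identities can be carried along
    segments from a base point.\<close>
  interpret B: adapted_hypersurface "ball (snd c p) r0" ?f ?\<eta>
  proof (rule adapted_hypersurface.intro[OF convex_hypersurface_subset[OF convex_hypersurface_axioms open_ball r0(2)]
      adapted_hypersurface_axioms.intro[OF convex_ball]])
    fix u assume "u \<in> ball (snd c p) r0"
    then have u: "u \<in> chart_image c" using r0(2) by blast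
    then obtain x where x: "x \<in> fst c" "u = snd c x" by (auto simp: chart_image_def)
    then have "x \<in> manifold_points A" using c(1) by (auto simp: manifold_points_def)
    then obtain e1 e2 e3 where on: "orthonormal3 (h u) e1 e2 e3"
      and gr: "symmetry_group (h u) (K u) (Sh u) = {id, half_turn (h u) e1, half_turn (h u) e2, half_turn (h u) e3}"
      using sym c(1) x unfolding pointwise_Z2xZ2_symmetry_def Let_def by blast
    obtain b l1 l2 l3 where ad: "adapted (h u) (K u) (Sh u) e1 e2 e3 b l1 l2 l3"
      using adapted_of_half_turns[OF pos_form_h[OF u] sym_K[OF u] cubic_sym[OF u] linear_K[OF u] linear_Sh[OF u] on] gr
          by blast
    interpret adapted_frame "h u" "K u" "Sh u" e1 e2 e3 b l1 l2 l3
      by (intro adapted_frame.intro pos_form_h u adapted_frame_axioms.intro sym_K linear_K linear_Sh ad)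
    show "\<exists>e1 e2 e3 b l1 l2 l3. adapted (h u) (K u) (Sh u) e1 e2 e3 b l1 l2 l3 \<and> \<not> (l1 = l2 \<and> l2 = l3)"
      using ad symmetry_group_ne gr by blast
  qed
  have "snd c p \<in> ball (snd c p) r0" using r0(1) by simp
  then obtain r n b lam where r: "r > 0" "ball (snd c p) r \<subseteq> ball (snd c p) r0"
    and sp: "special_hypersurface (ball (snd c p) r) ?f ?\<eta> n b lam"
    using B.special_ball by blast
  obtain T where T: "affine_transformation T" "T ` ?f ` ball (snd c p) r \<subseteq> model_hypersurface"
    using special_hypersurface.special_in_model[OF sp, of "snd c p"] r(1) by auto
  let ?U = "fst c \<inter> snd c -` ball (snd c p) r"
  have "open ?U"
    by (rule continuous_open_preimage[OF chart_inverse(2,3)[OF at c(1)] open_ball])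
  moreover have "p \<in> ?U" using c(2) r(1) by simp
  moreover have "?U \<subseteq> manifold_points A" using c(1) by (auto simp: manifold_points_def)
  moreover have "T ` F ` ?U \<subseteq> model_hypersurface"
  proof -
    have "F x = ?f (snd c x)" if "x \<in> ?U" for x using in_chart_apply[OF at c(1), of x F] that by simp
    then have "F ` ?U \<subseteq> ?f ` ball (snd c p) r" by force
    then show ?thesis using T(2) by blast
  qed
  ultimately show "\<exists>U T. open U \<and> p \<in> U \<and> U \<subseteq> manifold_points A \<and> affine_transformation T \<and> T ` F ` U \<subseteq> model_hypersurface"
    using T(1) by blast
qed

lemma model_imp_symmetry:
  fixes A :: "'m::{t2_space, second_countable_topology} chart set"
  assumes at: "smooth_atlas A" and hyp: "affine_hypersurface A F \<xi>" "locally_strictly_convex A F \<xi>"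
    and eq: "locally_affine_equivalent_to A F model_hypersurface"
  shows "pointwise_Z2xZ2_symmetry A F \<xi>"
  unfolding pointwise_Z2xZ2_symmetry_def Let_def
proof (intro ballI impI)
  fix p c assume p: "p \<in> manifold_points A" and c: "c \<in> A" "p \<in> fst c"
  let ?f = "in_chart c F" and ?\<eta> = "in_chart c \<xi>"
  interpret convex_hypersurface "chart_image c" ?f ?\<eta>
    by (rule chart_convex_hypersurface[OF at hyp c(1)])
  obtain U T where U: "open U" "p \<in> U" "affine_transformation T" "T ` F ` U \<subseteq> model_hypersurface"
    using eq p unfolding locally_affine_equivalent_to_def by blast
  obtain L d where L: "linear L" "bij L" "T = (\<lambda>x. L x + d)"
    using U(3) unfolding affine_transformation_def by blast
  let ?V = "snd c ` (U \<inter> fst c)"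
  have sub: "?V \<subseteq> chart_image c" by (auto simp: chart_image_def)
  have an: "affine_normal A F \<xi>" using hyp(1) by (simp add: affine_hypersurface_def)
  have "model_patch ?V ?f ?\<eta> L d"
  proof (rule model_patch.intro[OF convex_hypersurface_subset[OF convex_hypersurface_axioms open_chart_transfer[OF at
      c(1) U(1)] sub] model_patch_axioms.intro])
    show "linear L" "inj L" using L(1) bij_is_inj[OF L(2)] by blast+
    fix u assume u: "u \<in> ?V"
    then obtain x where x: "x \<in> U" "x \<in> fst c" "u = snd c x" by blast
    have "T (F x) \<in> model_hypersurface" using U(4) x(1) by blast
    then show "L (?f u) + d \<in> model_hypersurface" using in_chart_apply[OF at c(1) x(2), of F] by (simp add: L(3) x(3))
    have "u \<in> chart_image c" using u sub by blast
    then show "orthonormal3 (h u) X1 X2 X3 \<Longrightarrow> \<bar>det (vector [DD ?f u X1, DD ?f u X2, DD ?f u X3, ?\<eta> u] :: real^4^4)\<bar> = 1"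
        for X1 X2 X3
      using an c(1) unfolding affine_normal_def Let_def by blast
  qed
  from model_patch.model_symmetry[OF this, of "snd c p"]
  show "\<exists>e1 e2 e3. orthonormal3 (h (snd c p)) e1 e2 e3 \<and>
     symmetry_group (h (snd c p)) (K (snd c p)) (Sh (snd c p)) =
       {id, half_turn (h (snd c p)) e1, half_turn (h (snd c p)) e2, half_turn (h (snd c p)) e3}"
    using U(2) c(2) by blast
qed

theorem theorem3p1:
  fixes A :: "'m::{t2_space, second_countable_topology} chart set"
    and F \<xi> :: "'m \<Rightarrow> real^4"
  assumes "smooth_atlas A"
    and "affine_hypersurface A F \<xi>"
    and "locally_strictly_convex A F \<xi>"
  shows "pointwise_Z2xZ2_symmetry A F \<xi> \<longleftrightarrow>
         locally_affine_equivalent_to A F model_hypersurface"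
  using symmetry_imp_model[OF assms] model_imp_symmetry[OF assms] by blast

end
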